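(* Let $n\ge2$. There are constants $0<r_-<r_*<r_0<r_+$ depending only on $n$ such that every nonzero radial solution $\phi$ of $$\Delta\phi-\tfrac12\,y\cdot\nabla\phi+\tfrac12\,\phi=0\ \text{ in }\Omega:=\{\phi>0\},\qquad|\nabla\phi|=1\ \text{ on }\partial\Omega,\tag{P}$$ with connected positivity set $\Omega$ is one of the following: (i) $\phi_B$, the unique radial solution of (P) supported on a ball centered at the origin, whose radius is $r_0$; (ii) $\phi_A$, the unique radial solution of (P) supported on an annulus, the annulus being $A=\{r_-<|x|<r_+\}$; (iii) for some $r\ge r_*$, the radial solution $\phi_r$ of (P) supported on the complement of the ball of radius $r$ centered at the origin (such a $\phi_r$ exists for every $r\ge r_*$). Moreover, as $|x|\to\infty$, $$\phi_r(x)\sim\begin{cases}|x| & \text{if } r=r_*,\\ e^{|x|^2/4}\,|x|^{-(n+1)} & \text{if } r>r_*,\end{cases}$$ where $f\sim g$ means that $f/g$ tends to a positive finite constant. In dimension $n=1$, there is no annular solution as in (ii) (i.e. no radial solution of (P) with positivity set $\{r_-<|x|<r_+\}$, $0<r_-<r_+<\infty$), and the nonzero radial solution of (P) with bounded positivity set is unique.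
   Context: A solution of (P) is a nonnegative continuous function $\phi$ on $\mathbb{R}^n$ which satisfies the equation classically in the open set $\{\phi>0\}$, with $|\nabla\phi|=1$ attained on $\partial\{\phi>0\}$ from within $\{\phi>0\}$. It is radial if $\phi(y)=\phi(|y|)$. "Supported on" a set means that the positivity set $\{\phi>0\}$ is (the interior of) that set. *)

theory Defs
  imports "HOL-Analysis.Analysis"
begin

definition partial_deriv :: "'n::finite \<Rightarrow> (real^'n \<Rightarrow> real) \<Rightarrow> real^'n \<Rightarrow> real" where
  "partial_deriv i f x = frechet_derivative f (at x) (axis i 1)"

definition grad :: "(real^'n \<Rightarrow> real) \<Rightarrow> real^'n::finite \<Rightarrow> real^'n" where
  "grad f x = (\<chi> i. partial_deriv i f x)"

definition laplacian :: "(real^'n \<Rightarrow> real) \<Rightarrow> real^'n::finite \<Rightarrow> real" where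
  "laplacian f x = (\<Sum>i\<in>UNIV. partial_deriv i (partial_deriv i f) x)"

text \<open>Only meant for open sets, where being differentiable within the set is being differentiable.\<close>

definition C2_on :: "(real^'n::finite) set \<Rightarrow> (real^'n \<Rightarrow> real) \<Rightarrow> bool" where
  "C2_on S f \<longleftrightarrow> f differentiable_on S \<and>
     (\<forall>i. partial_deriv i f differentiable_on S) \<and>
     (\<forall>i j. continuous_on S (partial_deriv j (partial_deriv i f)))"

definition positivity_set :: "(real^'n::finite \<Rightarrow> real) \<Rightarrow> (real^'n) set" where
  "positivity_set \<phi> = {y. \<phi> y > 0}"

text \<open>The free boundary condition is a limit from inside the (open) positivity set; \<open>\<phi>\<close> need not be
  differentiable at the boundary points themselves.\<close>

definition solution_P :: "(real^'n::finite \<Rightarrow> real) \<Rightarrow> bool" where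
  "solution_P \<phi> \<longleftrightarrow>
     (\<forall>y. \<phi> y \<ge> 0) \<and> continuous_on UNIV \<phi> \<and>
     C2_on (positivity_set \<phi>) \<phi> \<and>
     (\<forall>y\<in>positivity_set \<phi>. laplacian \<phi> y - 1/2 * (y \<bullet> grad \<phi> y) + 1/2 * \<phi> y = 0) \<and>
     (\<forall>x\<in>frontier (positivity_set \<phi>).
        ((\<lambda>y. norm (grad \<phi> y)) \<longlongrightarrow> 1) (at x within positivity_set \<phi>))"

definition radial :: "(real^'n::finite \<Rightarrow> real) \<Rightarrow> bool" where
  "radial \<phi> \<longleftrightarrow> (\<exists>f :: real \<Rightarrow> real. \<forall>y. \<phi> y = f (norm y))"

definition radial_solution_P :: "(real^'n::finite \<Rightarrow> real) \<Rightarrow> bool" where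
  "radial_solution_P \<phi> \<longleftrightarrow> solution_P \<phi> \<and> radial \<phi>"

definition annulus :: "real \<Rightarrow> real \<Rightarrow> (real^'n::finite) set" where
  "annulus a b = {x. a < norm x \<and> norm x < b}"

text \<open>Weaker than the library's \<open>asymp_equiv\<close>: the quotient may tend to any positive constant.\<close>

definition sim_at_infinity :: "(real^'n::finite \<Rightarrow> real) \<Rightarrow> (real^'n \<Rightarrow> real) \<Rightarrow> bool" where
  "sim_at_infinity f g \<longleftrightarrow> (\<exists>c>0. ((\<lambda>x. f x / g x) \<longlongrightarrow> c) at_infinity)"

end

theory Submission
  imports Defs "HOL-Real_Asymp.Real_Asymp"
begin

text \<open>
  In the variable \<open>s = |y|\<^sup>2/4\<close> the radial equation is Kummer's equation
  \<open>s F'' + (b - s) F' + F/2 = 0\<close> with \<open>b = n/2\<close>, and the radial slope is \<open>sqrt s * F'\<close>. A basis of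
  solutions is the entire function \<open>B = M(-1/2, b, s)\<close>, decreasing with one zero \<open>s0\<close>, and the
  solution \<open>U\<close> of growth \<open>sqrt s\<close>, increasing with one zero \<open>s_star < s0\<close> and, for \<open>n \<ge> 2\<close>, tending to
  \<open>-\<infinity>\<close> at 0. The quotient \<open>rho = U/B\<close> is increasing on either side of \<open>s0\<close>, which gives the sign
  pattern of every solution: a solution with a zero \<open>a \<ge> s_star\<close> has no further zero to the right,
  and one with a zero \<open>a < s_star\<close> has exactly one, beyond \<open>s0\<close>.

  An annulus is a pair of consecutive zeros with equal slopes. Existence follows by comparing the
  limits \<open>a \<rightarrow> 0\<close> and \<open>a \<rightarrow> s_star\<close>. For uniqueness, in the radial variable \<open>r\<close> and with
  \<open>p = (n - 1)/r - r/2\<close>, the quantity \<open>(f' + p f)\<^sup>2 + (1 + (n - 1)/r\<^sup>2) f\<^sup>2\<close> equals \<open>f'\<^sup>2\<close> at the zeros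
  of \<open>f\<close>, and its derivative is \<open>f\<^sup>2\<close> times a function that changes sign once, from negative to
  positive, at a point inside every annulus. Two annular solutions scaled to agree at that point
  are ordered on both sides of it, so they cannot both have equal slopes at their ends.
\<close>

section \<open>Kummer's function and its derivatives\<close>

text \<open>The two bounds \<open>s_star <= b - 1/2\<close> and \<open>b < s0\<close> hold the
  argument together: \<open>psi\<close> changes sign between \<open>b - 1/2\<close> and
  \<open>b\<close>, hence inside every annulus. The first is radial concavity of \<open>U\<close>
  read at its zero, the second a consequence of the signs in the power series of \<open>B\<close>.
  Existence of the annulus meets one obstacle: as the inner zero \<open>a\<close> tends to 0, the
  reciprocal slopes \<open>flux a\<close> and \<open>flux e\<close> at both ends tend to 0, so their
  limits decide nothing. Multiplication by the common value \<open>rho a = rho e\<close> turns them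
  into \<open>uflux a\<close>, which still tends to 0, and \<open>uflux e\<close>, which tends to
  the positive number \<open>uflux s0\<close>. Asymptotics come from the limit of one bounded
  increasing function instead of Gamma function identities, and the same function bounds the
  integral that defines \<open>U\<close> from both sides, giving its growth and its concavity. On
  the line \<open>sqrt s\<close>, that is \<open>|y| / 2\<close>, takes the place of
  \<open>U\<close>. It stays continuous at the origin, so differentiability there, and not mere
  continuity, has to exclude it.\<close>

locale kummer =
  fixes b :: real
  assumes half_le_b: "1/2 \<le> b"
begin

definition M_fps :: "real fps" where
  "M_fps = Abs_fps (\<lambda>k. pochhammer (-1/2) k / (pochhammer b k * fact k))"

definition B :: "real \<Rightarrow> real" where "B = eval_fps M_fps"
text \<open>With this sign \<open>K\<close> is positive on the half-line; it is the Kummer function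
  \<open>M(1/2, b + 1, s) / (2 * b)\<close>.\<close>

definition K :: "real \<Rightarrow> real" where "K = eval_fps (- fps_deriv M_fps)"
definition K1 :: "real \<Rightarrow> real" where "K1 = eval_fps (fps_deriv (- fps_deriv M_fps))"

lemma b_pos: "0 < b"
  using half_le_b by simp

lemma M_fps_nth_Suc:
  "fps_nth M_fps (Suc k) * (b + real k) * (real k + 1) = (real k - 1/2) * fps_nth M_fps k"
proof -
  have "pochhammer (-1/2) k * (real k - 1/2) / (pochhammer b k * (b + real k) * ((real k + 1) * fact k))
      * (b + real k) * (real k + 1) = (real k - 1/2) * (pochhammer (-1/2) k / (pochhammer b k * fact k))"
  proof -
    have "b + real k \<noteq> 0" "real k + 1 \<noteq> 0" using b_pos by linarith+
    then show ?thesis by (simp add: divide_simps)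
  qed
  then show ?thesis by (simp add: M_fps_def pochhammer_Suc add.commute)
qed

lemma M_fps_0: "fps_nth M_fps 0 = 1"
  by (simp add: M_fps_def)

text \<open>In \<open>pochhammer (-1/2) k\<close> only the first factor is negative. Positivity of
  \<open>K1\<close>, hence monotonicity of \<open>K\<close> and concavity of \<open>B\<close>, rests
  on this.\<close>

lemma M_fps_Suc_neg: "fps_nth M_fps (Suc k) < 0"
proof (induction k)
  case 0
  show ?case using b_pos by (simp add: M_fps_def pochhammer_Suc)
next
  case (Suc k)
  have p: "0 < (b + real (Suc k)) * (real (Suc k) + 1)" using b_pos by simp
  have "fps_nth M_fps (Suc (Suc k)) * ((b + real (Suc k)) * (real (Suc k) + 1)) < 0"
    using M_fps_nth_Suc[of "Suc k"] Suc.IH by (simp add: mult_pos_neg mult.assoc)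
  with p show ?case by (meson mult_less_0_iff not_less_iff_gr_or_eq)
qed

text \<open>One step of the recurrence contributes the factor
  \<open>|k - 1/2| / ((b + k) * (k + 1))\<close>, at most \<open>1 / (k + 1)\<close>; for
  \<open>k = 0\<close> this is exactly \<open>1/2 <= b\<close>. The series is thus dominated by that
  of \<open>exp\<close>.\<close>

lemma abs_M_fps_le: "\<bar>fps_nth M_fps k\<bar> \<le> 1 / fact k"
proof (induction k)
  case 0
  show ?case by (simp add: M_fps_0)
next
  case (Suc k)
  have bk: "0 < b + real k" using b_pos by simp
  have "\<bar>fps_nth M_fps (Suc k)\<bar> * ((b + real k) * (real k + 1)) = \<bar>real k - 1/2\<bar> * \<bar>fps_nth M_fps k\<bar>"
    using arg_cong[OF M_fps_nth_Suc[of k], of abs] bk by (simp add: abs_mult mult.assoc)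
  also have "\<dots> \<le> (b + real k) * (1 / fact k)"
    using Suc.IH half_le_b by (intro mult_mono) auto
  finally have "(b + real k) * (\<bar>fps_nth M_fps (Suc k)\<bar> * (real k + 1)) \<le> (b + real k) * (1 / fact k)"
    by (simp add: ac_simps)
  then have "\<bar>fps_nth M_fps (Suc k)\<bar> * (real k + 1) \<le> 1 / fact k"
    using bk by (rule mult_left_le_imp_le)
  then have "\<bar>fps_nth M_fps (Suc k)\<bar> \<le> 1 / fact k / (real k + 1)"
    by (subst pos_le_divide_eq) auto
  also have "\<dots> = 1 / fact (Suc k)" by (simp add: add.commute)
  finally show ?case .
qed

lemma M_fps_conv_radius: "fps_conv_radius M_fps = \<infinity>"
  unfolding fps_conv_radius_def
proof (rule conv_radius_inftyI'', rule summable_comparison_test)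
  fix z :: real
  have "norm (fps_nth M_fps n * z ^ n) \<le> inverse (fact n) * \<bar>z\<bar> ^ n" for n
    using mult_right_mono[OF abs_M_fps_le[of n], of "\<bar>z\<bar> ^ n"]
    by (simp add: abs_mult power_abs divide_inverse)
  then show "\<exists>N. \<forall>n\<ge>N. norm (fps_nth M_fps n * z ^ n) \<le> inverse (fact n) * \<bar>z\<bar> ^ n" by blast
  show "summable (\<lambda>n. inverse (fact n) * \<bar>z\<bar> ^ n)" by (rule summable_exp)
qed

lemma conv_radius_deriv_infty:
  fixes f :: "real fps"
  assumes "fps_conv_radius f = \<infinity>"
  shows "fps_conv_radius (fps_deriv f) = \<infinity>" "fps_conv_radius (- f) = \<infinity>"
  using fps_conv_radius_deriv[of f] assms by (auto simp: fps_conv_radius_uminus)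

lemmas M_radii = M_fps_conv_radius conv_radius_deriv_infty

lemma B_deriv: "(B has_real_derivative - K s) (at s)"
proof -
  have "- K s = eval_fps (fps_deriv M_fps) s"
    by (simp add: K_def eval_fps_minus M_radii)
  then show ?thesis
    unfolding B_def using has_field_derivative_eval_fps[of s M_fps UNIV] by (simp add: M_radii)
qed

lemma K_deriv: "(K has_real_derivative K1 s) (at s)"
  unfolding K_def K1_def by (rule has_field_derivative_eval_fps) (simp add: M_radii)

lemma continuous_on_BK: "continuous_on S B" "continuous_on S K" "continuous_on S K1"
proof -
  have "\<exists>d. (K1 has_real_derivative d) (at s)" for s
    unfolding K1_def by (rule exI, rule has_field_derivative_eval_fps) (simp add: M_radii)
  then have "isCont K1 s" for s by (meson DERIV_isCont)
  then show "continuous_on S B" "continuous_on S K" "continuous_on S K1"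
    using DERIV_isCont[OF B_deriv] DERIV_isCont[OF K_deriv]
    by (auto simp: continuous_at_imp_continuous_on)
qed

text \<open>Kummer's equation is the coefficient recurrence. It is kept solved for
  \<open>s * K1 s\<close>, so that its values at 0 and at \<open>b\<close> give \<open>K 0\<close>
  and the sign of \<open>B b\<close>.\<close>

lemma B_ode: "s * K1 s = (s - b) * K s + B s / 2"
proof -
  let ?d = "fps_deriv M_fps"
  have "fps_X * fps_deriv ?d + fps_const b * ?d - fps_X * ?d + fps_const (1/2) * M_fps = 0"
  proof (rule fps_ext)
    fix k
    have eq: "fps_nth M_fps (Suc k) * ((b + real k) * (real k + 1)) - (real k - 1/2) * fps_nth M_fps k = 0"
      using M_fps_nth_Suc[of k] by (simp add: mult.assoc)
    show "fps_nth (fps_X * fps_deriv ?d + fps_const b * ?d - fps_X * ?d + fps_const (1/2) * M_fps) k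
        = fps_nth 0 k"
      using eq by (cases k) (simp_all add: algebra_simps)
  qed
  then have "eval_fps (fps_X * fps_deriv ?d + fps_const b * ?d - fps_X * ?d + fps_const (1/2) * M_fps) s = 0"
    by simp
  moreover have rad: "fps_conv_radius (fps_X * fps_deriv ?d) = \<infinity>" "fps_conv_radius (fps_const b * ?d) = \<infinity>"
    "fps_conv_radius (fps_X * ?d) = \<infinity>" "fps_conv_radius (fps_const (1/2) * M_fps) = \<infinity>"
    using fps_conv_radius_mult[of fps_X "fps_deriv ?d"] fps_conv_radius_mult[of "fps_const b" ?d]
      fps_conv_radius_mult[of fps_X ?d] fps_conv_radius_mult[of "fps_const (1/2)" M_fps]
    by (auto simp: M_radii)
  moreover have "fps_conv_radius (fps_X * fps_deriv ?d + fps_const b * ?d) = \<infinity>"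
    "fps_conv_radius (fps_X * fps_deriv ?d + fps_const b * ?d - fps_X * ?d) = \<infinity>"
    using fps_conv_radius_add[of "fps_X * fps_deriv ?d" "fps_const b * ?d"]
      fps_conv_radius_diff[of "fps_X * fps_deriv ?d + fps_const b * ?d" "fps_X * ?d"] rad
    by auto
  ultimately have "s * eval_fps (fps_deriv ?d) s + b * eval_fps ?d s - s * eval_fps ?d s
      + 1/2 * eval_fps M_fps s = 0"
    by (simp add: eval_fps_add eval_fps_diff eval_fps_mult M_radii)
  moreover have "K s = - eval_fps ?d s" "K1 s = - eval_fps (fps_deriv ?d) s"
    by (simp_all add: K_def K1_def eval_fps_minus M_radii)
  ultimately show ?thesis by (simp add: B_def algebra_simps)
qed

lemma B_0: "B 0 = 1"
  by (simp add: B_def eval_fps_at_0 M_fps_0)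

lemma K_0: "K 0 = 1 / (2 * b)"
proof -
  have "K 0 * (2 * b) = 1" using B_ode[of 0] by (simp add: B_0 ac_simps)
  then show ?thesis using b_pos by (subst nonzero_eq_divide_eq) auto
qed

lemma K1_pos:
  assumes "0 \<le> s" shows "0 < K1 s"
proof -
  let ?f = "fps_deriv (- fps_deriv M_fps)"
  have pos: "0 < fps_nth ?f k" for k
    using M_fps_Suc_neg[of "Suc k"] by (simp add: mult_less_0_iff mult_pos_neg)
  have "0 \<le> fps_nth ?f k * s ^ k" for k
    using pos[of k] assms by (intro mult_nonneg_nonneg zero_le_power less_imp_le[OF pos]) auto
  then have "(\<Sum>k<Suc 0. fps_nth ?f k * s ^ k) \<le> K1 s"
    unfolding K1_def eval_fps_def
    by (intro sum_le_suminf summable_fps) (simp_all add: M_radii del: fps_neg_nth fps_deriv_nth)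
  with pos[of 0] show ?thesis by simp
qed

lemma K_mono:
  assumes "0 \<le> s" "s \<le> t" shows "K s \<le> K t"
proof (rule DERIV_nonneg_imp_nondecreasing[OF assms(2)])
  fix x assume "s \<le> x"
  then have "0 \<le> K1 x" using K1_pos[of x] assms(1) by simp
  then show "\<exists>y. (K has_real_derivative y) (at x) \<and> 0 \<le> y" using K_deriv by blast
qed

lemma K_pos:
  assumes "0 \<le> s" shows "0 < K s"
proof -
  have "0 < 1 / (2 * b)" using b_pos by simp
  also have "\<dots> \<le> K s" using K_mono[of 0 s] assms by (simp add: K_0)
  finally show ?thesis .
qed

lemma B_strict_antimono:
  assumes "0 \<le> s" "s < t" shows "B t < B s"
proof (rule DERIV_neg_imp_decreasing[OF assms(2)])
  fix x assume "s \<le> x"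
  then have "- K x < 0" using K_pos[of x] assms(1) by simp
  then show "\<exists>y. (B has_real_derivative y) (at x) \<and> y < 0" using B_deriv by blast
qed

lemma B_at_b_pos: "0 < B b"
proof -
  have "B b = 2 * (b * K1 b)" using B_ode[of b] by simp
  then show ?thesis using K1_pos[of b] b_pos by simp
qed

text \<open>\<open>B\<close> is concave, so it lies below its tangent \<open>1 - s / (2 * b)\<close>
  at 0 and is nonpositive at \<open>2 * b\<close>. Having the zero beyond \<open>b\<close> later
  puts the sign change of \<open>psi\<close> to the left of \<open>s0\<close>.\<close>

lemma ex1_B_zero: "\<exists>s. b < s \<and> B s = 0"
proof -
  have "0 < 2 * b" using b_pos by simp
  from MVT2[OF this, of B "\<lambda>s. - K s"] obtain z
    where z: "0 < z" "z < 2*b" "B (2*b) - 1 = 2*b * (- K z)"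
    using B_deriv by (auto simp: B_0)
  have "2 * b * K 0 \<le> 2 * b * K z"
    using K_mono[of 0 z] z b_pos by (intro mult_left_mono) auto
  then have "1 \<le> 2 * b * K z" using b_pos by (simp add: K_0)
  with z have "B (2*b) \<le> 0" by simp
  moreover have "isCont B s" for s using B_deriv by (rule DERIV_isCont)
  ultimately obtain s where "b \<le> s" "B s = 0"
    using IVT2[of B "2*b" 0 b] B_at_b_pos b_pos by auto
  moreover from this B_at_b_pos have "b \<noteq> s" by auto
  ultimately show ?thesis by (auto simp: less_le)
qed

definition s0 :: real where "s0 = (SOME s. b < s \<and> B s = 0)"

lemma b_less_s0: "b < s0" and B_s0: "B s0 = 0"
  using someI_ex[OF ex1_B_zero] by (auto simp: s0_def)

lemma s0_pos: "0 < s0"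
  using b_less_s0 b_pos by simp

lemma B_pos_iff: "0 \<le> s \<Longrightarrow> 0 < B s \<longleftrightarrow> s < s0"
  and B_neg_iff: "0 \<le> s \<Longrightarrow> B s < 0 \<longleftrightarrow> s0 < s"
proof -
  assume s: "0 \<le> s"
  have 1: "s < s0 \<Longrightarrow> 0 < B s" and 2: "s0 < s \<Longrightarrow> B s < 0"
    using B_strict_antimono[OF s, of s0] B_strict_antimono[of s0 s] B_s0 s0_pos by auto
  show "0 < B s \<longleftrightarrow> s < s0" "B s < 0 \<longleftrightarrow> s0 < s"
    using 1 2 B_s0 by (cases s s0 rule: linorder_cases; simp; fail)+
qed

text \<open>Integrating factor: a solution satisfies \<open>(W * F')' = - W * F / (2 * s)\<close>,
  and \<open>W\<close> times the Wronskian of two solutions is constant.\<close>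

definition W :: "real \<Rightarrow> real" where "W s = s powr b * exp (- s)"

lemma W_pos: "0 < s \<Longrightarrow> 0 < W s"
  by (simp add: W_def)

lemma powr_deriv:
  assumes "0 < s" shows "((\<lambda>s. s powr a) has_real_derivative a * s powr a / s) (at s)"
  using has_real_derivative_powr[OF assms, of a] assms by (simp add: powr_diff)

lemma W_deriv:
  assumes "0 < s" shows "(W has_real_derivative W s * (b / s - 1)) (at s)"
  unfolding W_def
  by (rule derivative_eq_intros powr_deriv refl assms)+ (use assms in \<open>simp add: field_simps\<close>)

end

section \<open>A second solution and the behaviour at infinity\<close>

lemma mono_bounded_tendsto_at_top:
  fixes f :: "real \<Rightarrow> real"
  assumes mono: "\<And>x y. a < x \<Longrightarrow> x \<le> y \<Longrightarrow> f x \<le> f y" and bdd: "\<And>x. a < x \<Longrightarrow> f x \<le> C"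
  obtains l where "(f \<longlongrightarrow> l) at_top" "\<And>x. a < x \<Longrightarrow> f x \<le> l"
proof
  define l where "l = (SUP x\<in>{a<..}. f x)"
  have bd: "bdd_above (f ` {a<..})" using bdd by (intro bdd_aboveI2) auto
  show le: "f x \<le> l" if "a < x" for x
    unfolding l_def using bd that by (intro cSUP_upper) auto
  show "(f \<longlongrightarrow> l) at_top"
  proof (rule increasing_tendsto)
    show "\<forall>\<^sub>F x in at_top. f x \<le> l"
      using le by (intro eventually_mono[OF eventually_gt_at_top[of a]])
    fix y assume "y < l"
    then obtain x0 where x0: "a < x0" "y < f x0"
      using less_cSUP_iff[OF _ bd, of y] unfolding l_def by auto
    show "\<forall>\<^sub>F x in at_top. y < f x"
      using less_le_trans[OF x0(2) mono[OF x0(1)]]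
      by (intro eventually_mono[OF eventually_ge_at_top[of x0]])
  qed
qed

lemma DERIV_nonneg_mono_pos:
  fixes f :: "real \<Rightarrow> real"
  assumes "\<And>x. s \<le> x \<Longrightarrow> x \<le> t \<Longrightarrow> (f has_real_derivative f' x) (at x)"
    and "\<And>x. s \<le> x \<Longrightarrow> x \<le> t \<Longrightarrow> 0 \<le> f' x" and "s \<le> t"
  shows "f s \<le> f t"
  using assms(3) by (rule DERIV_nonneg_imp_nondecreasing) (use assms in blast)

context kummer
begin

text \<open>In the radial variable, \<open>T\<close> is minus the second derivative of \<open>B\<close>, and \<open>Q\<close> is \<open>T\<close> times the weight
  \<open>r\<^sup>n\<^sup>-\<^sup>1 * exp (- r\<^sup>2/4)\<close> of the equation, up to a constant. The equation for the radial derivative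
  shows that \<open>Q\<close> increases; its limit \<open>l\<close> controls all asymptotics.\<close>

definition T :: "real \<Rightarrow> real" where "T s = s * K1 s + K s / 2"
definition Q :: "real \<Rightarrow> real" where "Q s = W s / sqrt s * T s"
text \<open>Reciprocal radial slope of \<open>- B\<close>. Its derivative is \<open>- Q\<close>
  times the integrand that defines \<open>J\<close> below, so bounds on \<open>Q\<close> become
  bounds on \<open>J\<close>.\<close>

definition G :: "real \<Rightarrow> real" where "G s = 1 / (sqrt s * K s)"

lemma T_pos: "0 < s \<Longrightarrow> 0 < T s"
  using K1_pos[of s] K_pos[of s] by (simp add: T_def add_pos_pos)

lemma Q_pos: "0 < s \<Longrightarrow> 0 < Q s"
  by (simp add: Q_def T_pos W_pos)

lemma G_pos: "0 < s \<Longrightarrow> 0 < G s"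
  by (simp add: G_def K_pos)

lemma T_deriv: "(T has_real_derivative K s / 2 + (s - b + 1/2) * K1 s) (at s)"
proof -
  have "T = (\<lambda>s. (s - b + 1/2) * K s + B s / 2)"
    using B_ode by (auto simp: T_def algebra_simps)
  then show ?thesis
    by (auto intro!: derivative_eq_intros K_deriv B_deriv)
qed

lemma sqrt_deriv: "0 < s \<Longrightarrow> (sqrt has_real_derivative sqrt s / (2 * s)) (at s)"
  using DERIV_real_sqrt[of s] sqrt_divide_self_eq[of s]
  by (metis divide_divide_eq_left less_imp_le mult.commute times_divide_eq_right mult_1 divide_inverse)

text \<open>The factor \<open>2 * b - 1\<close> is \<open>n - 1\<close>: on the line
  \<open>Q\<close> is constant, in higher dimension it increases.\<close>

lemma Q_deriv:
  assumes "0 < s"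
  shows "(Q has_real_derivative W s / sqrt s * ((2 * b - 1) / (4 * s) * K s)) (at s)"
proof -
  have "(Q has_real_derivative (W s * (b / s - 1) * sqrt s - W s * (sqrt s / (2 * s))) / (sqrt s * sqrt s) * T s
      + (K s / 2 + (s - b + 1/2) * K1 s) * (W s / sqrt s)) (at s)"
    unfolding Q_def using assms
    by (intro DERIV_mult DERIV_divide W_deriv T_deriv sqrt_deriv) auto
  moreover have "(W s * (b / s - 1) * sqrt s - W s * (sqrt s / (2 * s))) / (sqrt s * sqrt s)
    = W s / sqrt s * (b / s - 1 - 1 / (2 * s))"
  proof -
    have "(w * c * q - w * (q / (2 * s))) / (q * q) = w / q * (c - 1 / (2 * s))" if "0 < q" for w c q
      using assms that by (simp add: field_simps)
    from this[of "sqrt s"] show ?thesis using assms by simp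
  qed
  moreover have "(b / s - 1 - 1 / (2 * s)) * T s + (K s / 2 + (s - b + 1/2) * K1 s) = (2 * b - 1) / (4 * s) * K s"
    using assms by (simp add: T_def field_simps)
  moreover have "x * c * t + r * x = x * (c * t + r)" for x c t r :: real
    by (simp add: algebra_simps)
  ultimately show ?thesis by (simp only:)
qed

lemma Q_mono:
  assumes "0 < s" "s \<le> t" shows "Q s \<le> Q t"
  using _ _ assms(2)
proof (rule DERIV_nonneg_mono_pos)
  fix x assume x: "s \<le> x"
  then show "(Q has_real_derivative W x / sqrt x * ((2 * b - 1) / (4 * x) * K x)) (at x)"
    using assms by (intro Q_deriv) auto
  show "0 \<le> W x / sqrt x * ((2 * b - 1) / (4 * x) * K x)"
    using x assms half_le_b W_pos[of x] K_pos[of x] by (intro mult_nonneg_nonneg) auto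
qed

text \<open>Concavity of \<open>B\<close> gives \<open>B s >= - s * K s\<close>, and the equation
  then bounds \<open>s * K1 s\<close> from below. The purpose is to bound \<open>Q' / Q\<close> by
  \<open>(2 * b - 1) / s^2\<close>, which is integrable at infinity.\<close>

lemma K_le_T:
  assumes "4 * b \<le> s" shows "s * K s \<le> 4 * T s"
proof -
  have s: "0 < s" using assms b_pos by linarith
  from MVT2[OF s, of B "\<lambda>s. - K s"] obtain z where z: "0 < z" "z < s" "B s - 1 = s * (- K z)"
    using B_deriv by (auto simp: B_0)
  have "s * K z \<le> s * K s" using K_mono[of z s] z s by (intro mult_left_mono) auto
  with z have "- (s * K s) \<le> B s" by linarith
  then have "(s - b) * K s - s * K s / 2 \<le> s * K1 s" using B_ode[of s] by simp
  moreover have "s * K s / 4 \<le> (s - b) * K s - s * K s / 2"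
  proof -
    have "b * K s \<le> s / 4 * K s"
      using assms K_pos[of s] s by (intro mult_right_mono) auto
    then show ?thesis by (simp add: algebra_simps)
  qed
  ultimately have "s * K s / 4 \<le> s * K1 s" by linarith
  moreover have "4 * T s = 4 * (s * K1 s) + 2 * K s" by (simp add: T_def)
  ultimately show ?thesis using K_pos[of s] s by linarith
qed

lemma Q_bounded: "\<exists>C. \<forall>s>0. Q s \<le> C"
proof -
  \<comment> \<open>The exponent is the integral from \<open>s\<close> to infinity of the bound
    \<open>(2 * b - 1) / s^2\<close> on \<open>Q' / Q\<close>, so the product with \<open>Q\<close>
    decreases from \<open>4 * b\<close> on.\<close>
  let ?e = "\<lambda>s. exp ((2 * b - 1) / s)"
  let ?h = "\<lambda>s. Q s * ?e s"
  have dec: "?h s \<le> ?h (4 * b)" if "4 * b \<le> s" for s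
  proof (rule DERIV_nonpos_imp_nonincreasing[OF that])
    fix x assume x: "4 * b \<le> x"
    then have x0: "0 < x" using b_pos by linarith
    let ?d = "W x / sqrt x * ((2 * b - 1) / (4 * x) * K x)"
    have "(?h has_real_derivative ?d * ?e x + Q x * (?e x * (- ((2 * b - 1) / (x * x))))) (at x)"
    proof -
      have "((\<lambda>s. (2 * b - 1) / s) has_real_derivative - ((2 * b - 1) / (x * x))) (at x)"
        using x0 by (auto intro!: derivative_eq_intros simp: field_simps)
      from DERIV_mult[OF Q_deriv[OF x0] DERIV_fun_exp[OF this]] show ?thesis
        by (simp add: mult_ac)
    qed
    moreover have "?d \<le> Q x * ((2 * b - 1) / (x * x))"
    proof -
      have "K x / (4 * x) \<le> T x / (x * x)"
        using K_le_T[OF x] x0 by (simp add: field_simps)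
      then have "W x / sqrt x * ((2 * b - 1) * (K x / (4 * x))) \<le> W x / sqrt x * ((2 * b - 1) * (T x / (x * x)))"
        using x0 W_pos[of x] half_le_b by (intro mult_left_mono) auto
      then show ?thesis by (simp add: Q_def mult_ac)
    qed
    then have "?d * ?e x + Q x * (?e x * (- ((2 * b - 1) / (x * x)))) \<le> 0"
    proof -
      have gen: "d * e + q * (e * (- c)) \<le> 0" if "d \<le> q * c" "0 \<le> e" for d e q c :: real
        using mult_right_mono[OF that] by (simp add: mult_ac)
      show "?d \<le> Q x * ((2 * b - 1) / (x * x)) \<Longrightarrow> ?thesis"
        by (rule gen) auto
    qed
    ultimately show "\<exists>y. (?h has_real_derivative y) (at x) \<and> y \<le> 0" by blast
  qed
  have "Q s \<le> ?h (4 * b)" if "0 < s" for s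
  proof -
    have "Q s \<le> Q (max s (4 * b))" using that by (intro Q_mono) auto
    also have "\<dots> \<le> ?h (max s (4 * b))"
      using Q_pos[of "max s (4 * b)"] that half_le_b by simp
    also have "\<dots> \<le> ?h (4 * b)" by (rule dec) simp
    finally show ?thesis .
  qed
  then show ?thesis by blast
qed

lemma Q_limit: "\<exists>l. (Q \<longlongrightarrow> l) at_top \<and> (\<forall>s>0. Q s \<le> l)"
  using Q_bounded mono_bounded_tendsto_at_top[of 0 Q] Q_mono by metis

text \<open>Classically \<open>l = Gamma b / (2 * sqrt pi)\<close>; the limit takes the place of the
  connection formula.\<close>

definition l :: real where "l = (SOME l. (Q \<longlongrightarrow> l) at_top \<and> (\<forall>s>0. Q s \<le> l))"

lemma Q_tendsto: "(Q \<longlongrightarrow> l) at_top" and Q_le_l: "0 < s \<Longrightarrow> Q s \<le> l"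
  using someI_ex[OF Q_limit] unfolding l_def by blast+

lemma l_pos: "0 < l"
  using Q_pos[of 1] Q_le_l[of 1] by simp

lemma sqrt_K_deriv:
  assumes "0 < s" shows "((\<lambda>s. sqrt s * K s) has_real_derivative T s / sqrt s) (at s)"
proof (rule DERIV_cong[OF DERIV_mult[OF sqrt_deriv[OF assms] K_deriv]])
  have "K1 s * sqrt s = K1 s * s / sqrt s" using real_div_sqrt[of s] assms
    by (metis less_imp_le times_divide_eq_right)
  moreover have "sqrt s / (2 * s) = 1 / (2 * sqrt s)"
  proof -
    have "sqrt s / (2 * s) = (sqrt s / s) / 2" by simp
    also have "sqrt s / s = inverse (sqrt s)" using assms by (intro sqrt_divide_self_eq) simp
    also have "inverse (sqrt s) / 2 = 1 / (2 * sqrt s)" by (simp add: inverse_eq_divide)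
    finally show ?thesis .
  qed
  ultimately show "sqrt s / (2 * s) * K s + K1 s * sqrt s = T s / sqrt s"
    by (simp add: T_def add_divide_distrib mult_ac)
qed

lemma G_deriv:
  assumes "0 < s" shows "(G has_real_derivative - (Q s / (s * W s * (K s)\<^sup>2))) (at s)"
proof -
  have n: "sqrt s * K s \<noteq> 0" using assms K_pos[of s] by simp
  have "(G has_real_derivative - (T s / sqrt s) / (sqrt s * K s)\<^sup>2) (at s)"
    unfolding G_def
    by (rule derivative_eq_intros sqrt_K_deriv assms refl n)+ (simp add: power2_eq_square)
  moreover have "T s / sqrt s / (sqrt s * K s)\<^sup>2 = Q s / (s * W s * (K s)\<^sup>2)"
    using assms W_pos[of s] by (simp add: Q_def power_mult_distrib)
  ultimately show ?thesis by simp
qed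

section \<open>Growth of \<open>K\<close>, \<open>B\<close> and \<open>G\<close> at infinity\<close>

lemma exp_powr_at_top: "filterlim (\<lambda>s::real. s powr a * exp s) at_top at_top"
  by real_asymp

lemma exp_powr_deriv:
  assumes "0 < s" 
  shows "((\<lambda>s. s powr a * exp s) has_real_derivative s powr a * exp s * (1 + a / s)) (at s)"
  by (rule DERIV_cong[OF DERIV_mult[OF powr_deriv[OF assms] DERIV_exp]])
    (use assms in \<open>simp add: field_simps\<close>)

lemma one_plus_div_tendsto: "((\<lambda>s. 1 + a / s) \<longlongrightarrow> 1) at_top" for a :: real
  by real_asymp

text \<open>After multiplication by \<open>sqrt s\<close> the quotient of the derivatives is
  \<open>Q s / (1 - b / s)\<close>; this explains the normalisation of \<open>Q\<close>.\<close>

lemma K_asymp: "((\<lambda>s. K s / (s powr (- b - 1/2) * exp s)) \<longlongrightarrow> l) at_top"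
proof -
  have "((\<lambda>s. sqrt s * K s / (s powr (- b) * exp s)) \<longlongrightarrow> l) at_top"
  proof (rule lhospital_at_top_at_top[OF exp_powr_at_top])
    have ev: "\<forall>\<^sub>F s in at_top. (0::real) < s \<and> b < s"
      by (intro eventually_conj eventually_gt_at_top)
    show "\<forall>\<^sub>F s in at_top. s powr (- b) * exp s * (1 + (- b) / s) \<noteq> 0"
      using ev by eventually_elim (auto simp: field_simps)
    show "\<forall>\<^sub>F s in at_top. ((\<lambda>s. sqrt s * K s) has_real_derivative T s / sqrt s) (at s)"
      using ev by eventually_elim (auto intro: sqrt_K_deriv)
    show "\<forall>\<^sub>F s in at_top. ((\<lambda>s. s powr (- b) * exp s) has_real_derivative s powr (- b) * exp s * (1 + (- b) / s)) (at s)"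
      using ev by eventually_elim (rule exp_powr_deriv, simp)
    have "((\<lambda>s. Q s / (1 + (- b) / s)) \<longlongrightarrow> l / 1) at_top"
      by (intro tendsto_divide Q_tendsto one_plus_div_tendsto) simp
    moreover have "\<forall>\<^sub>F s in at_top. Q s / (1 + (- b) / s)
        = T s / sqrt s / (s powr (- b) * exp s * (1 + (- b) / s))"
      using ev by eventually_elim (simp add: Q_def W_def powr_minus exp_minus divide_inverse)
    ultimately show "((\<lambda>s. T s / sqrt s / (s powr (- b) * exp s * (1 + (- b) / s))) \<longlongrightarrow> l) at_top"
      by (simp add: tendsto_cong)
  qed
  moreover have "\<forall>\<^sub>F s in at_top. sqrt s * K s / (s powr (- b) * exp s) = K s / (s powr (- b - 1/2) * exp s)"
    using eventually_gt_at_top[of 0]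
  proof eventually_elim
    case (elim s)
    then have "sqrt s * s powr (- b - 1/2) = s powr (- b)"
      by (simp add: powr_half_sqrt[symmetric] flip: powr_add)
    then have "s powr (- b) * exp s = sqrt s * (s powr (- b - 1/2) * exp s)" by simp
    then show ?case using elim by simp
  qed
  ultimately show ?thesis by (simp add: tendsto_cong)
qed

lemma B_asymp: "((\<lambda>s. B s / (s powr (- b - 1/2) * exp s)) \<longlongrightarrow> - l) at_top"
proof (rule lhospital_at_top_at_top[OF exp_powr_at_top])
  let ?a = "- b - 1/2"
  have ev: "\<forall>\<^sub>F s in at_top. (0::real) < s \<and> b + 1/2 < s"
    by (intro eventually_conj eventually_gt_at_top)
  show "\<forall>\<^sub>F s in at_top. s powr ?a * exp s * (1 + ?a / s) \<noteq> 0"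
    using ev
  proof eventually_elim
    case (elim s)
    then have "0 < 1 + ?a / s" by (simp add: field_simps)
    with elim show ?case by simp
  qed
  show "\<forall>\<^sub>F s in at_top. (B has_real_derivative - K s) (at s)"
    by (simp add: B_deriv)
  show "\<forall>\<^sub>F s in at_top. ((\<lambda>s. s powr ?a * exp s) has_real_derivative s powr ?a * exp s * (1 + ?a / s)) (at s)"
    using ev by eventually_elim (rule exp_powr_deriv, simp)
  have "((\<lambda>s. - (K s / (s powr ?a * exp s)) / (1 + ?a / s)) \<longlongrightarrow> - l / 1) at_top"
    by (intro tendsto_divide tendsto_minus K_asymp one_plus_div_tendsto) simp
  then show "((\<lambda>s. - K s / (s powr ?a * exp s * (1 + ?a / s))) \<longlongrightarrow> - l) at_top"
    by simp
qed

lemma G_tendsto: "(G \<longlongrightarrow> 0) at_top"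
proof (rule tendsto_sandwich[of "\<lambda>_. 0"])
  show "\<forall>\<^sub>F s in at_top. 0 \<le> G s"
    using eventually_gt_at_top[of 0] by eventually_elim (simp add: G_pos less_imp_le)
  show "\<forall>\<^sub>F s in at_top. G s \<le> (1 / K 0) / sqrt s"
    using eventually_gt_at_top[of 0]
  proof eventually_elim
    case (elim s)
    have "1 / K s \<le> 1 / K 0" using K_mono[of 0 s] K_pos[of 0] elim by (simp add: frac_le)
    then have "1 / K s / sqrt s \<le> 1 / K 0 / sqrt s" using elim by (intro divide_right_mono) auto
    then show ?case by (simp add: G_def mult.commute)
  qed
  show "((\<lambda>s. 1 / K 0 / sqrt s) \<longlongrightarrow> 0) at_top" by real_asymp
qed simp

text \<open>Every solution of Kummer's equation with \<open>n \<ge> 2\<close> has a zero, but \<open>K = - B'\<close> has none on the half-line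
  and solves the differentiated equation, so reduction of order is applied there: \<open>U' = K * J\<close>, and
  \<open>U\<close> is recovered from \<open>U'\<close> by the equation itself.\<close>

lemma ex_J: "\<exists>J. (\<forall>s>0. (J has_real_derivative - (1 / (s * W s * (K s)\<^sup>2))) (at s)) \<and>
  (\<forall>s>0. G s / l \<le> J s \<and> J s \<le> G s / Q s)"
proof -
  let ?f = "\<lambda>s. 1 / (s * W s * (K s)\<^sup>2)"
  have cont: "isCont ?f x" if x: "0 < x" for x
    using DERIV_isCont[OF W_deriv[OF x]] DERIV_isCont[OF K_deriv] x W_pos[OF x] K_pos[of x]
    by (intro continuous_intros) auto
  have "\<exists>F. \<forall>x. 0 < ereal x \<longrightarrow> ereal x < \<infinity> \<longrightarrow> (F has_vector_derivative ?f x) (at x)"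
    by (rule einterval_antiderivative) (use cont in \<open>auto simp: zero_ereal_def\<close>)
  then obtain F where F: "(F has_real_derivative ?f s) (at s)" if "0 < s" for s
    by (auto simp: has_real_derivative_iff_has_vector_derivative)
  have f_pos: "0 < ?f s" if "0 < s" for s
    using that W_pos[of s] K_pos[of s] by simp
  \<comment> \<open>With \<open>f\<close> the integrand, \<open>G' = - Q * f\<close> and
    \<open>Q s <= Q <= l\<close> beyond \<open>s\<close>. Hence \<open>F + G / Q s\<close> decreases
    and \<open>F + G / l\<close> increases there, which yields convergence of \<open>F\<close> and
    both bounds on its tail.\<close>
  have up: "F x \<le> F s + G s / Q s" if "0 < s" "s \<le> x" for s x
  proof -
    have "- F s - G s / Q s \<le> - F x - G x / Q s"
    proof (rule DERIV_nonneg_mono_pos[where f = "\<lambda>s'. - F s' - G s' / Q s" and f' = "\<lambda>y. - ?f y + Q y / Q s * ?f y"])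
      fix y assume y: "s \<le> y"
      with that have y0: "0 < y" by simp
      show "((\<lambda>s'. - F s' - G s' / Q s) has_real_derivative - ?f y + Q y / Q s * ?f y) (at y)"
        by (rule derivative_eq_intros F G_deriv y0 refl)+ (use Q_pos[OF that(1)] in auto)
      have "1 \<le> Q y / Q s" using Q_mono[OF that(1) y] Q_pos[OF that(1)] by simp
      from mult_right_mono[OF this, of "?f y"] f_pos[OF y0]
      show "0 \<le> - ?f y + Q y / Q s * ?f y" by linarith
    qed (rule that)
    moreover have "0 \<le> G x / Q s" using that G_pos[of x] Q_pos[of s] by simp
    ultimately show ?thesis by linarith
  qed
  have low: "F s + G s / l - G x / l \<le> F x" if "0 < s" "s \<le> x" for s x
  proof -
    have "F s + G s / l \<le> F x + G x / l"
    proof (rule DERIV_nonneg_mono_pos[where f = "\<lambda>s'. F s' + G s' / l" and f' = "\<lambda>y. ?f y - Q y / l * ?f y"])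
      fix y assume y: "s \<le> y"
      with that have y0: "0 < y" by simp
      show "((\<lambda>s'. F s' + G s' / l) has_real_derivative ?f y - Q y / l * ?f y) (at y)"
        by (rule derivative_eq_intros F G_deriv y0 refl)+ (use l_pos in auto)
      have "Q y / l \<le> 1" using Q_le_l[OF y0] l_pos by simp
      from mult_right_mono[OF this, of "?f y"] f_pos[OF y0]
      show "0 \<le> ?f y - Q y / l * ?f y" by linarith
    qed (rule that)
    then show ?thesis by simp
  qed
  have F_mono: "F s \<le> F x" if "0 < s" "s \<le> x" for s x
    using that f_pos F by (intro DERIV_nonneg_mono_pos[of s x F ?f]) (auto intro: less_imp_le)
  have "F x \<le> F 1 + G 1 / Q 1" if "0 < x" for x
    using up[of 1 x] F_mono[OF that, of 1] G_pos[of 1] Q_pos[of 1]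
    by (cases "1 \<le> x") (auto intro: order_trans simp: add_increasing2)
  with F_mono obtain L where L: "(F \<longlongrightarrow> L) at_top"
    by (rule mono_bounded_tendsto_at_top[of 0 F])
  have "L \<le> F s + G s / Q s" if "0 < s" for s
    using up[OF that] by (intro tendsto_upperbound[OF L] eventually_mono[OF eventually_ge_at_top[of s]]) auto
  moreover have "F s + G s / l \<le> L" if "0 < s" for s
  proof (rule tendsto_lowerbound)
    show "((\<lambda>x. F x + G x / l) \<longlongrightarrow> L) at_top"
      using tendsto_add[OF L tendsto_divide[OF G_tendsto tendsto_const[of l]]] l_pos by simp
    show "\<forall>\<^sub>F x in at_top. F s + G s / l \<le> F x + G x / l"
      using eventually_ge_at_top[of s] by eventually_elim (use low[OF that] in fastforce)
  qed simp
  \<comment> \<open>\<open>L - F\<close> is the integral from \<open>s\<close> to infinity.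
    Anchoring it at infinity is what selects the solution of slow growth.\<close>
  ultimately have "\<forall>s>0. ((\<lambda>s. L - F s) has_real_derivative - ?f s) (at s)"
    "\<forall>s>0. G s / l \<le> L - F s \<and> L - F s \<le> G s / Q s"
    by (auto intro!: derivative_eq_intros F simp: algebra_simps)
  then show ?thesis by blast
qed

definition J :: "real \<Rightarrow> real" where
  "J = (SOME J. (\<forall>s>0. (J has_real_derivative - (1 / (s * W s * (K s)\<^sup>2))) (at s)) \<and>
  (\<forall>s>0. G s / l \<le> J s \<and> J s \<le> G s / Q s))"

lemma J_deriv: "0 < s \<Longrightarrow> (J has_real_derivative - (1 / (s * W s * (K s)\<^sup>2))) (at s)"
  and J_ge: "0 < s \<Longrightarrow> G s / l \<le> J s" and J_le: "0 < s \<Longrightarrow> J s \<le> G s / Q s"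
  using someI_ex[OF ex_J] unfolding J_def by blast+

lemma J_pos: "0 < s \<Longrightarrow> 0 < J s"
  using J_ge[of s] G_pos[of s] l_pos by (meson divide_pos_pos less_le_trans)

text \<open>This is \<open>F = 2 * ((s - b) * F' - s * F'')\<close> with \<open>F' = K * J\<close>,
  simplified by \<open>B_ode\<close>. The normalisation of \<open>J\<close> makes the Wronskian with
  \<open>B\<close> equal to \<open>2 / W\<close>.\<close>

definition U :: "real \<Rightarrow> real" where "U s = 2 / (W s * K s) - B s * J s"
definition U1 :: "real \<Rightarrow> real" where "U1 s = K s * J s"
definition U2 :: "real \<Rightarrow> real" where "U2 s = K1 s * J s - 1 / (s * W s * K s)"

lemma U1_pos: "0 < s \<Longrightarrow> 0 < U1 s"
  by (simp add: U1_def J_pos K_pos)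

lemma U1_deriv:
  assumes "0 < s" shows "(U1 has_real_derivative U2 s) (at s)"
  unfolding U1_def U2_def
  by (rule derivative_eq_intros J_deriv K_deriv assms refl)+ 
    (use K_pos[of s] assms in \<open>simp add: power2_eq_square\<close>)

lemma U_ode:
  assumes "0 < s" shows "s * U2 s = (s - b) * U1 s - U s / 2"
proof -
  have "s * U2 s = (s * K1 s) * J s - 1 / (W s * K s)"
    using assms by (simp add: U2_def right_diff_distrib)
  also have "\<dots> = (s - b) * U1 s - (2 / (W s * K s) - B s * J s) / 2"
    unfolding B_ode U1_def by (simp add: field_split_simps)
  finally show ?thesis by (simp only: U_def)
qed

lemma U_deriv:
  assumes "0 < s" shows "(U has_real_derivative U1 s) (at s)"
proof -
  have K: "0 < K s" and W: "0 < W s" using assms K_pos W_pos by auto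
  have d: "(U has_real_derivative
     - (2 * (W s * (b / s - 1) * K s + W s * K1 s) / (W s * K s * (W s * K s)))
     - (- K s * J s + - (1 / (s * W s * (K s)\<^sup>2)) * B s)) (at s)"
  proof -
    have wk: "((\<lambda>s. W s * K s) has_real_derivative W s * (b / s - 1) * K s + W s * K1 s) (at s)"
      by (rule DERIV_cong[OF DERIV_mult[OF W_deriv[OF assms] K_deriv]]) (rule arg_cong2[where f="(+)"], rule refl, rule mult.commute)
    show ?thesis unfolding U_def
      by (rule DERIV_cong[OF DERIV_diff[OF DERIV_divide[OF DERIV_const[of 2] wk] DERIV_mult[OF B_deriv J_deriv[OF assms]]]])
        (use K W in \<open>simp_all only: mult_zero_left diff_0 minus_divide_left mult_eq_0_iff\<close>, simp_all)
  qed
  have e: "2 * (W s * (b / s - 1) * K s + W s * K1 s) / (W s * K s * (W s * K s)) = B s / (s * W s * (K s)\<^sup>2)"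
  proof -
    have "2 * (W s * (b / s - 1) * K s + W s * K1 s) * s = W s * (2 * (s * K1 s) - 2 * (s - b) * K s)"
      using assms by (simp add: field_simps)
    also have "\<dots> = W s * B s" unfolding B_ode by (simp add: algebra_simps)
    finally have "2 * (W s * (b / s - 1) * K s + W s * K1 s) = W s * B s / s"
      using assms by (metis nonzero_mult_div_cancel_right less_irrefl)
    then show ?thesis using K W assms by (simp add: power2_eq_square)
  qed
  show ?thesis using d unfolding e by (simp add: U1_def)
qed

lemma wronskian_U_B:
  assumes "0 < s" shows "U1 s * B s + U s * K s = 2 / W s"
  using K_pos[of s] assms by (simp add: U_def U1_def field_simps)

text \<open>The left side is the second radial derivative of \<open>U\<close>, and its sign is
  exactly the bound \<open>J s <= G s / Q s\<close>.\<close>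

lemma U_concave:
  assumes "0 < s" shows "s * U2 s + U1 s / 2 \<le> 0"
proof -
  have K: "0 < K s" and W: "0 < W s" and T: "0 < T s" using assms K_pos W_pos T_pos by auto
  have "s * U2 s + U1 s / 2 = T s * J s - 1 / (W s * K s)"
    using assms by (simp add: U2_def U1_def T_def algebra_simps)
  also have "T s * J s \<le> T s * (G s / Q s)"
    using J_le[OF assms] T by (intro mult_left_mono) auto
  also have "T s * (G s / Q s) = 1 / (W s * K s)"
    using K W T assms by (simp add: G_def Q_def field_simps)
  finally show ?thesis by simp
qed

lemma sqrt_U1_tendsto: "((\<lambda>s. sqrt s * U1 s) \<longlongrightarrow> 1 / l) at_top"
proof (rule tendsto_sandwich)
  show "\<forall>\<^sub>F s in at_top. 1 / l \<le> sqrt s * U1 s"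
    using eventually_gt_at_top[of 0]
  proof eventually_elim
    case (elim s)
    have "sqrt s * K s * (G s / l) \<le> sqrt s * K s * J s"
      using J_ge[OF elim] K_pos[of s] elim by (intro mult_left_mono) auto
    then show ?case using elim K_pos[of s] by (simp add: U1_def G_def)
  qed
  show "\<forall>\<^sub>F s in at_top. sqrt s * U1 s \<le> 1 / Q s"
    using eventually_gt_at_top[of 0]
  proof eventually_elim
    case (elim s)
    have "sqrt s * K s * J s \<le> sqrt s * K s * (G s / Q s)"
      using J_le[OF elim] K_pos[of s] elim by (intro mult_left_mono) auto
    then show ?case using elim K_pos[of s] by (simp add: U1_def G_def)
  qed
  show "((\<lambda>s. 1 / Q s) \<longlongrightarrow> 1 / l) at_top"
    using l_pos by (intro tendsto_intros Q_tendsto) auto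
qed simp

lemma U_asymp: "((\<lambda>s. U s / sqrt s) \<longlongrightarrow> 2 / l) at_top"
proof (rule lhospital_at_top_at_top[OF sqrt_at_top])
  have ev: "\<forall>\<^sub>F s in at_top. (0::real) < s" by (rule eventually_gt_at_top)
  show "\<forall>\<^sub>F s in at_top. sqrt s / (2 * s) \<noteq> 0"
    using ev by eventually_elim simp
  show "\<forall>\<^sub>F s in at_top. (U has_real_derivative U1 s) (at s)"
    using ev by eventually_elim (rule U_deriv)
  show "\<forall>\<^sub>F s in at_top. (sqrt has_real_derivative sqrt s / (2 * s)) (at s)"
    using ev by eventually_elim (rule sqrt_deriv)
  have "((\<lambda>s. 2 * (sqrt s * U1 s)) \<longlongrightarrow> 2 * (1 / l)) at_top"
    by (intro tendsto_mult_left sqrt_U1_tendsto)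
  moreover have "\<forall>\<^sub>F s in at_top. 2 * (sqrt s * U1 s) = U1 s / (sqrt s / (2 * s))"
    using ev by eventually_elim (simp add: field_simps)
  ultimately show "((\<lambda>s. U1 s / (sqrt s / (2 * s))) \<longlongrightarrow> 2 / l) at_top"
    by (simp add: tendsto_cong)
qed

end

section \<open>The solution space and the zeros of solutions\<close>

context kummer
begin

text \<open>The derivative is carried as \<open>F1\<close>, so that a profile known only where it is
  positive can be matched with a solution on the whole half-line.\<close>

definition ksol :: "real set \<Rightarrow> (real \<Rightarrow> real) \<Rightarrow> (real \<Rightarrow> real) \<Rightarrow> bool" where
  "ksol S F F1 \<longleftrightarrow> (\<forall>s\<in>S. (F has_real_derivative F1 s) (at s) \<and>
     (F1 has_real_derivative ((s - b) * F1 s - F s / 2) / s) (at s))"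

lemma ksolD:
  assumes "ksol S F F1" "s \<in> S"
  shows "(F has_real_derivative F1 s) (at s)"
    and "(F1 has_real_derivative ((s - b) * F1 s - F s / 2) / s) (at s)"
  using assms by (auto simp: ksol_def)

lemma ksol_mono: "ksol S F F1 \<Longrightarrow> S' \<subseteq> S \<Longrightarrow> ksol S' F F1"
  by (auto simp: ksol_def)

lemma ksol_lincomb:
  assumes "ksol S F F1" "ksol S H H1"
  shows "ksol S (\<lambda>s. x * F s + y * H s) (\<lambda>s. x * F1 s + y * H1 s)"
  unfolding ksol_def
proof (intro ballI conjI)
  fix s assume s: "s \<in> S"
  note d = ksolD[OF assms(1) s] ksolD[OF assms(2) s]
  show "((\<lambda>s. x * F s + y * H s) has_real_derivative x * F1 s + y * H1 s) (at s)"
    using d by (intro DERIV_add DERIV_cmult)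
  have "((\<lambda>s. x * F1 s + y * H1 s) has_real_derivative
      x * (((s - b) * F1 s - F s / 2) / s) + y * (((s - b) * H1 s - H s / 2) / s)) (at s)"
    using d by (intro DERIV_add DERIV_cmult)
  moreover have "x * (((s - b) * F1 s - F s / 2) / s) + y * (((s - b) * H1 s - H s / 2) / s)
      = ((s - b) * (x * F1 s + y * H1 s) - (x * F s + y * H s) / 2) / s"
    by (cases "s = 0") (simp_all add: field_simps)
  ultimately show "((\<lambda>s. x * F1 s + y * H1 s) has_real_derivative
      ((s - b) * (x * F1 s + y * H1 s) - (x * F s + y * H s) / 2) / s) (at s)" by simp
qed

lemma ksol_B: "ksol {0<..} B (\<lambda>s. - K s)"
  unfolding ksol_def
proof (intro ballI conjI)
  fix s :: real assume "s \<in> {0<..}"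
  then have s: "0 < s" by simp
  have "- K1 s * s = (s - b) * - K s - B s / 2" using B_ode[of s] by (simp add: mult.commute)
  then have "- K1 s = ((s - b) * - K s - B s / 2) / s" using s by (metis nonzero_mult_div_cancel_right less_irrefl)
  then show "((\<lambda>s. - K s) has_real_derivative ((s - b) * - K s - B s / 2) / s) (at s)"
    using DERIV_minus[OF K_deriv[of s]] by simp
qed (rule B_deriv)

lemma ksol_U: "ksol {0<..} U U1"
  unfolding ksol_def
proof (intro ballI conjI)
  fix s :: real assume "s \<in> {0<..}"
  then have s: "0 < s" by simp
  show "(U has_real_derivative U1 s) (at s)" using s by (rule U_deriv)
  have "U2 s = ((s - b) * U1 s - U s / 2) / s" using U_ode[OF s] s by (metis nonzero_mult_div_cancel_left less_irrefl)
  then show "(U1 has_real_derivative ((s - b) * U1 s - U s / 2) / s) (at s)"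
    using U1_deriv[OF s] by simp
qed

lemma wronskian_deriv:
  assumes "0 < s" "ksol S F F1" "ksol S H H1" "s \<in> S"
  shows "((\<lambda>s. W s * (F1 s * H s - F s * H1 s)) has_real_derivative 0) (at s)"
proof -
  note d = ksolD[OF assms(2,4)] ksolD[OF assms(3,4)]
  have "((\<lambda>s. W s * (F1 s * H s - F s * H1 s)) has_real_derivative
     W s * (b / s - 1) * (F1 s * H s - F s * H1 s) +
     (((s - b) * F1 s - F s / 2) / s * H s + H1 s * F1 s - (F1 s * H1 s + ((s - b) * H1 s - H s / 2) / s * F s)) * W s) (at s)"
    using d assms(1) by (intro DERIV_mult DERIV_diff W_deriv)
  moreover have "W s * (b / s - 1) * (F1 s * H s - F s * H1 s) +
     (((s - b) * F1 s - F s / 2) / s * H s + H1 s * F1 s - (F1 s * H1 s + ((s - b) * H1 s - H s / 2) / s * F s)) * W s = 0"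
    using assms(1) by (simp add: field_simps)
  ultimately show ?thesis by simp
qed

lemma wronskian_const:
  assumes "convex S" "S \<subseteq> {0<..}" "ksol S F F1" "ksol S H H1"
  obtains c where "\<And>s. s \<in> S \<Longrightarrow> W s * (F1 s * H s - F s * H1 s) = c"
proof -
  have "\<exists>c. \<forall>s\<in>S. W s * (F1 s * H s - F s * H1 s) = c"
  proof (rule has_field_derivative_zero_constant[OF assms(1)])
    fix s assume "s \<in> S"
    with assms(2) show "((\<lambda>s. W s * (F1 s * H s - F s * H1 s)) has_real_derivative 0) (at s within S)"
      by (intro has_field_derivative_at_within[OF wronskian_deriv[OF _ assms(3,4)]]) auto
  qed
  then show ?thesis using that by blast
qed

text \<open>Cramer's rule with two constant Wronskians as numerators. The second basis solution
  \<open>V\<close> is left open: it will be \<open>U\<close> or, on the line,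
  \<open>sqrt\<close>.\<close>

lemma ksol_representation:
  assumes S: "convex S" "S \<subseteq> {0<..}" and F: "ksol S F F1" and V: "ksol S V V1"
    and c: "\<And>s. s \<in> S \<Longrightarrow> V1 s * B s + V s * K s = c / W s" "c \<noteq> 0"
  obtains \<alpha> \<gamma> where "\<And>s. s \<in> S \<Longrightarrow> F s = \<alpha> * B s + \<gamma> * V s"
    "\<And>s. s \<in> S \<Longrightarrow> F1 s = \<gamma> * V1 s - \<alpha> * K s"
proof -
  obtain x where x: "\<And>s. s \<in> S \<Longrightarrow> W s * (F1 s * B s - F s * - K s) = x"
    using wronskian_const[OF S F ksol_mono[OF ksol_B S(2)]] by blast
  obtain y where y: "\<And>s. s \<in> S \<Longrightarrow> W s * (F1 s * V s - F s * V1 s) = y"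
    using wronskian_const[OF S F V] by blast
  show ?thesis
  proof
    fix s assume s: "s \<in> S"
    then have W: "W s \<noteq> 0" using S W_pos[of s] by auto
    have cs: "c = W s * (V1 s * B s + V s * K s)" using c(1)[OF s] W by simp
    have "c * F s = x * V s - y * B s"
      unfolding cs x[OF s, symmetric] y[OF s, symmetric] by (simp add: algebra_simps)
    then have "F s = (x * V s - y * B s) / c" using c(2) by (simp add: eq_divide_eq mult.commute)
    then show "F s = (- y / c) * B s + (x / c) * V s" by (simp add: diff_divide_distrib)
    have "c * F1 s = x * V1 s + y * K s"
      unfolding cs x[OF s, symmetric] y[OF s, symmetric] by (simp add: algebra_simps)
    then have "F1 s = (x * V1 s + y * K s) / c" using c(2) by (simp add: eq_divide_eq mult.commute)
    then show "F1 s = (x / c) * V1 s - (- y / c) * K s" by (simp add: add_divide_distrib)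
  qed
qed

text \<open>The 2x2 determinant of the vectors \<open>(B, U)\<close> at \<open>a\<close> and at
  \<open>s\<close>: up to scale the solution vanishing at \<open>a\<close>, and antisymmetric in its
  two points.\<close>

definition P :: "real \<Rightarrow> real \<Rightarrow> real" where "P a s = B a * U s - U a * B s"
definition P1 :: "real \<Rightarrow> real \<Rightarrow> real" where "P1 a s = B a * U1 s + U a * K s"

lemma ksol_P: "ksol {0<..} (P a) (P1 a)"
  using ksol_lincomb[OF ksol_U ksol_B, of "B a" "- U a"] by (simp add: P_def P1_def[abs_def] P_def[abs_def])

lemma P_self: "P a a = 0"
  by (simp add: P_def)

lemma P1_self: "0 < a \<Longrightarrow> P1 a a = 2 / W a"
  using wronskian_U_B[of a] by (simp add: P1_def mult.commute)

lemma P_swap: "P t s = - P s t"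
  by (simp add: P_def)

text \<open>Three-term Plucker relation for four vectors in the plane. When the solutions vanishing
  at \<open>a\<close> and at \<open>c\<close> are scaled to agree at \<open>t\<close>, it shows that
  their difference is a multiple of \<open>P s t\<close>, so its sign is read off from
  \<open>P\<close>.\<close>

lemma P_plucker: "P a s * P c t - P c s * P a t = P a c * P s t"
  by (simp add: P_def algebra_simps)

text \<open>\<open>F_a = shot a\<close> is the solution with \<open>F_a(a) = 0\<close> and \<open>sqrt a * F_a'(a) = 1\<close>, that is,
  with unit radial slope at its zero.\<close>

definition shot :: "real \<Rightarrow> real \<Rightarrow> real" where "shot a s = W a / (2 * sqrt a) * P a s"
definition shot1 :: "real \<Rightarrow> real \<Rightarrow> real" where "shot1 a s = W a / (2 * sqrt a) * P1 a s"

lemma ksol_shot: "ksol {0<..} (shot a) (shot1 a)"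
  using ksol_lincomb[OF ksol_P ksol_B, of "W a / (2 * sqrt a)" a 0]
  by (simp add: shot_def[abs_def] shot1_def[abs_def])

lemma shot_self: "shot a a = 0" and shot1_self: "0 < a \<Longrightarrow> sqrt a * shot1 a a = 1"
  using W_pos[of a] by (simp_all add: shot_def shot1_def P_self P1_self)

lemma shot_pos_iff: "0 < a \<Longrightarrow> 0 < shot a s \<longleftrightarrow> 0 < P a s"
  using W_pos[of a] by (simp add: shot_def zero_less_mult_iff zero_less_divide_iff)

section \<open>The quotient \<open>rho\<close> and its range beyond \<open>s0\<close>\<close>

definition rho :: "real \<Rightarrow> real" where "rho s = U s / B s"

lemma rho_deriv:
  assumes "0 < s" "B s \<noteq> 0" shows "(rho has_real_derivative 2 / (W s * (B s)\<^sup>2)) (at s)"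
proof -
  have "(rho has_real_derivative (U1 s * B s - U s * - K s) / (B s * B s)) (at s)"
    unfolding rho_def by (rule DERIV_divide[OF U_deriv B_deriv]) (use assms in auto)
  moreover have "U1 s * B s - U s * - K s = 2 / W s" using wronskian_U_B[OF assms(1)] by simp
  ultimately show ?thesis by (simp add: power2_eq_square)
qed

lemma rho_strict_mono:
  assumes "0 < s" "s < t" "t < s0 \<or> s0 < s" shows "rho s < rho t"
proof (rule DERIV_pos_imp_increasing[OF assms(2)])
  fix x assume x: "s \<le> x" "x \<le> t"
  then have "B x \<noteq> 0" using assms B_pos_iff[of x] B_neg_iff[of x] by auto
  moreover have "0 < x" using x assms by simp
  ultimately have "(rho has_real_derivative 2 / (W x * (B x)\<^sup>2)) (at x)" "0 < 2 / (W x * (B x)\<^sup>2)"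
    using rho_deriv W_pos[of x] by auto
  then show "\<exists>y. (rho has_real_derivative y) (at x) \<and> 0 < y" by blast
qed

text \<open>Away from \<open>s0\<close>, the further zeros of the solution vanishing at
  \<open>a\<close> are therefore the points with the same value of \<open>rho\<close>.\<close>

lemma P_rho: "B a \<noteq> 0 \<Longrightarrow> B s \<noteq> 0 \<Longrightarrow> P a s = B a * B s * (rho s - rho a)"
  by (simp add: P_def rho_def field_simps)

lemma U_strict_mono:
  assumes "0 < s" "s < t" shows "U s < U t"
proof (rule DERIV_pos_imp_increasing[OF assms(2)])
  fix x assume "s \<le> x"
  then have "0 < x" using assms by simp
  then show "\<exists>y. (U has_real_derivative y) (at x) \<and> 0 < y" using U_deriv U1_pos by blast
qed

lemma U_s0_pos: "0 < U s0"
  using s0_pos W_pos[of s0] K_pos[of s0] by (simp add: U_def B_s0)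

lemma isCont_U: "0 < s \<Longrightarrow> isCont U s"
  using U_deriv DERIV_isCont by blast

lemma isCont_B: "isCont B s"
  using B_deriv DERIV_isCont by blast

lemma isCont_W: "0 < s \<Longrightarrow> isCont W s"
  using W_deriv DERIV_isCont by blast

lemma isCont_rho: "0 < s \<Longrightarrow> s \<noteq> s0 \<Longrightarrow> isCont rho s"
  using rho_deriv DERIV_isCont B_pos_iff[of s] B_neg_iff[of s] by (metis less_imp_le less_irrefl neq_iff)

lemma rho_at_top: "(rho \<longlongrightarrow> 0) at_top"
proof -
  have "((\<lambda>s. (U s / sqrt s) * (sqrt s / (s powr (- b - 1/2) * exp s)) / (B s / (s powr (- b - 1/2) * exp s)))
      \<longlongrightarrow> 2 / l * 0 / - l) at_top"
    using l_pos by (intro tendsto_intros U_asymp B_asymp) (auto, real_asymp)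
  moreover have "\<forall>\<^sub>F s in at_top. (U s / sqrt s) * (sqrt s / (s powr (- b - 1/2) * exp s)) / (B s / (s powr (- b - 1/2) * exp s)) = rho s"
    using eventually_gt_at_top[of 0] by eventually_elim (simp add: rho_def)
  ultimately show ?thesis by (simp add: tendsto_cong)
qed

lemma rho_at_s0: "filterlim rho at_bot (at_right s0)"
proof -
  have "filterlim (\<lambda>s. U s * inverse (B s)) at_bot (at_right s0)"
  proof (rule filterlim_tendsto_pos_mult_at_bot[OF _ U_s0_pos])
    show "(U \<longlongrightarrow> U s0) (at_right s0)"
      using isCont_U[OF s0_pos] by (auto simp: isCont_def intro: filterlim_at_within_If filterlim_mono at_le)
    show "filterlim (\<lambda>s. inverse (B s)) at_bot (at_right s0)"
    proof (rule filterlim_inverse_at_bot)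
      show "(B \<longlongrightarrow> 0) (at_right s0)"
        using isCont_B[of s0] by (auto simp: isCont_def B_s0 intro: filterlim_mono at_le)
      show "\<forall>\<^sub>F s in at_right s0. B s < 0"
        using s0_pos B_neg_iff by (intro eventually_at_right_less[THEN eventually_mono]) auto
    qed
  qed
  then show ?thesis by (simp add: rho_def[abs_def] divide_inverse)
qed

lemma rho_neg:
  assumes "s0 < s" shows "rho s < 0"
proof -
  have "0 < U s" using U_strict_mono[OF s0_pos assms] U_s0_pos by simp
  moreover have "B s < 0" using assms s0_pos B_neg_iff[of s] by simp
  ultimately show ?thesis by (simp add: rho_def divide_pos_neg)
qed

lemma rho_onto:
  assumes "t < 0" shows "\<exists>s>s0. rho s = t"
proof -
  have "\<forall>\<^sub>F s in at_right s0. rho s \<le> t \<and> s0 < s"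
    using rho_at_s0 by (intro eventually_conj eventually_at_right_less) (simp add: filterlim_at_bot)
  then obtain p where p: "rho p \<le> t" "s0 < p"
    by (metis (mono_tags, lifting) eventually_happens' trivial_limit_at_right_real)
  have "\<forall>\<^sub>F s in at_top. t < rho s \<and> p < s"
    using assms order_tendstoD(1)[OF rho_at_top] by (intro eventually_conj eventually_gt_at_top) auto
  then obtain q where q: "t < rho q" "p < q"
    by (metis (mono_tags, lifting) eventually_happens' trivial_limit_at_top_linorder)
  have "\<exists>s\<ge>p. s \<le> q \<and> rho s = t"
    using p q s0_pos by (intro IVT) (auto intro!: isCont_rho)
  then obtain s where s: "p \<le> s" "rho s = t" by blast
  then have "s0 < s" using p by simp
  then show ?thesis using s by blast
qed

end

section \<open>Dimension at least two: the singularity at the origin and the pattern of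
  zeros\<close>

locale kummer2 = kummer +
  assumes one_le_b: "1 \<le> b"
begin

text \<open>On \<open>(0, 1)\<close> one has \<open>W s <= s\<close> because \<open>1 <= b\<close>,
  and \<open>B <= 1\<close>; so \<open>rho' >= 2 / s\<close>, and \<open>rho\<close> diverges at
  least like \<open>2 * ln s\<close>. On the line \<open>1 / W\<close> is integrable at 0 and this
  fails.\<close>

lemma rho_at_0: "filterlim rho at_bot (at_right 0)"
proof -
  have le: "rho s \<le> rho 1 + 2 * ln s" if s: "0 < s" "s < 1" for s
  proof -
    have "rho s - 2 * ln s \<le> rho 1 - 2 * ln 1"
    proof (rule DERIV_nonneg_mono_pos[where f = "\<lambda>x. rho x - 2 * ln x"
          and f' = "\<lambda>x. 2 / (W x * (B x)\<^sup>2) - 2 * (1 / x)"])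
      fix x :: real assume x: "s \<le> x" "x \<le> 1"
      then have x0: "0 < x" using s by simp
      have B: "0 < B x" "B x \<le> 1"
        using x x0 one_le_b b_less_s0 B_pos_iff[of x] B_strict_antimono[of 0 x] by (auto simp: B_0)
      then have "(B x)\<^sup>2 \<le> 1" by (simp add: power_le_one)
      moreover have "W x \<le> x * 1"
      proof -
        have "x powr b \<le> x powr 1" using x x0 one_le_b by (intro powr_mono') auto
        then show ?thesis unfolding W_def using x0 by (intro mult_mono) auto
      qed
      ultimately have "W x * (B x)\<^sup>2 \<le> x * 1 * 1"
        using x0 W_pos[of x] by (intro mult_mono) auto
      moreover have "0 < W x * (B x)\<^sup>2" using B W_pos[OF x0] by simp
      ultimately have "2 / x \<le> 2 / (W x * (B x)\<^sup>2)" by (intro divide_left_mono) (auto simp: x0)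
      then show "0 \<le> 2 / (W x * (B x)\<^sup>2) - 2 * (1 / x)" by simp
      show "((\<lambda>x. rho x - 2 * ln x) has_real_derivative 2 / (W x * (B x)\<^sup>2) - 2 * (1 / x)) (at x)"
        using B x0 by (intro DERIV_diff rho_deriv DERIV_cmult DERIV_ln_divide) auto
    qed (use s in simp)
    then show ?thesis by simp
  qed
  have "filterlim (\<lambda>s. rho 1 + 2 * ln s) at_bot (at_right 0)" by real_asymp
  then show ?thesis
  proof (rule filterlim_at_bot_mono)
    show "\<forall>\<^sub>F s in at_right 0. rho s \<le> rho 1 + 2 * ln s"
      by (rule eventually_mono[OF eventually_at_right_real[OF zero_less_one]]) (use le in auto)
  qed
qed

lemma B_tendsto_0: "(B \<longlongrightarrow> 1) (at_right 0)"
  using isCont_B[of 0] by (auto simp: isCont_def B_0 intro: filterlim_mono at_le)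

lemma U_at_0: "filterlim U at_bot (at_right 0)"
proof -
  have "filterlim (\<lambda>s. B s * rho s) at_bot (at_right 0)"
    by (rule filterlim_tendsto_pos_mult_at_bot[OF B_tendsto_0 _ rho_at_0]) simp
  moreover have "\<forall>\<^sub>F s in at_right 0. B s * rho s = U s"
    using eventually_at_right_real[OF s0_pos]
  proof eventually_elim
    case (elim s)
    then have "B s \<noteq> 0" using B_pos_iff[of s] by auto
    then show ?case by (simp add: rho_def)
  qed
  ultimately show ?thesis by (simp add: filterlim_cong)
qed

lemma ex_U_zero: "\<exists>s>0. s < s0 \<and> U s = 0"
proof -
  have "\<forall>\<^sub>F s in at_right 0. U s \<le> -1 \<and> s \<in> {0<..<s0}"
    using U_at_0 eventually_at_right_real[OF s0_pos] by (intro eventually_conj) (auto simp: filterlim_at_bot)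
  then obtain p where p: "U p \<le> -1" "p \<in> {0<..<s0}"
    by (metis (mono_tags, lifting) eventually_happens' trivial_limit_at_right_real)
  then have "\<exists>s\<ge>p. s \<le> s0 \<and> U s = 0"
    using U_s0_pos by (intro IVT) (auto intro!: isCont_U)
  then show ?thesis using p U_s0_pos by (metis greaterThanLessThan_iff le_less less_irrefl less_le_trans)
qed

definition s_star :: real where "s_star = (SOME s. s > 0 \<and> s < s0 \<and> U s = 0)"

lemma s_star_pos: "0 < s_star" and s_star_less_s0: "s_star < s0" and U_s_star: "U s_star = 0"
  using someI_ex[OF ex_U_zero] unfolding s_star_def by auto

text \<open>At the zero of \<open>U\<close> the equation turns radial concavity into
  \<open>(s - b + 1/2) * U1 s <= 0\<close>, and \<open>U1\<close> is positive.\<close>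

lemma s_star_le: "s_star \<le> b - 1/2"
proof -
  have "(s_star - b + 1/2) * U1 s_star \<le> 0"
    using U_concave[OF s_star_pos] U_ode[OF s_star_pos] by (simp add: U_s_star algebra_simps)
  then show ?thesis using U1_pos[OF s_star_pos] by (simp add: mult_le_0_iff)
qed

lemma U_pos_iff: "0 < s \<Longrightarrow> 0 < U s \<longleftrightarrow> s_star < s"
  and U_neg_iff: "0 < s \<Longrightarrow> U s < 0 \<longleftrightarrow> s < s_star"
proof -
  assume s: "0 < s"
  have 1: "s < s_star \<Longrightarrow> U s < 0" and 2: "s_star < s \<Longrightarrow> 0 < U s"
    using U_strict_mono[OF s, of s_star] U_strict_mono[OF s_star_pos, of s] U_s_star by auto
  show "0 < U s \<longleftrightarrow> s_star < s" "U s < 0 \<longleftrightarrow> s < s_star"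
    using 1 2 U_s_star by (cases s s_star rule: linorder_cases; simp; fail)+
qed

lemma P_pos_left:
  assumes "0 < a" "a < t" "t < s0" shows "0 < P a t"
proof -
  have "0 < B a" "0 < B t" using assms B_pos_iff[of a] B_pos_iff[of t] by auto
  then show ?thesis using rho_strict_mono[of a t] assms by (simp add: P_rho)
qed

text \<open>On either side of \<open>s0\<close>, \<open>rho\<close> increases while \<open>B\<close>
  keeps its sign. Across \<open>s0\<close> the signs \<open>U a >= 0\<close>, \<open>U t > 0\<close>
  and \<open>B a > 0 >= B t\<close> decide; this is where \<open>s_star <= a\<close> enters.\<close>

lemma P_pos_right:
  assumes "s_star \<le> a" "a < t" shows "0 < P a t"
proof -
  have pos: "0 < a" "0 < t" using assms s_star_pos by auto
  have Ua: "0 \<le> U a" using U_neg_iff[OF pos(1)] assms(1) by (simp add: not_less[symmetric])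
  have Ut: "0 < U t" using U_pos_iff[OF pos(2)] assms by simp
  consider "t < s0" | "a < s0" "s0 \<le> t" | "a = s0" | "s0 < a" using assms by linarith
  then show ?thesis
  proof cases
    case 1
    then show ?thesis using P_pos_left pos assms by blast
  next
    case 2
    then have "0 < B a" "B t \<le> 0" using pos B_pos_iff[of a] B_pos_iff[of t] by auto
    then have "0 < B a * U t" "U a * B t \<le> 0" using Ua Ut by (auto simp: mult_nonneg_nonpos)
    then show ?thesis by (simp add: P_def)
  next
    case 3
    then have "B a = 0" "B t < 0" "0 < U a" using B_s0 B_neg_iff[of t] pos assms U_s0_pos by auto
    then show ?thesis by (simp add: P_def mult_pos_neg)
  next
    case 4
    then have "B a < 0" "B t < 0" using B_neg_iff[of a] B_neg_iff[of t] pos assms by auto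
    then show ?thesis using rho_strict_mono[of a t] assms 4 pos by (simp add: P_rho mult_neg_neg)
  qed
qed

text \<open>\<open>P a\<close> is positive up to \<open>s0\<close>, where its value is
  \<open>B a * U s0\<close>. Beyond \<open>s0\<close> the product \<open>B a * B t\<close> is
  negative, so the sign is that of \<open>rho e - rho t\<close>.\<close>

lemma P_sign:
  assumes a: "0 < a" "a < s_star" and e: "s0 < e" "rho e = rho a" and t: "a < t"
  shows "0 < P a t \<longleftrightarrow> t < e" and "P a t < 0 \<longleftrightarrow> e < t"
proof -
  have Ba: "0 < B a" using a s_star_less_s0 B_pos_iff[of a] by simp
  have "0 < P a t \<and> t < e \<or> P a t = 0 \<and> t = e \<or> P a t < 0 \<and> e < t"
  proof (cases t s0 rule: linorder_cases)
    case less
    then show ?thesis using P_pos_left a t e by simp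
  next
    case equal
    then show ?thesis using Ba U_s0_pos e by (simp add: P_def B_s0)
  next
    case greater
    have "0 < t" using a t by simp
    with greater have Bt: "B t < 0" using B_neg_iff[of t] by simp
    have eq: "P a t = (B a * B t) * (rho t - rho e)" using Ba Bt e by (simp add: P_rho)
    have neg: "B a * B t < 0" using Ba Bt by (simp add: mult_pos_neg)
    show ?thesis
      unfolding eq using neg rho_strict_mono[of t e] rho_strict_mono[of e t] greater e s0_pos
      by (cases t e rule: linorder_cases) (auto simp: mult_neg_neg mult_neg_pos)
  qed
  then show "0 < P a t \<longleftrightarrow> t < e" "P a t < 0 \<longleftrightarrow> e < t" by auto
qed

lemma ex_second_zero:
  assumes "0 < a" "a < s_star" obtains e where "s0 < e" "rho e = rho a"
proof -
  have "U a < 0" "0 < B a" using U_neg_iff[of a] B_pos_iff[of a] assms s_star_less_s0 by auto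
  then have "rho a < 0" by (simp add: rho_def divide_neg_pos)
  then show ?thesis using rho_onto that by blast
qed

text \<open>\<open>flux\<close> is the reciprocal slope at its zeros of the solution \<open>U - t B\<close>, up to a constant: there
  \<open>sqrt s * (U - t B)' = 2 / flux s\<close> by the Wronskian identity.\<close>

definition flux :: "real \<Rightarrow> real" where "flux s = W s * B s / sqrt s"

text \<open>\<open>shot a\<close> is a multiple of \<open>U - rho a * B\<close>, whose radial slopes
  at the zeros are \<open>2 / flux\<close>; the normalisation at \<open>a\<close> leaves their
  ratio. An outer slope of \<open>-1\<close> therefore reads
  \<open>flux a + flux e = 0\<close>.\<close>

lemma shot1_second_zero:
  assumes "0 < a" "a < s_star" "s0 < e" "rho e = rho a"
  shows "sqrt e * shot1 a e = flux a / flux e"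
proof -
  have Be: "B e < 0" and Ba: "0 < B a" and e: "0 < e"
    using assms s0_pos s_star_less_s0 B_neg_iff[of e] B_pos_iff[of a] by auto
  have "U a = B a * U e / B e" using assms(4) Be Ba by (simp add: rho_def field_simps)
  then have "P1 a e = B a * (U1 e * B e + U e * K e) / B e"
    using Be by (simp add: P1_def field_simps)
  then have "P1 a e = B a * (2 / W e) / B e" using wronskian_U_B[OF e] by simp
  then show ?thesis
    using Be e assms(1) W_pos[OF e] by (simp add: shot1_def flux_def)
qed

end

section \<open>Existence and uniqueness of the annulus\<close>

context kummer2
begin

lemma flux_tendsto_top: "(flux \<longlongrightarrow> 0) at_top"
proof -
  have "((\<lambda>s. B s / (s powr (- b - 1/2) * exp s) * (1 / s)) \<longlongrightarrow> - l * 0) at_top"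
    by (intro tendsto_mult B_asymp) real_asymp
  moreover have "\<forall>\<^sub>F s in at_top. B s / (s powr (- b - 1/2) * exp s) * (1 / s) = flux s"
    using eventually_gt_at_top[of 0]
  proof eventually_elim
    case (elim s)
    have e: "- b - 1/2 = - (b + 1/2)" by simp
    have p: "s powr (- b - 1/2) = 1 / (s powr b * sqrt s)"
      unfolding e powr_minus_divide powr_add using elim by (simp add: powr_half_sqrt)
    have gen: "B s / (1 / (p * q) * y) * (1 / (q * q)) = p * (1 / y) * B s / q"
      if "0 < p" "0 < q" "0 < y" for p q y :: real
      using that by (simp add: field_simps)
    have "sqrt s * sqrt s = s" using elim by simp
    with gen[of "s powr b" "sqrt s" "exp s"] elim
    show ?case unfolding p flux_def W_def by (simp add: exp_minus inverse_eq_divide)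
  qed
  ultimately show ?thesis by (simp add: tendsto_cong)
qed

lemma isCont_flux: "0 < s \<Longrightarrow> isCont flux s"
  unfolding flux_def by (intro continuous_intros isCont_W isCont_B) auto

text \<open>Equal to \<open>rho * flux\<close>. Unlike \<open>flux\<close> it is positive at
  \<open>s0\<close>, which decides the sign of \<open>flux a + flux e\<close> for small
  \<open>a\<close>.\<close>

definition uflux :: "real \<Rightarrow> real" where "uflux s = W s * U s / sqrt s"

lemma flux_uflux: "B s \<noteq> 0 \<Longrightarrow> uflux s = rho s * flux s"
  by (simp add: flux_def uflux_def rho_def)

lemma isCont_uflux: "0 < s \<Longrightarrow> isCont uflux s"
  unfolding uflux_def by (intro continuous_intros isCont_W isCont_U) auto

text \<open>\<open>(W * U')' = - W * U / (2 * s)\<close> is nonnegative where \<open>U <= 0\<close>.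
  So near 0 the derivative \<open>U'\<close> is at most a constant times
  \<open>1 / W\<close>.\<close>

lemma W_U1_le:
  assumes "0 < s" "s \<le> s_star" shows "W s * U1 s \<le> W s_star * U1 s_star"
proof (rule DERIV_nonneg_mono_pos[where f = "\<lambda>s. W s * U1 s" and f' = "\<lambda>s. - (W s * U s / (2 * s))"])
  fix x assume x: "s \<le> x" "x \<le> s_star"
  then have x0: "0 < x" using assms by simp
  show "((\<lambda>s. W s * U1 s) has_real_derivative - (W x * U x / (2 * x))) (at x)"
  proof (rule DERIV_cong[OF DERIV_mult[OF W_deriv[OF x0] ksolD(2)[OF ksol_U]]])
    show "W x * (b / x - 1) * U1 x + ((x - b) * U1 x - U x / 2) / x * W x = - (W x * U x / (2 * x))"
      using x0 by (simp add: field_simps)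
  qed (use x0 in simp)
  have "U x \<le> 0" using x0 x U_pos_iff[of x] by (simp add: not_less[symmetric])
  then have "W x * U x \<le> 0" using W_pos[OF x0] by (simp add: mult_nonneg_nonpos)
  then show "0 \<le> - (W x * U x / (2 * x))" using x0 by (simp add: divide_nonpos_pos)
qed (rule assms)

text \<open>Any positive exponent would do; \<open>1/4\<close> avoids the logarithm that \<open>U\<close> has at 0 for \<open>n = 2\<close>.\<close>

lemma uflux_lower: "\<exists>C. \<forall>s. 0 < s \<and> s \<le> s_star \<longrightarrow> - (C * s powr (1/4)) \<le> uflux s"
proof -
  define C where "C = W s_star * U1 s_star * exp s_star * s_star powr (1/4)"
  have C: "0 \<le> C" using W_pos[OF s_star_pos] U1_pos[OF s_star_pos] by (simp add: C_def)
  \<comment> \<open>The true order is \<open>s powr (- b)\<close>; giving away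
    \<open>s powr (1/4)\<close> makes the primitive a pure power even for
    \<open>b = 1\<close>.\<close>
  have U1_le: "U1 s \<le> C * s powr (- b - 1/4)" if s: "0 < s" "s \<le> s_star" for s
  proof -
    have "W s * U1 s \<le> W s_star * U1 s_star" using s by (rule W_U1_le)
    then have "U1 s \<le> W s_star * U1 s_star / W s" using W_pos[OF s(1)] by (simp add: field_simps)
    also have "\<dots> = W s_star * U1 s_star * (exp s * s powr (- b))"
      by (simp add: W_def powr_minus exp_minus divide_inverse)
    also have "s powr (- b) = s powr (1/4) * s powr (- b - 1/4)"
      by (simp flip: powr_add)
    also have "W s_star * U1 s_star * (exp s * (s powr (1/4) * s powr (- b - 1/4)))
      \<le> W s_star * U1 s_star * (exp s_star * (s_star powr (1/4) * s powr (- b - 1/4)))"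
    proof -
      have "s powr (1/4) \<le> s_star powr (1/4)" using s by (intro powr_mono2) auto
      then have "exp s * (s powr (1/4) * s powr (- b - 1/4)) \<le> exp s_star * (s_star powr (1/4) * s powr (- b - 1/4))"
        using s by (intro mult_mono) auto
      then show ?thesis
        using W_pos[OF s_star_pos] U1_pos[OF s_star_pos] by (intro mult_left_mono) auto
    qed
    finally show ?thesis by (simp add: C_def mult_ac)
  qed
  \<comment> \<open>The derivative of \<open>4 * C * s powr (3/4 - b)\<close> is
    \<open>- (4 * b - 3) * C * s powr (- b - 1/4)\<close>, and \<open>4 * b - 3 >= 1\<close>. This
    is the origin of the 4: the sum with \<open>U\<close> decreases up to \<open>s_star\<close>,
    where it is nonnegative.\<close>
  have U_ge: "- (4 * C * s powr (3/4 - b)) \<le> U s" if s: "0 < s" "s \<le> s_star" for s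
  proof -
    have "- (U s + 4 * C * s powr (3/4 - b)) \<le> - (U s_star + 4 * C * s_star powr (3/4 - b))"
    proof (rule DERIV_nonneg_mono_pos[where f = "\<lambda>s. - (U s + 4 * C * s powr (3/4 - b))"
        and f' = "\<lambda>s. - (U1 s + 4 * C * ((3/4 - b) * s powr (3/4 - b) / s))"])
      fix x assume x: "s \<le> x" "x \<le> s_star"
      then have x0: "0 < x" using s by simp
      show "((\<lambda>s. - (U s + 4 * C * s powr (3/4 - b))) has_real_derivative
         - (U1 x + 4 * C * ((3/4 - b) * x powr (3/4 - b) / x))) (at x)"
        by (intro DERIV_minus DERIV_add U_deriv DERIV_cmult powr_deriv x0)
      have "3/4 - b - 1 = - b - 1/4" by simp
      then have "x powr (3/4 - b) / x = x powr (- b - 1/4)"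
        using x0 powr_diff[of x "3/4 - b" 1] by (simp only: powr_one)
      then have z: "(3/4 - b) * x powr (3/4 - b) / x = (3/4 - b) * x powr (- b - 1/4)"
        by (metis times_divide_eq_right)
      have e: "4 * C * ((3/4 - b) * x powr (3/4 - b) / x) = - (C * x powr (- b - 1/4) * (4 * b - 3))"
        unfolding z by (simp add: algebra_simps)
      have "C * x powr (- b - 1/4) * 1 \<le> C * x powr (- b - 1/4) * (4 * b - 3)"
        using C one_le_b by (intro mult_left_mono) auto
      with U1_le[OF x0 x(2)] show "0 \<le> - (U1 x + 4 * C * ((3/4 - b) * x powr (3/4 - b) / x))"
        unfolding e by linarith
    qed (rule s)
    moreover have "0 \<le> 4 * C * s_star powr (3/4 - b)" using C by simp
    ultimately show ?thesis by (simp add: U_s_star)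
  qed
  have "- (4 * C * s powr (1/4)) \<le> uflux s" if s: "0 < s" "s \<le> s_star" for s
  proof -
    have "s powr b / sqrt s * s powr (3/4 - b) = s powr (1/4)"
      using s by (simp add: powr_half_sqrt[symmetric] flip: powr_diff powr_add)
    moreover have "W s / sqrt s * s powr (3/4 - b) = exp (- s) * (s powr b / sqrt s * s powr (3/4 - b))"
      by (simp add: W_def)
    ultimately have "W s / sqrt s * s powr (3/4 - b) = exp (- s) * s powr (1/4)" by (simp only:)
    also have "\<dots> \<le> 1 * s powr (1/4)" using s by (intro mult_right_mono) auto
    finally have "4 * C * (W s / sqrt s * s powr (3/4 - b)) \<le> 4 * C * s powr (1/4)"
      using C by (intro mult_left_mono) auto
    moreover have "W s / sqrt s * - (4 * C * s powr (3/4 - b)) \<le> W s / sqrt s * U s"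
      using U_ge[OF s] W_pos[OF s(1)] s by (intro mult_left_mono) auto
    ultimately show ?thesis by (simp add: uflux_def mult_ac)
  qed
  then show ?thesis by blast
qed

text \<open>The second zero \<open>e\<close> depends continuously on \<open>a\<close> through the
  branch of \<open>rho\<close> beyond \<open>s0\<close>. The intermediate value theorem applies to
  \<open>flux a + flux e\<close>, which is negative for some \<open>a\<close> near 0 and positive
  near \<open>s_star\<close>, where \<open>e\<close> escapes to infinity and \<open>flux e\<close>
  vanishes.\<close>

lemma ex_annulus: "\<exists>a e. 0 < a \<and> a < s_star \<and> s0 < e \<and> rho e = rho a \<and> flux a + flux e = 0"
proof -
  define inv where "inv = inv_into {s0<..} rho"
  have inj: "inj_on rho {s0<..}"
    using rho_strict_mono s0_pos by (intro linorder_inj_onI) (auto simp: less_le)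
  have img: "rho ` {s0<..} = {..<0}"
    using rho_neg rho_onto by force
  have cont_inv: "continuous_on {..<0} inv"
    unfolding img[symmetric] inv_def
    by (rule continuous_on_inverse_open)
       (use inj s0_pos in \<open>auto intro!: continuous_at_imp_continuous_on isCont_rho\<close>)
  have inv: "s0 < inv t" "rho (inv t) = t" if "t < 0" for t
    using that inv_into_into[of t rho "{s0<..}"] f_inv_into_f[of t rho "{s0<..}"] img
    by (auto simp: inv_def)
  have rho_less: "x < y" if "rho x < rho y" "s0 < x" "s0 < y" for x y
    using that rho_strict_mono[of y x] s0_pos by (cases x y rule: linorder_cases) auto
  have neg: "rho a < 0" if "0 < a" "a < s_star" for a
    using that U_neg_iff[of a] B_pos_iff[of a] s_star_less_s0 by (simp add: rho_def divide_neg_pos)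
  define E where "E a = flux a + flux (inv (rho a))" for a
  have cont_E: "isCont E a" if "0 < a" "a < s_star" for a
  proof -
    have "isCont inv (rho a)"
      using cont_inv neg[OF that] by (simp add: continuous_on_eq_continuous_at)
    moreover have "isCont rho a" using that s_star_less_s0 by (intro isCont_rho) auto
    ultimately have "isCont (\<lambda>a. inv (rho a)) a" by (rule isCont_o2[rotated])
    moreover have "isCont flux (inv (rho a))"
      using inv(1)[OF neg[OF that]] s0_pos by (intro isCont_flux) simp
    ultimately have "isCont (\<lambda>a. flux (inv (rho a))) a" by (rule isCont_o2)
    then show ?thesis unfolding E_def using that by (intro continuous_add isCont_flux)
  qed
  \<comment> \<open>\<open>p\<close> is so small that \<open>uflux p > - h\<close>, and that
    \<open>e\<close> is close enough to \<open>s0\<close> for \<open>uflux e > h\<close>, with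
    \<open>h\<close> half of \<open>uflux s0\<close>. Division of the sum by the negative
    \<open>rho p\<close> reverses its sign.\<close>
  obtain p where p: "0 < p" "p < s_star" "E p < 0"
  proof -
    define h where "h = uflux s0 / 2"
    have h: "0 < h" using W_pos[OF s0_pos] U_s0_pos s0_pos by (simp add: h_def uflux_def)
    have "isCont uflux s0" using s0_pos by (rule isCont_uflux)
    then have "\<forall>\<^sub>F s in at_right s0. h < uflux s"
      using h by (intro order_tendstoD(1)[of uflux "uflux s0"]) (auto simp: isCont_def h_def intro: filterlim_mono at_le)
    then obtain d where d: "s0 < d" "\<And>s. s0 < s \<Longrightarrow> s < d \<Longrightarrow> h < uflux s"
      by (auto simp: eventually_at_right_field)
    \<comment> \<open>Only a weak inequality \<open>rho p <= rho d'\<close> is available, so the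
      midpoint is needed to reach the strict \<open>e < d\<close>.\<close>
    define d' where "d' = (s0 + d) / 2"
    have d': "s0 < d'" "d' < d" using d(1) by (auto simp: d'_def)
    obtain C where C: "\<And>s. 0 < s \<Longrightarrow> s \<le> s_star \<Longrightarrow> - (C * s powr (1/4)) \<le> uflux s"
      using uflux_lower by blast
    have "((\<lambda>s::real. C * s powr (1/4)) \<longlongrightarrow> 0) (at_right 0)" by real_asymp
    then have "\<forall>\<^sub>F s in at_right 0. C * s powr (1/4) < h" using h by (rule order_tendstoD)
    moreover have "\<forall>\<^sub>F s in at_right 0. rho s \<le> rho d'" using rho_at_0 by (simp add: filterlim_at_bot)
    ultimately have "\<forall>\<^sub>F s in at_right 0. C * s powr (1/4) < h \<and> rho s \<le> rho d' \<and> s \<in> {0<..<s_star}"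
      using eventually_at_right_real[OF s_star_pos] by (intro eventually_conj)
    then obtain p where p: "C * p powr (1/4) < h" "rho p \<le> rho d'" "0 < p" "p < s_star"
      by (metis (mono_tags, lifting) eventually_happens' trivial_limit_at_right_real greaterThanLessThan_iff)
    define e where "e = inv (rho p)"
    have e: "s0 < e" "rho e = rho p" using inv[OF neg[OF p(3,4)]] by (auto simp: e_def)
    have "e < d"
      using rho_strict_mono[of d' e] d' e p s0_pos by (cases "d' < e") auto
    then have "0 < uflux p + uflux e" using d(2)[OF e(1)] C[of p] p by simp
    moreover have "uflux p = rho p * flux p" "uflux e = rho p * flux e"
      using flux_uflux[of p] flux_uflux[of e] e p s_star_less_s0 B_pos_iff[of p] B_neg_iff[of e] s0_pos
      by auto
    ultimately have "0 < rho p * E p" by (simp add: E_def e_def distrib_left)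
    then have "E p < 0" using neg[OF p(3,4)] by (simp add: zero_less_mult_iff)
    with p show ?thesis using that by blast
  qed
  \<comment> \<open>Near \<open>s_star\<close>, \<open>flux\<close> exceeds half its value
    \<open>2 * h\<close> there, and \<open>rho\<close> is so close to 0 that \<open>e\<close> lies
    beyond the point after which \<open>flux > - h\<close>.\<close>
  obtain q where q: "0 < q" "q < s_star" "0 < E q"
  proof -
    define h where "h = flux s_star / 2"
    have "0 < B s_star" using s_star_pos s_star_less_s0 B_pos_iff[of s_star] by simp
    then have h: "0 < h" using W_pos[OF s_star_pos] s_star_pos by (simp add: h_def flux_def)
    have "\<forall>\<^sub>F s in at_top. - h < flux s \<and> s0 < s"
      using h by (intro eventually_conj order_tendstoD(1)[OF flux_tendsto_top] eventually_gt_at_top) auto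
    then obtain d where d: "s0 < d" "\<And>s. d \<le> s \<Longrightarrow> - h < flux s"
      by (metis (mono_tags, lifting) eventually_at_top_linorder order_refl)
    have "isCont flux s_star" "isCont rho s_star"
      using s_star_pos s_star_less_s0 by (auto intro: isCont_flux isCont_rho)
    then have "(flux \<longlongrightarrow> flux s_star) (at_left s_star)" "(rho \<longlongrightarrow> rho s_star) (at_left s_star)"
      by (auto simp: isCont_def intro: filterlim_mono at_le)
    moreover have "h < flux s_star" "rho d < rho s_star"
      using h rho_neg[OF d(1)] by (auto simp: h_def rho_def U_s_star)
    ultimately have "\<forall>\<^sub>F s in at_left s_star. h < flux s \<and> rho d < rho s \<and> s \<in> {0<..<s_star}"
      using eventually_at_left_real[OF s_star_pos] by (intro eventually_conj order_tendstoD(1)) auto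
    then obtain q where q: "h < flux q" "rho d < rho q" "0 < q" "q < s_star"
      by (metis (mono_tags, lifting) eventually_happens' trivial_limit_at_left_real greaterThanLessThan_iff)
    define e where "e = inv (rho q)"
    have e: "s0 < e" "rho e = rho q" using inv[OF neg[OF q(3,4)]] by (auto simp: e_def)
    then have "d < e" using rho_less q d(1) by simp
    then have "0 < E q" using d(2)[of e] q by (simp add: E_def e_def)
    with q show ?thesis using that by blast
  qed
  have "\<exists>a. 0 < a \<and> a < s_star \<and> E a = 0"
  \<comment> \<open>Nothing orders \<open>p\<close> and \<open>q\<close>, hence the two versions of
    the intermediate value theorem.\<close>
  proof (cases "p \<le> q")
    case True
    then have "\<exists>x\<ge>p. x \<le> q \<and> E x = 0" using p q by (intro IVT) (auto intro: cont_E)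
    then show ?thesis using p q by (meson le_less_trans less_le_trans)
  next
    case False
    then have "\<exists>x\<ge>q. x \<le> p \<and> E x = 0" using p q by (intro IVT2) (auto intro: cont_E)
    then show ?thesis using p q by (meson le_less_trans less_le_trans)
  qed
  then show ?thesis using inv neg unfolding E_def by blast
qed

text \<open>\<open>energy\<close> is \<open>(f' + p f)\<^sup>2 + (1 + (n - 1)/r\<^sup>2) f\<^sup>2\<close> with \<open>p = (n - 1)/r - r/2\<close>, rewritten in \<open>s = r\<^sup>2/4\<close>.\<close>

definition psi :: "real \<Rightarrow> real" where
  "psi s = 2 - (2 * b - 1) / (2 * s) - (2 * b - 1) * (2 * b) / (4 * s\<^sup>2)"

definition energy :: "(real \<Rightarrow> real) \<Rightarrow> (real \<Rightarrow> real) \<Rightarrow> real \<Rightarrow> real" where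
  "energy F F1 s = s * (F1 s)\<^sup>2 + (2 * b - 1 - 2 * s) * F s * F1 s
     + ((2 * b - 1) * (2 * b) / (4 * s) - (2 * b - 1) + s + 1) * (F s)\<^sup>2"

text \<open>In the radial variable, \<open>f'' + p * f' = - f / 2\<close> gives
  \<open>(f' + p * f)' = - c * f\<close> with \<open>c = 1 + (n - 1) / r^2\<close>. In the
  derivative of \<open>(f' + p * f)^2 + c * f^2\<close> the mixed terms therefore cancel and
  \<open>(c' - 2 * p * c) * f^2\<close> remains; in the variable \<open>s\<close> the factor becomes
  \<open>psi\<close>.\<close>

lemma energy_deriv:
  assumes "ksol {0<..} F F1" "0 < s"
  shows "(energy F F1 has_real_derivative psi s * (F s)\<^sup>2) (at s)"
proof -
  have s: "s \<in> {0<..}" using assms by simp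
  note d = ksolD[OF assms(1) s]
  define F2 where "F2 = ((s - b) * F1 s - F s / 2) / s"
  have d2: "(F1 has_real_derivative F2) (at s)" using d(2) by (simp add: F2_def)
  have F2: "s * F2 = (s - b) * F1 s - F s / 2" using assms by (simp add: F2_def)
  have "(energy F F1 has_real_derivative
     (F1 s)\<^sup>2 + s * (2 * F1 s * F2) + (- 2 * F s * F1 s + (2 * b - 1 - 2 * s) * (F1 s * F1 s + F s * F2))
     + ((- ((2 * b - 1) * (2 * b) / (4 * s\<^sup>2)) + 1) * (F s)\<^sup>2
       + ((2 * b - 1) * (2 * b) / (4 * s) - (2 * b - 1) + s + 1) * (2 * F s * F1 s))) (at s)"
    unfolding energy_def
    by (rule derivative_eq_intros d(1) d2 refl | (use assms in simp; fail))+
       (use assms in \<open>simp add: field_simps power2_eq_square\<close>)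
  moreover have "(F1 s)\<^sup>2 + s * (2 * F1 s * F2) + (- 2 * F s * F1 s + (2 * b - 1 - 2 * s) * (F1 s * F1 s + F s * F2))
     + ((- ((2 * b - 1) * (2 * b) / (4 * s\<^sup>2)) + 1) * (F s)\<^sup>2
       + ((2 * b - 1) * (2 * b) / (4 * s) - (2 * b - 1) + s + 1) * (2 * F s * F1 s)) = psi s * (F s)\<^sup>2"
    using assms(2) unfolding F2_def psi_def by (simp add: field_simps power2_eq_square)
  ultimately show ?thesis by simp
qed

text \<open>\<open>psi\<close> increases, with \<open>psi (b - 1/2) = - 1 / (2 * b - 1)\<close> and
  \<open>psi b = 1 / b\<close>; moreover \<open>s_star <= b - 1/2\<close> and
  \<open>b < s0\<close>.\<close>

lemma ex_psi_zero: "\<exists>s. s_star < s \<and> s < s0 \<and> (\<forall>x>0. x < s \<longrightarrow> psi x < 0) \<and> (\<forall>x>s. 0 < psi x)"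
proof -
  have mono: "psi s < psi t" if "0 < s" "s < t" for s t
  proof -
    have "(2 * b - 1) / (2 * t) < (2 * b - 1) / (2 * s)"
      using that one_le_b by (intro divide_strict_left_mono) auto
    moreover have "s\<^sup>2 \<le> t\<^sup>2" using that by (intro power_mono) auto
    then have "(2 * b - 1) * (2 * b) / (4 * t\<^sup>2) \<le> (2 * b - 1) * (2 * b) / (4 * s\<^sup>2)"
      using that one_le_b by (intro divide_left_mono) auto
    ultimately show ?thesis by (simp add: psi_def)
  qed
  have lo: "psi (b - 1/2) < 0"
  proof -
    obtain t where t: "b = t + 1/2" "0 < t" using one_le_b that[of "b - 1/2"] by simp
    have "psi t = 2 - (2 * b - 1) / (2 * t) - (2 * b - 1) * (2 * b) / (4 * t\<^sup>2)"
      by (simp only: psi_def)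
    also have "\<dots> = - (1 / (2 * t))"
      using t(2) by (simp add: t(1) field_simps power2_eq_square)
    finally have "psi t = - (1 / (2 * t))" .
    then show ?thesis using t by simp
  qed
  have hi: "0 < psi b"
    using one_le_b by (simp add: psi_def power2_eq_square field_simps)
  have "\<exists>s\<ge>b - 1/2. s \<le> b \<and> psi s = 0"
    unfolding psi_def using lo hi one_le_b by (intro IVT) (auto simp: psi_def intro!: continuous_intros)
  then obtain s where s: "b - 1/2 \<le> s" "s \<le> b" "psi s = 0" by blast
  then have "s \<noteq> b - 1/2" using lo by auto
  then have "s_star < s" "s < s0" using s s_star_le b_less_s0 by auto
  then show ?thesis using mono s s_star_pos by (metis less_trans)
qed

text \<open>The annulus that starts further in also ends further in. Let \<open>k\<close> scale
  \<open>H = shot c\<close> to agree with \<open>F = shot a\<close> at the zero \<open>m\<close> of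
  \<open>psi\<close>. Then \<open>k * H <= F\<close> before \<open>m\<close> and
  \<open>F <= k * H\<close> after it, so \<open>k^2 * energy H - energy F\<close> is nondecreasing
  on \<open>[c, e]\<close>. Both energies are 1 at the ends of their annuli, that of
  \<open>F\<close> drops on \<open>[a, c]\<close> and that of \<open>H\<close> rises on
  \<open>[e, f]\<close>; so the difference exceeds \<open>k^2 - 1\<close> at \<open>c\<close> and is
  at most \<open>k^2 - 1\<close> at \<open>e\<close>.\<close>

lemma annulus_less_False:
  assumes a: "0 < a" "a < c" "c < s_star"
    and e: "s0 < e" "rho e = rho a" "flux a + flux e = 0"
    and f: "s0 < f" "rho f = rho c" "flux c + flux f = 0"
  shows False
proof -
  obtain m where m: "s_star < m" "m < s0" "\<And>x. 0 < x \<Longrightarrow> x < m \<Longrightarrow> psi x < 0" "\<And>x. m < x \<Longrightarrow> 0 < psi x"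
    using ex_psi_zero by blast
  have c0: "0 < c" and as: "a < s_star" and e0: "0 < e" and f0: "0 < f" using a e f s0_pos by auto
  have "rho e < rho f" using e f rho_strict_mono[of a c] a s_star_less_s0 by simp
  then have ef: "e < f" using rho_strict_mono[of f e] e f s0_pos by (cases e f rule: linorder_cases) auto
  let ?F = "shot a" and ?F1 = "shot1 a" and ?H = "shot c" and ?H1 = "shot1 c"
  let ?h1 = "energy ?F ?F1" and ?h2 = "energy ?H ?H1"
  \<comment> \<open>At a zero of the solution the energy reduces to the squared radial slope, and
    the flux condition makes the outer slope \<open>-1\<close>.\<close>
  have ends: "energy (shot x) (shot1 x) x = 1" "energy (shot x) (shot1 x) y = 1"
    if "0 < x" "x < s_star" "s0 < y" "rho y = rho x" "flux x + flux y = 0" for x y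
  proof -
    have y: "0 < y" "B y < 0" "0 < B x" using that s0_pos s_star_less_s0 B_neg_iff[of y] B_pos_iff[of x] by auto
    have sq: "s * z\<^sup>2 = (sqrt s * z)\<^sup>2" if "0 < s" for s z :: real using that by (simp add: power_mult_distrib)
    show "energy (shot x) (shot1 x) x = 1"
      using sq[OF that(1), of "shot1 x x"] shot1_self[OF that(1)] by (simp add: energy_def shot_self)
    have "shot x y = 0" using that y by (simp add: shot_def P_rho)
    moreover have "sqrt y * shot1 x y = -1"
    proof -
      have "flux y \<noteq> 0" using y W_pos[of y] by (simp add: flux_def)
      moreover have "flux x = - flux y" using that(5) by simp
      ultimately show ?thesis using shot1_second_zero[OF that(1-4)] by simp
    qed
    ultimately show "energy (shot x) (shot1 x) y = 1"
      using sq[OF y(1), of "shot1 x y"] by (simp add: energy_def)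
  qed
  note h1 = ends[OF a(1) as e] and h2 = ends[OF c0 a(3) f]
  have d1: "(?h1 has_real_derivative psi s * (?F s)\<^sup>2) (at s)" if "0 < s" for s
    using energy_deriv[OF ksol_shot that] .
  have d2: "(?h2 has_real_derivative psi s * (?H s)\<^sup>2) (at s)" if "0 < s" for s
    using energy_deriv[OF ksol_shot that] .
  have F_pos: "0 < ?F s" if "a < s" "s < e" for s
    using P_sign(1)[OF a(1) as e(1,2) that(1)] that a by (simp add: shot_pos_iff)
  have H_pos: "0 < ?H s" if "c < s" "s < f" for s
    using P_sign(1)[OF c0 a(3) f(1,2) that(1)] that c0 by (simp add: shot_pos_iff)
  have mF: "0 < ?F m" and mH: "0 < ?H m" using F_pos[of m] H_pos[of m] m a e f by auto
  define k where "k = ?F m / ?H m"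
  have k: "0 < k" using mF mH by (simp add: k_def)
  have cross: "?H s * ?F m - ?F s * ?H m = W a / (2 * sqrt a) * (W c / (2 * sqrt c)) * (- (P a c * P s m))" for s
  proof -
    have "P c s * P a m - P a s * P c m = - (P a c * P s m)"
      using P_plucker[of c s a m] P_swap[of c a] by simp
    moreover have "(y * p) * (x * q) - (x * r) * (y * t) = x * y * (p * q - r * t)" for x y p q r t :: real
      by (simp add: algebra_simps)
    ultimately show ?thesis unfolding shot_def by (simp only:)
  qed
  have fac: "0 < W a / (2 * sqrt a) * (W c / (2 * sqrt c))" using W_pos[OF a(1)] W_pos[OF c0] a c0 by simp
  have Pac: "0 < P a c" using P_pos_left a s_star_less_s0 by simp
  have left: "k * ?H s \<le> ?F s" if "0 < s" "s < m" for s
  proof -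
    have "0 < P s m" using P_pos_left that m by simp
    then have "W a / (2 * sqrt a) * (W c / (2 * sqrt c)) * (- (P a c * P s m)) \<le> 0"
      using fac Pac by (intro mult_nonneg_nonpos) auto
    then show ?thesis using cross[of s] mH by (simp add: k_def field_simps)
  qed
  have right: "?F s \<le> k * ?H s" if "m < s" for s
  proof -
    have "0 < P m s" using P_pos_right that m by simp
    then have "0 \<le> W a / (2 * sqrt a) * (W c / (2 * sqrt c)) * (- (P a c * P s m))"
      using Pac P_swap[of s m] by (intro mult_nonneg_nonneg[OF less_imp_le[OF fac]]) auto
    then show ?thesis using cross[of s] mH by (simp add: k_def field_simps)
  qed
  have dk: "((\<lambda>s. k\<^sup>2 * ?h2 s - ?h1 s) has_real_derivative psi s * ((k * ?H s)\<^sup>2 - (?F s)\<^sup>2)) (at s)"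
    if "0 < s" for s
    using DERIV_diff[OF DERIV_cmult[OF d2[OF that], of "k\<^sup>2"] d1[OF that]]
    by (simp add: algebra_simps power_mult_distrib)
  have "?h1 c < ?h1 a"
  proof (rule DERIV_neg_imp_decreasing_open[OF a(2)])
    fix x assume x: "a < x" "x < c"
    then have "psi x * (?F x)\<^sup>2 < 0"
      using m(3)[of x] F_pos[of x] a m e s_star_less_s0 by (intro mult_neg_pos) auto
    then show "\<exists>y. (?h1 has_real_derivative y) (at x) \<and> y < 0" using d1[of x] x a by (intro exI conjI) auto
  next
    show "continuous_on {a..c} ?h1"
      using a by (intro continuous_at_imp_continuous_on ballI DERIV_isCont[OF d1]) auto
  qed
  moreover have "k\<^sup>2 * ?h2 c - ?h1 c \<le> k\<^sup>2 * ?h2 m - ?h1 m"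
  proof (rule DERIV_nonneg_imp_increasing_open[where f = "\<lambda>s. k\<^sup>2 * ?h2 s - ?h1 s"])
    show "c \<le> m" using a m by simp
    fix x assume x: "c < x" "x < m"
    then have "(k * ?H x)\<^sup>2 \<le> (?F x)\<^sup>2"
      using left[of x] H_pos[of x] k c0 m f by (intro power_mono) auto
    then have "0 \<le> psi x * ((k * ?H x)\<^sup>2 - (?F x)\<^sup>2)"
      using m(3)[of x] x c0 by (intro mult_nonpos_nonpos) auto
    then show "\<exists>y. ((\<lambda>s. k\<^sup>2 * ?h2 s - ?h1 s) has_real_derivative y) (at x) \<and> 0 \<le> y"
      using dk[of x] x c0 by (intro exI conjI) auto
  next
    show "continuous_on {c..m} (\<lambda>s. k\<^sup>2 * ?h2 s - ?h1 s)"
      using c0 by (intro continuous_at_imp_continuous_on ballI DERIV_isCont[OF dk]) auto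
  qed
  moreover have "k\<^sup>2 * ?h2 m - ?h1 m \<le> k\<^sup>2 * ?h2 e - ?h1 e"
  proof (rule DERIV_nonneg_imp_increasing_open[where f = "\<lambda>s. k\<^sup>2 * ?h2 s - ?h1 s"])
    show "m \<le> e" using e m by simp
    fix x assume x: "m < x" "x < e"
    then have x0: "0 < x" using m s_star_pos by simp
    have "(?F x)\<^sup>2 \<le> (k * ?H x)\<^sup>2"
      using right[of x] F_pos[of x] x m as by (intro power_mono) auto
    then have "0 \<le> psi x * ((k * ?H x)\<^sup>2 - (?F x)\<^sup>2)"
      using m(4)[of x] x by (intro mult_nonneg_nonneg) auto
    then show "\<exists>y. ((\<lambda>s. k\<^sup>2 * ?h2 s - ?h1 s) has_real_derivative y) (at x) \<and> 0 \<le> y"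
      using dk[OF x0] by blast
  next
    have "0 < m" using m s_star_pos by simp
    then show "continuous_on {m..e} (\<lambda>s. k\<^sup>2 * ?h2 s - ?h1 s)"
      by (intro continuous_at_imp_continuous_on ballI DERIV_isCont[OF dk]) auto
  qed
  moreover have "?h2 e \<le> ?h2 f"
  proof (rule DERIV_nonneg_mono_pos[OF _ _ less_imp_le[OF ef]])
    fix x assume "e \<le> x"
    then have "0 < x" "m < x" using e0 e m by auto
    then show "(?h2 has_real_derivative psi x * (?H x)\<^sup>2) (at x)" "0 \<le> psi x * (?H x)\<^sup>2"
      using d2 m(4)[of x] by auto
  qed
  then have "k\<^sup>2 * ?h2 e \<le> k\<^sup>2 * 1" using h2 by (intro mult_left_mono) auto
  moreover have "energy ?H ?H1 c = 1" "energy ?F ?F1 a = 1" "energy ?F ?F1 e = 1" using h1 h2 by auto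
  ultimately show False by simp
qed

lemma annulus_unique:
  assumes a: "0 < a" "a < s_star" and c: "0 < c" "c < s_star"
    and e: "s0 < e" "rho e = rho a" "flux a + flux e = 0"
    and f: "s0 < f" "rho f = rho c" "flux c + flux f = 0"
  shows "a = c \<and> e = f"
proof -
  have "a = c"
    using annulus_less_False[of a c e f] annulus_less_False[of c a f e] assms
    by (cases a c rule: linorder_cases) auto
  moreover from this have "e = f"
    using rho_strict_mono[of e f] rho_strict_mono[of f e] e f s0_pos by (cases e f rule: linorder_cases) auto
  ultimately show ?thesis by simp
qed

end

section \<open>Radial functions on Euclidean space\<close>

lemma partial_deriv_eqI:
  assumes "(f has_derivative f') (at x)" shows "partial_deriv i f x = f' (axis i 1)"
  unfolding partial_deriv_def using frechet_derivative_at[OF assms] by simp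

text \<open>Unlike \<open>|y|\<close>, the variable \<open>|y|^2 / 4\<close> is smooth at the
  origin, so the centre of a ball needs no separate treatment.\<close>

lemma has_derivative_quarter_norm:
  "((\<lambda>y :: 'a::real_inner. (norm y)\<^sup>2 / 4) has_derivative (\<lambda>h. y \<bullet> h / 2)) (at y)"
  unfolding power2_norm_eq_inner
  by (auto intro!: derivative_eq_intros simp: inner_commute)

lemma has_derivative_radial:
  fixes y :: "'a::real_inner"
  assumes "(F has_real_derivative D) (at ((norm y)\<^sup>2 / 4))"
  shows "((\<lambda>y. F ((norm y)\<^sup>2 / 4)) has_derivative (\<lambda>h. D * (y \<bullet> h / 2))) (at y)"
  using has_derivative_compose[OF has_derivative_quarter_norm assms[unfolded has_field_derivative_def]] .

context
  fixes \<phi> :: "real^'n::finite \<Rightarrow> real" and \<Omega> and F F1 F2 :: "real \<Rightarrow> real"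
  assumes \<Omega>: "open \<Omega>"
    and \<phi>: "\<And>y. y \<in> \<Omega> \<Longrightarrow> \<phi> y = F ((norm y)\<^sup>2 / 4)"
    and F: "\<And>y. y \<in> \<Omega> \<Longrightarrow> (F has_real_derivative F1 ((norm y)\<^sup>2 / 4)) (at ((norm y)\<^sup>2 / 4))"
    and F1: "\<And>y. y \<in> \<Omega> \<Longrightarrow> (F1 has_real_derivative F2 ((norm y)\<^sup>2 / 4)) (at ((norm y)\<^sup>2 / 4))"
begin

lemma radial_has_derivative:
  assumes "y \<in> \<Omega>"
  shows "(\<phi> has_derivative (\<lambda>h. F1 ((norm y)\<^sup>2 / 4) * (y \<bullet> h / 2))) (at y)"
  by (rule has_derivative_transform_within_open[OF has_derivative_radial[OF F[OF assms]] \<Omega> assms])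
    (simp add: \<phi>)

lemma radial_partial_deriv:
  assumes "y \<in> \<Omega>" shows "partial_deriv i \<phi> y = F1 ((norm y)\<^sup>2 / 4) * (y $ i / 2)"
  using partial_deriv_eqI[OF radial_has_derivative[OF assms]] by (simp add: inner_axis)

lemma radial_partial_has_derivative:
  assumes "y \<in> \<Omega>"
  shows "(partial_deriv i \<phi> has_derivative
    (\<lambda>h. F1 ((norm y)\<^sup>2 / 4) * (h $ i / 2) + F2 ((norm y)\<^sup>2 / 4) * (y \<bullet> h / 2) * (y $ i / 2))) (at y)"
proof -
  have "((\<lambda>y. y $ i / 2) has_derivative (\<lambda>h. h $ i / 2)) (at y)"
    by (intro bounded_linear_imp_has_derivative bounded_linear_compose[OF bounded_linear_divide] bounded_linear_vec_nth)
  from has_derivative_mult[OF has_derivative_radial[OF F1[OF assms]] this]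
  show ?thesis
    by (rule has_derivative_transform_within_open[OF _ \<Omega> assms]) (simp add: radial_partial_deriv)
qed

lemma radial_partial_deriv2:
  assumes "y \<in> \<Omega>"
  shows "partial_deriv j (partial_deriv i \<phi>) y =
    F1 ((norm y)\<^sup>2 / 4) * ((if i = j then 1 else 0) / 2) + F2 ((norm y)\<^sup>2 / 4) * (y $ j / 2) * (y $ i / 2)"
proof -
  have "axis j (1 :: real) $ i = (if i = j then 1 else 0)" by (simp add: axis_def)
  then show ?thesis
    using partial_deriv_eqI[OF radial_partial_has_derivative[OF assms], of j i] by (simp add: inner_axis)
qed

lemma radial_laplacian:
  assumes "y \<in> \<Omega>"
  shows "laplacian \<phi> y = F1 ((norm y)\<^sup>2 / 4) * (real CARD('n) / 2) + F2 ((norm y)\<^sup>2 / 4) * ((norm y)\<^sup>2 / 4)"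
proof -
  have "(norm y)\<^sup>2 = (\<Sum>i\<in>UNIV. y $ i * y $ i)"
    by (simp add: power2_norm_eq_inner inner_vec_def)
  then have "(\<Sum>i\<in>UNIV. F2 ((norm y)\<^sup>2 / 4) * (y $ i / 2) * (y $ i / 2)) = F2 ((norm y)\<^sup>2 / 4) * ((norm y)\<^sup>2 / 4)"
    by (simp add: sum_distrib_left sum_divide_distrib mult.assoc)
  moreover have "laplacian \<phi> y = (\<Sum>i\<in>(UNIV :: 'n set). F1 ((norm y)\<^sup>2 / 4) * (1 / 2))
      + (\<Sum>i\<in>UNIV. F2 ((norm y)\<^sup>2 / 4) * (y $ i / 2) * (y $ i / 2))"
    by (simp only: laplacian_def radial_partial_deriv2[OF assms] sum.distrib if_True simp_thms)
  ultimately show ?thesis by (simp only: sum_constant) simp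
qed

lemma radial_grad:
  assumes "y \<in> \<Omega>" shows "grad \<phi> y = (F1 ((norm y)\<^sup>2 / 4) / 2) *\<^sub>R y"
  by (simp add: grad_def vec_eq_iff radial_partial_deriv[OF assms])

lemma radial_operator:
  assumes "y \<in> \<Omega>" "s = (norm y)\<^sup>2 / 4"
  shows "laplacian \<phi> y - 1/2 * (y \<bullet> grad \<phi> y) + 1/2 * \<phi> y
    = s * F2 s - (s - real CARD('n) / 2) * F1 s + F s / 2"
proof -
  have "(norm y)\<^sup>2 = 4 * s" using assms(2) by simp
  then have "y \<bullet> grad \<phi> y = 2 * s * F1 s"
    by (simp add: radial_grad[OF assms(1)] power2_norm_eq_inner[symmetric])
  then show ?thesis
    by (simp add: radial_laplacian[OF assms(1)] \<phi>[OF assms(1)] assms(2)[symmetric] algebra_simps)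
qed

end

text \<open>\<open>I\<close> is meant to be open in the whole line. For a ball it reaches below 0,
  so that its frontier is the free boundary alone.\<close>

definition radial_extension :: "real set \<Rightarrow> (real \<Rightarrow> real) \<Rightarrow> real^'n::finite \<Rightarrow> real" where
  "radial_extension I F y = (if (norm y)\<^sup>2 / 4 \<in> I then F ((norm y)\<^sup>2 / 4) else 0)"

lemma continuous_on_quarter_norm: "continuous_on S (\<lambda>y :: 'a::real_normed_vector. (norm y)\<^sup>2 / 4)"
  by (intro continuous_intros) auto

lemma tendsto_quarter_norm: "((\<lambda>y :: 'a::real_normed_vector. (norm y)\<^sup>2 / 4) \<longlongrightarrow> (norm x)\<^sup>2 / 4) (at x within S)"
  by (intro tendsto_intros) auto

text \<open>\<open>F\<close> and \<open>F1\<close> are required to be continuous across the frontier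
  of \<open>I\<close>. The gradient limit from inside is then just the value
  \<open>sqrt s * |F1 s|\<close>, the radial slope at the end point.\<close>

lemma radial_solution_P_extension:
  fixes F F1 F2 :: "real \<Rightarrow> real"
  assumes I: "open I"
    and pos: "\<And>s. s \<in> I \<Longrightarrow> 0 \<le> s \<Longrightarrow> 0 < F s"
    and F: "\<And>s. s \<in> I \<Longrightarrow> 0 \<le> s \<Longrightarrow> (F has_real_derivative F1 s) (at s)"
    and F1: "\<And>s. s \<in> I \<Longrightarrow> 0 \<le> s \<Longrightarrow> (F1 has_real_derivative F2 s) (at s)"
    and F2: "\<And>s. s \<in> I \<Longrightarrow> 0 \<le> s \<Longrightarrow> isCont F2 s"
    and ode: "\<And>s. s \<in> I \<Longrightarrow> 0 \<le> s \<Longrightarrow> s * F2 s = (s - real CARD('n::finite) / 2) * F1 s - F s / 2"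
    and bdry: "\<And>s. s \<in> frontier I \<Longrightarrow> 0 \<le> s \<Longrightarrow>
      F s = 0 \<and> isCont F s \<and> isCont F1 s \<and> sqrt s * \<bar>F1 s\<bar> = 1"
  shows "radial_solution_P (radial_extension I F :: real^'n \<Rightarrow> real)"
    and "positivity_set (radial_extension I F :: real^'n \<Rightarrow> real) = {y. (norm y)\<^sup>2 / 4 \<in> I}"
proof -
  let ?q = "\<lambda>y :: real^'n. (norm y)\<^sup>2 / 4"
  let ?\<phi> = "radial_extension I F :: real^'n \<Rightarrow> real"
  define \<Omega> where "\<Omega> = {y. ?q y \<in> I}"
  have q0: "0 \<le> ?q y" for y by simp
  have qc: "isCont ?q y" for y
    using continuous_on_quarter_norm[of UNIV] by (simp add: continuous_on_eq_continuous_at)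
  have \<Omega>: "open \<Omega>"
    using open_vimage[OF I continuous_on_quarter_norm] by (simp add: \<Omega>_def vimage_def)
  have posset: "positivity_set ?\<phi> = \<Omega>"
    using pos q0 by (auto simp: positivity_set_def radial_extension_def \<Omega>_def)
  then show "positivity_set ?\<phi> = {y. ?q y \<in> I}" by (simp add: \<Omega>_def)
  have \<phi>: "?\<phi> y = F (?q y)" if "y \<in> \<Omega>" for y
    using that by (simp add: \<Omega>_def radial_extension_def)
  have dF: "(F has_real_derivative F1 (?q y)) (at (?q y))"
    and dF1: "(F1 has_real_derivative F2 (?q y)) (at (?q y))" if "y \<in> \<Omega>" for y
    using that F F1 q0[of y] by (auto simp: \<Omega>_def)
  note R = \<Omega> \<phi> dF dF1
  have fr: "?q x \<in> frontier I" if x: "x \<in> frontier \<Omega>" for x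
  proof -
    have "x \<in> closure \<Omega>" "x \<notin> \<Omega>" using x \<Omega> by (auto simp: frontier_def interior_open)
    moreover have "?q ` closure \<Omega> \<subseteq> closure I"
    proof (rule image_closure_subset[OF continuous_on_quarter_norm closed_closure])
      show "?q ` \<Omega> \<subseteq> closure I" using closure_subset by (auto simp: \<Omega>_def)
    qed
    ultimately show ?thesis using I by (auto simp: frontier_def interior_open \<Omega>_def)
  qed
  have nonneg: "0 \<le> ?\<phi> y" for y
    using pos[of "?q y"] q0[of y] by (auto simp: radial_extension_def intro: less_imp_le)
  have cont: "isCont ?\<phi> x" for x
  proof (cases "x \<in> \<Omega> \<or> x \<in> frontier \<Omega>")
    case False
    then have "x \<in> - closure \<Omega>" using \<Omega> by (auto simp: frontier_def interior_open)
    then have "\<forall>\<^sub>F y in nhds x. y \<in> - closure \<Omega>" by (intro eventually_nhds_in_open) auto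
    then have "\<forall>\<^sub>F y in nhds x. ?\<phi> y = 0"
      using closure_subset[of \<Omega>] by (elim eventually_mono) (auto simp: radial_extension_def \<Omega>_def)
    then show ?thesis by (simp add: isCont_cong)
  next
    case True
    then show ?thesis
    proof
      assume "x \<in> \<Omega>"
      then show ?thesis using radial_has_derivative[OF R] has_derivative_continuous by blast
    next
      assume x: "x \<in> frontier \<Omega>"
      then have "x \<notin> \<Omega>" using \<Omega> by (auto simp: frontier_def interior_open)
      then have 0: "?\<phi> x = 0" by (simp add: radial_extension_def \<Omega>_def)
      have "isCont F (?q x)" "F (?q x) = 0" using bdry[OF fr[OF x] q0] by auto
      then have "((\<lambda>y. F (?q y)) \<longlongrightarrow> 0) (at x)"
        using isCont_tendsto_compose[of "?q x" F ?q "at x"] tendsto_quarter_norm[of x UNIV] by simp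
      then have "((\<lambda>y. \<bar>F (?q y)\<bar>) \<longlongrightarrow> 0) (at x)" by (simp add: tendsto_rabs_zero)
      \<comment> \<open>\<open>F\<close> continues beyond the boundary while the extension is cut
        off to 0; either way the modulus is at most that of \<open>F\<close>.\<close>
      then have "(?\<phi> \<longlongrightarrow> 0) (at x)"
        by (rule Lim_null_comparison[rotated]) (simp add: radial_extension_def)
      then show ?thesis by (simp add: isCont_def 0)
    qed
  qed
  have C2: "C2_on \<Omega> ?\<phi>"
    unfolding C2_on_def
  proof (intro conjI allI)
    show "?\<phi> differentiable_on \<Omega>"
      unfolding differentiable_on_def
      using radial_has_derivative[OF R] has_derivative_at_withinI differentiable_def by blast
    show "partial_deriv i ?\<phi> differentiable_on \<Omega>" for i
      unfolding differentiable_on_def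
      using radial_partial_has_derivative[OF R] has_derivative_at_withinI differentiable_def by blast
    show "continuous_on \<Omega> (partial_deriv j (partial_deriv i ?\<phi>))" for i j
    proof -
      have "isCont F1 (?q y)" "isCont F2 (?q y)" if "y \<in> \<Omega>" for y
        using dF1[OF that] DERIV_isCont F2[of "?q y"] that by (auto simp: \<Omega>_def)
      then have "continuous_on \<Omega> (\<lambda>y. F1 (?q y))" "continuous_on \<Omega> (\<lambda>y. F2 (?q y))"
        using isCont_o2[OF qc] by (auto intro!: continuous_at_imp_continuous_on)
      then have "continuous_on \<Omega> (\<lambda>y. F1 (?q y) * ((if i = j then 1 else 0) / 2) + F2 (?q y) * (y $ j / 2) * (y $ i / 2))"
        by (intro continuous_intros) auto
      then show ?thesis
        by (rule continuous_on_eq) (simp add: radial_partial_deriv2[OF R])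
    qed
  qed
  have eq: "laplacian ?\<phi> y - 1/2 * (y \<bullet> grad ?\<phi> y) + 1/2 * ?\<phi> y = 0" if "y \<in> \<Omega>" for y
  proof -
    have "?q y \<in> I" using that by (simp add: \<Omega>_def)
    from ode[OF this q0] radial_operator[OF R that refl] show ?thesis by linarith
  qed
  have bd: "((\<lambda>y. norm (grad ?\<phi> y)) \<longlongrightarrow> 1) (at x within \<Omega>)" if x: "x \<in> frontier \<Omega>" for x
  proof -
    have c: "isCont F1 (?q x)" "sqrt (?q x) * \<bar>F1 (?q x)\<bar> = 1" using bdry[OF fr[OF x] q0] by auto
    have "((\<lambda>y. \<bar>F1 (?q y)\<bar> / 2 * norm y) \<longlongrightarrow> \<bar>F1 (?q x)\<bar> / 2 * norm x) (at x within \<Omega>)"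
      by (intro tendsto_intros isCont_tendsto_compose[OF c(1)] tendsto_quarter_norm) auto
    moreover have "\<bar>F1 (?q x)\<bar> / 2 * norm x = 1"
      using c(2) by (simp add: real_sqrt_divide mult.commute)
    moreover have "\<forall>\<^sub>F y in at x within \<Omega>. \<bar>F1 (?q y)\<bar> / 2 * norm y = norm (grad ?\<phi> y)"
      by (simp add: eventually_at_filter radial_grad[OF R])
    ultimately show ?thesis by (simp add: tendsto_cong)
  qed
  have "radial ?\<phi>"
    unfolding radial_def radial_extension_def by (rule exI[of _ "\<lambda>r. if r\<^sup>2 / 4 \<in> I then F (r\<^sup>2 / 4) else 0"]) simp
  then show "radial_solution_P ?\<phi>"
    unfolding radial_solution_P_def solution_P_def posset
    using nonneg C2 eq bd cont by (auto simp: continuous_at_imp_continuous_on)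
qed

text \<open>\<open>undefined\<close> picks an arbitrary axis; by radiality the choice has no
  influence. As \<open>sqrt\<close> is odd, \<open>ray\<close> is continuous on the whole line and
  the profile of a radial function is even, so zeros and signs are discussed for nonnegative
  arguments.\<close>

definition ray :: "real \<Rightarrow> real^'n::finite" where
  "ray s = (2 * sqrt s) *\<^sub>R axis undefined 1"

definition profile :: "(real^'n::finite \<Rightarrow> real) \<Rightarrow> real \<Rightarrow> real" where
  "profile \<phi> s = \<phi> (ray s)"

text \<open>\<open>1 / sqrt s\<close> is \<open>dr/ds\<close> for \<open>r = 2 * sqrt s\<close>; it
  turns the radial derivative into one in \<open>s\<close>.\<close>

definition profile1 :: "(real^'n::finite \<Rightarrow> real) \<Rightarrow> real \<Rightarrow> real" where
  "profile1 \<phi> s = partial_deriv undefined \<phi> (ray s) / sqrt s"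

lemma norm_ray: "0 \<le> s \<Longrightarrow> norm (ray s) = 2 * sqrt s"
  by (simp add: ray_def)

lemma quarter_norm_ray: "0 \<le> s \<Longrightarrow> (norm (ray s))\<^sup>2 / 4 = s"
  by (simp add: norm_ray power_mult_distrib)

lemma continuous_on_ray: "continuous_on S ray"
  unfolding ray_def by (intro continuous_intros)

lemma radial_profile:
  assumes "radial \<phi>" shows "\<phi> y = profile \<phi> ((norm y)\<^sup>2 / 4)"
proof -
  obtain f where f: "\<And>y. \<phi> y = f (norm y)" using assms by (auto simp: radial_def)
  have "norm (ray ((norm y)\<^sup>2 / 4) :: real^'a) = norm y"
    by (simp add: norm_ray real_sqrt_divide)
  then show ?thesis by (simp add: profile_def f)
qed

lemma DERIV_ray:
  assumes "0 < s" "f differentiable (at (ray s))"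
  shows "((\<lambda>s. f (ray s)) has_real_derivative partial_deriv undefined f (ray s) / sqrt s) (at s)"
proof -
  let ?e = "axis undefined 1 :: real^'a"
  let ?D = "frechet_derivative f (at (ray s))"
  have D: "(f has_derivative ?D) (at (ray s))" using assms(2) by (simp add: frechet_derivative_works)
  have "((\<lambda>s. (2 * sqrt s) *\<^sub>R ?e) has_derivative (\<lambda>h. (h / sqrt s) *\<^sub>R ?e)) (at s)"
    using assms(1) by (auto intro!: derivative_eq_intros simp: field_simps)
  then have "(ray has_derivative (\<lambda>h. (h / sqrt s) *\<^sub>R ?e)) (at s)"
    by (simp add: ray_def[abs_def])
  from has_derivative_compose[OF this D]
  have "((\<lambda>s. f (ray s)) has_derivative (\<lambda>h. ?D ((h / sqrt s) *\<^sub>R ?e))) (at s)" .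
  moreover have "?D ((h / sqrt s) *\<^sub>R ?e) = partial_deriv undefined f (ray s) / sqrt s * h" for h
    using linear_cmul[OF has_derivative_linear[OF D], of "h / sqrt s" ?e] by (simp add: partial_deriv_def)
  ultimately show ?thesis
    unfolding has_field_derivative_def by (elim has_derivative_eq_rhs) (simp only: fun_eq_iff simp_thms)
qed

context
  fixes \<phi> :: "real^'n::finite \<Rightarrow> real"
  assumes sol: "radial_solution_P \<phi>"
begin

lemma open_positivity_set: "open (positivity_set \<phi>)"
  using sol by (auto simp: radial_solution_P_def solution_P_def positivity_set_def intro: open_Collect_less)

lemma profile_eq: "\<phi> y = profile \<phi> ((norm y)\<^sup>2 / 4)"
  using sol radial_profile by (auto simp: radial_solution_P_def)

lemma ray_in_positivity_set: "ray s \<in> positivity_set \<phi> \<longleftrightarrow> 0 < profile \<phi> s"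
  by (simp add: positivity_set_def profile_def)

lemma profile_nonneg: "0 \<le> profile \<phi> s"
  using sol by (simp add: radial_solution_P_def solution_P_def profile_def)

lemma continuous_on_profile: "continuous_on S (profile \<phi>)"
proof -
  have "continuous_on UNIV \<phi>" using sol by (simp add: radial_solution_P_def solution_P_def)
  then show ?thesis
    unfolding profile_def by (intro continuous_on_compose2[OF _ continuous_on_ray]) auto
qed

lemma profile_derivs:
  assumes "0 < s" "0 < profile \<phi> s"
  shows "(profile \<phi> has_real_derivative profile1 \<phi> s) (at s)"
    and "\<exists>D. (profile1 \<phi> has_real_derivative D) (at s)"
proof -
  have C2: "C2_on (positivity_set \<phi>) \<phi>" using sol by (simp add: radial_solution_P_def solution_P_def)
  have in_pos: "ray s \<in> positivity_set \<phi>" using assms ray_in_positivity_set by simp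
  have d: "\<phi> differentiable (at (ray s))" "partial_deriv i \<phi> differentiable (at (ray s))" for i
    using C2 in_pos open_positivity_set
    by (auto simp: C2_on_def differentiable_on_eq_differentiable_at)
  show "(profile \<phi> has_real_derivative profile1 \<phi> s) (at s)"
    unfolding profile_def[abs_def] profile1_def by (rule DERIV_ray[OF assms(1) d(1)])
  show "\<exists>D. (profile1 \<phi> has_real_derivative D) (at s)"
    unfolding profile1_def[abs_def]
    by (rule exI, rule DERIV_divide[OF DERIV_ray[OF assms(1) d(2)] DERIV_real_sqrt[OF assms(1)]])
      (use assms in simp)
qed

text \<open>The origin is removed because \<open>ray\<close> is not differentiable at
  \<open>s = 0\<close>; behaviour at the centre is treated separately.\<close>

lemma profile_ball_derivs:
  assumes "y \<in> positivity_set \<phi> - {0}"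
  shows "(profile \<phi> has_real_derivative profile1 \<phi> ((norm y)\<^sup>2 / 4)) (at ((norm y)\<^sup>2 / 4))"
    and "(profile1 \<phi> has_real_derivative deriv (profile1 \<phi>) ((norm y)\<^sup>2 / 4)) (at ((norm y)\<^sup>2 / 4))"
proof -
  have "0 < (norm y)\<^sup>2 / 4" "0 < profile \<phi> ((norm y)\<^sup>2 / 4)"
    using assms profile_eq[of y] by (auto simp: positivity_set_def)
  from profile_derivs[OF this]
  show "(profile \<phi> has_real_derivative profile1 \<phi> ((norm y)\<^sup>2 / 4)) (at ((norm y)\<^sup>2 / 4))"
    "(profile1 \<phi> has_real_derivative deriv (profile1 \<phi>) ((norm y)\<^sup>2 / 4)) (at ((norm y)\<^sup>2 / 4))"
    by (auto simp: DERIV_deriv_iff_real_differentiable real_differentiable_def)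
qed

lemma open_punctured: "open (positivity_set \<phi> - {0})"
  using open_positivity_set by (rule open_delete)

lemmas profile_formulas = open_punctured profile_eq profile_ball_derivs

lemma ray_punctured: "0 < s \<Longrightarrow> 0 < profile \<phi> s \<Longrightarrow> ray s \<in> positivity_set \<phi> - {0}"
  using ray_in_positivity_set norm_ray[of s, where 'a='n] by auto

lemma profile_ode:
  assumes "0 < s" "0 < profile \<phi> s"
  shows "(profile1 \<phi> has_real_derivative
    ((s - real CARD('n) / 2) * profile1 \<phi> s - profile \<phi> s / 2) / s) (at s)"
proof -
  have y: "ray s \<in> positivity_set \<phi> - {0}" using ray_punctured assms by simp
  have s: "s = (norm (ray s :: real^'n))\<^sup>2 / 4" using quarter_norm_ray[of s, where 'a='n] assms by simp
  have "laplacian \<phi> (ray s) - 1/2 * (ray s \<bullet> grad \<phi> (ray s)) + 1/2 * \<phi> (ray s) = 0"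
    using sol y by (simp add: radial_solution_P_def solution_P_def)
  then have "s * deriv (profile1 \<phi>) s = (s - real CARD('n) / 2) * profile1 \<phi> s - profile \<phi> s / 2"
    using radial_operator[OF profile_formulas y s] by linarith
  then have "deriv (profile1 \<phi>) s = ((s - real CARD('n) / 2) * profile1 \<phi> s - profile \<phi> s / 2) / s"
    using assms(1) by (metis nonzero_mult_div_cancel_left less_irrefl)
  then show ?thesis using profile_ball_derivs(2)[OF y] s by simp
qed

lemma profile_slope:
  assumes "0 < s" "profile \<phi> s = 0" "s \<in> closure {t. 0 < t \<and> 0 < profile \<phi> t}"
  shows "((\<lambda>t. sqrt t * \<bar>profile1 \<phi> t\<bar>) \<longlongrightarrow> 1) (at s within {t. 0 < t \<and> 0 < profile \<phi> t})"
proof -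
  let ?S = "{t. 0 < t \<and> 0 < profile \<phi> t}" and ?\<Omega> = "positivity_set \<phi>"
  have "ray s \<in> closure ?\<Omega>"
  proof -
    have "ray ` closure ?S \<subseteq> closure ?\<Omega>"
      by (rule image_closure_subset[OF continuous_on_ray closed_closure])
        (use ray_in_positivity_set closure_subset in blast)
    then show ?thesis using assms(3) by blast
  qed
  moreover have "ray s \<notin> ?\<Omega>" using assms ray_in_positivity_set by simp
  ultimately have "ray s \<in> frontier ?\<Omega>" using open_positivity_set by (simp add: frontier_def interior_open)
  then have "((\<lambda>y. norm (grad \<phi> y)) \<longlongrightarrow> 1) (at (ray s) within ?\<Omega>)"
    using sol by (simp add: radial_solution_P_def solution_P_def)
  moreover have "filterlim ray (at (ray s) within ?\<Omega>) (at s within ?S)"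
    unfolding filterlim_at
  proof
    show "(ray \<longlongrightarrow> ray s) (at s within ?S)"
      using continuous_on_ray[of UNIV] by (auto simp: continuous_on_def intro: tendsto_within_subset)
    have "ray t \<in> ?\<Omega> \<and> ray t \<noteq> (ray s :: real^'n)" if "t \<in> ?S" for t
    proof
      have "0 < \<phi> (ray t)" "\<phi> (ray s) = 0" using that assms(2) by (simp_all add: profile_def)
      then show "ray t \<in> ?\<Omega>" "ray t \<noteq> (ray s :: real^'n)" by (auto simp: positivity_set_def)
    qed
    then show "\<forall>\<^sub>F t in at s within ?S. ray t \<in> ?\<Omega> \<and> ray t \<noteq> (ray s :: real^'n)"
      by (auto simp: eventually_at_filter)
  qed
  ultimately have "((\<lambda>t. norm (grad \<phi> (ray t))) \<longlongrightarrow> 1) (at s within ?S)"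
    by (rule filterlim_compose)
  moreover have "norm (grad \<phi> (ray t)) = sqrt t * \<bar>profile1 \<phi> t\<bar>" if "t \<in> ?S" for t
  proof -
    have t: "0 < t" "0 < profile \<phi> t" using that by auto
    show ?thesis
      using radial_grad[OF profile_formulas ray_punctured[OF t]] quarter_norm_ray[of t, where 'a='n]
        norm_ray[of t, where 'a='n] t(1)
      by simp
  qed
  then have "\<forall>\<^sub>F t in at s within ?S. norm (grad \<phi> (ray t)) = sqrt t * \<bar>profile1 \<phi> t\<bar>"
    by (auto simp: eventually_at_filter)
  ultimately show ?thesis by (simp add: tendsto_cong)
qed

text \<open>A radial function that is differentiable at the origin has vanishing gradient there.\<close>

lemma profile_flat_at_0:
  assumes "0 < profile \<phi> 0"
  shows "((\<lambda>s. (profile \<phi> s - profile \<phi> 0) / sqrt s) \<longlongrightarrow> 0) (at_right 0)"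
proof -
  let ?e = "axis undefined 1 :: real^'n"
  let ?f = "\<lambda>t. \<phi> (t *\<^sub>R ?e)"
  have C2: "C2_on (positivity_set \<phi>) \<phi>" using sol by (simp add: radial_solution_P_def solution_P_def)
  have "(0 :: real^'n) \<in> positivity_set \<phi>"
    using assms by (simp add: positivity_set_def profile_def ray_def)
  then have "\<phi> differentiable (at 0)"
    using C2 open_positivity_set by (auto simp: C2_on_def differentiable_on_eq_differentiable_at)
  then obtain D where D: "(\<phi> has_derivative D) (at ((0::real) *\<^sub>R ?e))" by (auto simp: differentiable_def)
  have "((\<lambda>t. t *\<^sub>R ?e) has_derivative (\<lambda>h. h *\<^sub>R ?e)) (at 0)"
    by (intro derivative_eq_intros) auto
  from has_derivative_compose[OF this D] have "(?f has_derivative (\<lambda>h. D (h *\<^sub>R ?e))) (at 0)" .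
  moreover have "D (h *\<^sub>R ?e) = D ?e * h" for h
    using linear_cmul[OF has_derivative_linear[OF D], of h ?e] by simp
  ultimately have f: "(?f has_real_derivative D ?e) (at 0)" by (simp add: has_field_derivative_def)
  have even: "?f (- t) = ?f t" for t using profile_eq[of "(- t) *\<^sub>R ?e"] profile_eq[of "t *\<^sub>R ?e"] by simp
  have "((\<lambda>t. ?f (- t)) has_real_derivative D ?e * - 1) (at 0)"
    by (rule DERIV_chain'[where f = uminus]) (use f in \<open>auto intro!: derivative_eq_intros\<close>)
  then have "D ?e = - D ?e" unfolding even using f DERIV_unique by fastforce
  then have "D ?e = 0" by simp
  then have "((\<lambda>t. (?f t - ?f 0) / t) \<longlongrightarrow> 0) (at 0)"
    using f by (simp add: has_field_derivative_iff)
  moreover have "filterlim (\<lambda>s. 2 * sqrt s) (at 0) (at_right 0)"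
  proof (rule filterlim_atI)
    show "((\<lambda>s. 2 * sqrt s) \<longlongrightarrow> 0) (at_right 0)" by (auto intro!: tendsto_eq_intros)
    show "\<forall>\<^sub>F s in at_right 0. 2 * sqrt s \<noteq> 0" by (auto simp: eventually_at_filter)
  qed
  ultimately have "((\<lambda>s. (?f (2 * sqrt s) - ?f 0) / (2 * sqrt s)) \<longlongrightarrow> 0) (at_right 0)"
    by (rule filterlim_compose)
  from tendsto_mult_left[OF this, of 2]
  have "((\<lambda>s. 2 * ((profile \<phi> s - profile \<phi> 0) / (2 * sqrt s))) \<longlongrightarrow> 2 * 0) (at_right 0)"
    by (simp only: profile_def ray_def real_sqrt_zero mult_zero_right)
  moreover have "2 * (c / (2 * x)) = c / x" for c x :: real by simp
  ultimately show ?thesis by (simp only: mult_zero_right)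
qed

end

section \<open>Classification of the radial profiles\<close>

text \<open>\<open>no_max\<close> and \<open>no_min\<close> express openness relative to
  \<open>{0..}\<close>. In the last two cases \<open>p = 0\<close> is a punctured set, which only
  the equation can exclude.\<close>

lemma connected_halfline_cases:
  fixes I :: "real set"
  assumes sub: "I \<subseteq> {0..}" and ne: "I \<noteq> {}" and conn: "connected I"
    and no_max: "\<And>s. s \<in> I \<Longrightarrow> \<exists>t\<in>I. s < t"
    and no_min: "\<And>s. s \<in> I \<Longrightarrow> 0 < s \<Longrightarrow> \<exists>t\<in>I. t < s"
  obtains (ball) q where "0 < q" "I = {0..<q}"
  | (all) "I = {0..}"
  | (bounded) p q where "0 \<le> p" "p < q" "I = {p<..<q}"
  | (unbounded) p where "0 \<le> p" "I = {p<..}"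
proof -
  have nonneg: "0 \<le> s" if "s \<in> I" for s using that sub by auto
  have ge: "0 \<le> a" if "a < c" "{a<..<c} \<subseteq> I" for a c
  proof (rule ccontr)
    assume neg: "\<not> 0 \<le> a"
    then have "(a + min 0 c) / 2 \<in> {a<..<c}" using that(1) by (auto simp: min_def)
    then have "0 \<le> (a + min 0 c) / 2" using nonneg that(2) by blast
    then show False using neg by (auto simp: min_def split: if_splits)
  qed
  have min_0: "a = 0" if "a \<in> I" "\<And>t. t \<in> I \<Longrightarrow> a \<le> t" for a
    using no_min[OF that(1)] nonneg[OF that(1)] that(2) by force
  have no_Max: False if "c \<in> I" "\<And>t. t \<in> I \<Longrightarrow> t \<le> c" for c
    using no_max[OF that(1)] that(2) by force
  have "\<exists>a c. I = {} \<or> I = UNIV \<or> I = {..<c} \<or> I = {..c} \<or> I = {a<..} \<or> I = {a..}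
    \<or> I = {a<..<c} \<or> I = {a<..c} \<or> I = {a..<c} \<or> I = {a..c}"
    by (rule interval_cases) (use conn connected_iff_interval in metis)
  then obtain a c where "I = {} \<or> I = UNIV \<or> I = {..<c} \<or> I = {..c} \<or> I = {a<..} \<or> I = {a..}
    \<or> I = {a<..<c} \<or> I = {a<..c} \<or> I = {a..<c} \<or> I = {a..c}"
    by (elim exE)
  then show thesis
  proof (elim disjE)
    assume 1: "I = {}" then show ?thesis using ne by simp
  next
    assume 2: "I = UNIV"
    then have "-1 \<in> I" by simp
    from nonneg[OF this] show ?thesis by simp
  next
    assume 3: "I = {..<c}"
    then have "c - 1 - \<bar>c\<bar> \<in> I" by simp
    from nonneg[OF this] show ?thesis by linarith
  next
    assume 4: "I = {..c}"
    then have "c - 1 - \<bar>c\<bar> \<in> I" by simp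
    from nonneg[OF this] show ?thesis by linarith
  next
    assume 5: "I = {a<..}"
    have "{a<..<a + 1} \<subseteq> I" unfolding 5 by auto
    then have "0 \<le> a" by (rule ge[rotated]) simp
    then show ?thesis using 5 by (rule unbounded)
  next
    assume 6: "I = {a..}"
    have "a = 0" by (rule min_0) (simp_all add: 6)
    then show ?thesis using 6 all by simp
  next
    assume 7: "I = {a<..<c}"
    then have "a < c" using ne by auto
    then have "0 \<le> a" by (rule ge) (simp add: 7)
    then show ?thesis using \<open>a < c\<close> 7 by (rule bounded)
  next
    assume 8: "I = {a<..c}"
    then have "a < c" using ne by auto
    then have False by (intro no_Max[of c]) (simp_all add: 8)
    then show ?thesis ..
  next
    assume 9: "I = {a..<c}"
    then have "a < c" using ne by auto
    then have "a = 0" by (intro min_0) (simp_all add: 9)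
    then show ?thesis using 9 \<open>a < c\<close> ball by simp
  next
    assume 10: "I = {a..c}"
    then have "a \<le> c" using ne by auto
    then have False by (intro no_Max[of c]) (simp_all add: 10)
    then show ?thesis ..
  qed
qed

lemma positive_part_cases:
  fixes g :: "real \<Rightarrow> real"
  assumes cont: "continuous_on {0..} g" and conn: "connected {s. 0 \<le> s \<and> 0 < g s}"
    and ne: "{s. 0 \<le> s \<and> 0 < g s} \<noteq> {}"
  obtains (ball) q where "0 < q" "{s. 0 \<le> s \<and> 0 < g s} = {0..<q}"
  | (all) "{s. 0 \<le> s \<and> 0 < g s} = {0..}"
  | (bounded) p q where "0 \<le> p" "p < q" "{s. 0 \<le> s \<and> 0 < g s} = {p<..<q}"
  | (unbounded) p where "0 \<le> p" "{s. 0 \<le> s \<and> 0 < g s} = {p<..}"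
proof (rule connected_halfline_cases[OF _ ne conn])
  let ?I = "{s. 0 \<le> s \<and> 0 < g s}"
  show "?I \<subseteq> {0..}" by auto
  have nbhd: "\<exists>d>0. \<forall>t\<ge>0. \<bar>t - s\<bar> < d \<longrightarrow> 0 < g t" if "0 \<le> s" "0 < g s" for s
  proof -
    have "\<exists>d>0. \<forall>t\<in>{0..}. dist t s < d \<longrightarrow> dist (g t) (g s) < g s"
      using cont that by (auto simp: continuous_on_iff)
    then obtain d where d: "d > 0" "\<And>t. 0 \<le> t \<Longrightarrow> \<bar>t - s\<bar> < d \<Longrightarrow> \<bar>g t - g s\<bar> < g s"
      by (auto simp: dist_real_def)
    have "0 < g t" if "0 \<le> t" "\<bar>t - s\<bar> < d" for t using d(2)[OF that] by linarith
    with d(1) show ?thesis by blast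
  qed
  show "\<exists>t\<in>?I. s < t" if "s \<in> ?I" for s
  proof -
    have s: "0 \<le> s" "0 < g s" using that by auto
    obtain d where d: "d > 0" "\<And>t. 0 \<le> t \<Longrightarrow> \<bar>t - s\<bar> < d \<Longrightarrow> 0 < g t" using nbhd[OF s] by blast
    have "0 < g (s + d/2)" using d(1) s by (intro d(2)) auto
    then show ?thesis using d(1) s by (intro bexI[of _ "s + d/2"]) auto
  qed
  show "\<exists>t\<in>?I. t < s" if "s \<in> ?I" "0 < s" for s
  proof -
    have s: "0 < s" "0 < g s" using that by auto
    obtain d where d: "d > 0" "\<And>t. 0 \<le> t \<Longrightarrow> \<bar>t - s\<bar> < d \<Longrightarrow> 0 < g t" using nbhd[OF less_imp_le[OF s(1)] s(2)] by blast
    have "0 < g (max 0 (s - d/2))" using d(1) s(1) by (intro d(2)) (auto simp: max_def)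
    then show ?thesis using d(1) s(1) by (intro bexI[of _ "max 0 (s - d/2)"]) auto
  qed
qed (use that in blast)+

text \<open>What a radial solution retains along a ray: the dimension enters through
  \<open>b\<close>, and the slope condition concerns positive zeros adherent to the positivity
  set.\<close>

locale kummer_profile = kummer +
  fixes g g1 :: "real \<Rightarrow> real"
  assumes cont_g: "continuous_on {0..} g"
    and sol_g: "ksol {s. 0 < s \<and> 0 < g s} g g1"
    and slope_g: "\<And>s. 0 < s \<Longrightarrow> g s = 0 \<Longrightarrow> s \<in> closure {t. 0 < t \<and> 0 < g t} \<Longrightarrow>
      ((\<lambda>t. sqrt t * \<bar>g1 t\<bar>) \<longlongrightarrow> 1) (at s within {t. 0 < t \<and> 0 < g t})"
begin

text \<open>\<open>h\<close> is differentiable across \<open>s\<close>, so the limits of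
  \<open>g\<close> and \<open>g1\<close> along \<open>Z\<close> are values of \<open>h\<close> and
  \<open>h1\<close>. In the applications \<open>Z\<close> is an interval of positivity with end
  point \<open>s\<close>.\<close>

lemma slope_at_end:
  assumes s: "0 < s" "g s = 0" and Z: "Z \<subseteq> {t. 0 < t \<and> 0 < g t}" "at s within Z \<noteq> bot"
    and h: "ksol {0<..} h h1" "\<And>t. t \<in> Z \<Longrightarrow> g t = h t" "\<And>t. t \<in> Z \<Longrightarrow> g1 t = h1 t"
  shows "h s = 0" "sqrt s * \<bar>h1 s\<bar> = 1"
proof -
  have "s \<in> closure {t. 0 < t \<and> 0 < g t}"
  proof -
    have "closure (Z - {s}) \<subseteq> closure {t. 0 < t \<and> 0 < g t}" using Z(1) by (intro closure_mono) auto
    then show ?thesis using Z(2) not_trivial_limit_within[of s Z] by auto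
  qed
  then have "((\<lambda>t. sqrt t * \<bar>g1 t\<bar>) \<longlongrightarrow> 1) (at s within {t. 0 < t \<and> 0 < g t})"
    by (rule slope_g[OF s])
  then have "((\<lambda>t. sqrt t * \<bar>g1 t\<bar>) \<longlongrightarrow> 1) (at s within Z)"
    using Z(1) by (rule tendsto_within_subset)
  moreover have "\<forall>\<^sub>F t in at s within Z. sqrt t * \<bar>g1 t\<bar> = sqrt t * \<bar>h1 t\<bar>"
    by (simp add: eventually_at_filter h(3))
  ultimately have 1: "((\<lambda>t. sqrt t * \<bar>h1 t\<bar>) \<longlongrightarrow> 1) (at s within Z)"
    by (simp add: tendsto_cong)
  have "isCont h1 s" "isCont h s" using ksolD[OF h(1), of s] s(1) DERIV_isCont by auto
  then have "isCont (\<lambda>t. sqrt t * \<bar>h1 t\<bar>) s" by (intro continuous_intros) auto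
  then have "((\<lambda>t. sqrt t * \<bar>h1 t\<bar>) \<longlongrightarrow> sqrt s * \<bar>h1 s\<bar>) (at s within Z)"
    by (auto simp: isCont_def intro: tendsto_within_subset)
  with 1 show "sqrt s * \<bar>h1 s\<bar> = 1" using tendsto_unique[OF Z(2)] by blast
  have "(g \<longlongrightarrow> g s) (at s within Z)"
  proof (rule tendsto_within_subset)
    show "(g \<longlongrightarrow> g s) (at s within {0..})" using cont_g s(1) by (simp add: continuous_on_def)
    show "Z \<subseteq> {0..}" using Z(1) by auto
  qed
  moreover have "\<forall>\<^sub>F t in at s within Z. g t = h t"
    by (simp add: eventually_at_filter h(2))
  ultimately have "(h \<longlongrightarrow> g s) (at s within Z)"
    by (simp add: tendsto_cong)
  moreover have "(h \<longlongrightarrow> h s) (at s within Z)"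
    using \<open>isCont h s\<close> by (auto simp: isCont_def intro: tendsto_within_subset)
  ultimately show "h s = 0" using s(2) tendsto_unique[OF Z(2)] by metis
qed

lemma profile_representation:
  assumes "convex Z" "Z \<subseteq> {t. 0 < t \<and> 0 < g t}"
  obtains \<alpha> \<gamma> where "\<And>s. s \<in> Z \<Longrightarrow> g s = \<alpha> * B s + \<gamma> * U s"
    "\<And>s. s \<in> Z \<Longrightarrow> g1 s = \<gamma> * U1 s - \<alpha> * K s"
proof (rule ksol_representation[OF assms(1) _ ksol_mono[OF sol_g assms(2)] ksol_mono[OF ksol_U]])
  show Z: "Z \<subseteq> {0<..}" "Z \<subseteq> {0<..}" using assms(2) by auto
  show "U1 s * B s + U s * K s = 2 / W s" if "s \<in> Z" for s
    using Z that by (intro wronskian_U_B) auto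
  show "(2::real) \<noteq> 0" by simp
qed (rule that)

lemma ksol_BU: "ksol {0<..} (\<lambda>s. \<alpha> * B s + \<gamma> * U s) (\<lambda>s. \<gamma> * U1 s - \<alpha> * K s)"
  using ksol_lincomb[OF ksol_B ksol_U, of \<alpha> \<gamma>] by (simp add: algebra_simps)

text \<open>Positivity to the right of \<open>p\<close> forces \<open>h1 p >= 0\<close>, so the
  slope condition fixes the sign of \<open>h1 p\<close> as well as its size. The values of
  \<open>h\<close> and \<open>h1\<close> at \<open>p\<close> then determine both
  coefficients.\<close>

lemma profile_eq_shot:
  assumes p: "0 < p" "g p = 0" and Z: "convex Z" "Z \<subseteq> {p<..}" "at p within Z \<noteq> bot"
    and pos: "\<And>t. t \<in> Z \<Longrightarrow> 0 < g t"
  shows "\<And>t. t \<in> Z \<Longrightarrow> g t = shot p t" "\<And>t. t \<in> Z \<Longrightarrow> g1 t = shot1 p t"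
proof -
  have Z': "Z \<subseteq> {t. 0 < t \<and> 0 < g t}" using Z pos p by auto
  obtain \<alpha> \<gamma> where g: "\<And>s. s \<in> Z \<Longrightarrow> g s = \<alpha> * B s + \<gamma> * U s"
    "\<And>s. s \<in> Z \<Longrightarrow> g1 s = \<gamma> * U1 s - \<alpha> * K s"
    using profile_representation[OF Z(1) Z'] by blast
  define h where "h s = \<alpha> * B s + \<gamma> * U s" for s
  define h1 where "h1 s = \<gamma> * U1 s - \<alpha> * K s" for s
  have sol: "ksol {0<..} h h1" using ksol_BU[of \<alpha> \<gamma>] by (simp only: h_def[abs_def] h1_def[abs_def])
  have gh: "\<And>t. t \<in> Z \<Longrightarrow> g t = h t" "\<And>t. t \<in> Z \<Longrightarrow> g1 t = h1 t"
    using g by (simp_all add: h_def h1_def)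
  have h: "h p = 0" by (rule slope_at_end(1)[OF p Z' Z(3) sol gh])
  have slope: "sqrt p * \<bar>h1 p\<bar> = 1" by (rule slope_at_end(2)[OF p Z' Z(3) sol gh])
  have "(h has_real_derivative h1 p) (at p within Z)"
    using ksolD(1)[OF sol, of p] p by (simp add: has_field_derivative_at_within)
  then have "((\<lambda>t. (h t - h p) / (t - p)) \<longlongrightarrow> h1 p) (at p within Z)"
    by (simp add: has_field_derivative_iff)
  moreover have "\<forall>\<^sub>F t in at p within Z. 0 \<le> (h t - h p) / (t - p)"
  proof -
    have "0 \<le> (h t - h p) / (t - p)" if "t \<in> Z" for t
      using gh(1)[OF that] pos[OF that] Z(2) that h by auto
    then show ?thesis by (simp add: eventually_at_filter)
  qed
  ultimately have "0 \<le> h1 p" by (rule tendsto_lowerbound) (rule Z(3))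
  with slope have "h1 p = 1 / sqrt p" using p(1) by (simp add: field_simps)
  then have h1: "\<gamma> * U1 p - \<alpha> * K p = 1 / sqrt p" by (simp add: h1_def)
  have h0: "\<alpha> * B p + \<gamma> * U p = 0" using h by (simp add: h_def)
  have W: "0 < W p" using p W_pos by simp
  have wr: "U1 p * B p + U p * K p = 2 / W p" using wronskian_U_B[OF p(1)] .
  \<comment> \<open>Cramer's rule for the equations \<open>h0\<close> and \<open>h1\<close>, whose
    determinant is the Wronskian \<open>2 / W p\<close>.\<close>
  have "\<gamma> * (2 / W p) = (\<gamma> * U1 p - \<alpha> * K p) * B p + (\<alpha> * B p + \<gamma> * U p) * K p"
    unfolding wr[symmetric] by (simp add: algebra_simps)
  then have ga: "\<gamma> = W p / (2 * sqrt p) * B p"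
    unfolding h1 h0 using W p by (simp add: field_simps)
  have "- \<alpha> * (2 / W p) = (\<gamma> * U1 p - \<alpha> * K p) * U p - (\<alpha> * B p + \<gamma> * U p) * U1 p"
    unfolding wr[symmetric] by (simp add: algebra_simps)
  then have al: "\<alpha> = - (W p / (2 * sqrt p) * U p)"
    unfolding h1 h0 using W p by (simp add: field_simps)
  show "g t = shot p t" "g1 t = shot1 p t" if "t \<in> Z" for t
    using g[OF that] by (simp_all add: ga al shot_def shot1_def P_def P1_def algebra_simps)
qed

lemma at_within_Ioo_nontrivial: "p < q \<Longrightarrow> at p within {p<..<q} \<noteq> bot" "p < q \<Longrightarrow> at q within {p<..<q} \<noteq> bot"
  for p q :: real
  using islimpt_greaterThanLessThan1[of p q] islimpt_greaterThanLessThan2[of p q]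
  by (simp_all add: trivial_limit_within)

end

locale kummer2_profile = kummer2 + kummer_profile
begin

text \<open>\<open>g\<close> is continuous at 0, whereas \<open>U\<close> tends to minus infinity
  there.\<close>

lemma no_U_component:
  assumes "0 < q" "\<And>s. 0 < s \<Longrightarrow> s < q \<Longrightarrow> g s = \<alpha> * B s + \<gamma> * U s"
  shows "\<gamma> = 0" "\<alpha> = g 0"
proof -
  have "(g \<longlongrightarrow> g 0) (at 0 within {0..})" using cont_g by (simp add: continuous_on_def)
  then have "(g \<longlongrightarrow> g 0) (at_right 0)" by (rule tendsto_within_subset) auto
  then have g0: "((\<lambda>s. \<alpha> * B s + \<gamma> * U s) \<longlongrightarrow> g 0) (at_right 0)"
  proof (rule Lim_transform_eventually)
    show "\<forall>\<^sub>F s in at_right 0. g s = \<alpha> * B s + \<gamma> * U s"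
      by (rule eventually_mono[OF eventually_at_right_real[OF assms(1)]]) (use assms(2) in auto)
  qed
  show \<gamma>: "\<gamma> = 0"
  proof (rule ccontr)
    assume "\<gamma> \<noteq> 0"
    have "((\<lambda>s. ((\<alpha> * B s + \<gamma> * U s) - \<alpha> * B s) / \<gamma>) \<longlongrightarrow> (g 0 - \<alpha> * 1) / \<gamma>) (at_right 0)"
      using \<open>\<gamma> \<noteq> 0\<close> by (intro tendsto_intros g0 B_tendsto_0)
    then have "(U \<longlongrightarrow> (g 0 - \<alpha>) / \<gamma>) (at_right 0)" using \<open>\<gamma> \<noteq> 0\<close> by simp
    moreover have "filterlim U at_infinity (at_right 0)"
      using U_at_0 at_bot_le_at_infinity filterlim_mono by blast
    ultimately show False using not_tendsto_and_filterlim_at_infinity[OF trivial_limit_at_right_real] by blast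
  qed
  have "((\<lambda>s. \<alpha> * B s) \<longlongrightarrow> \<alpha> * 1) (at_right 0)" by (intro tendsto_intros B_tendsto_0)
  with g0 \<gamma> show "\<alpha> = g 0" using tendsto_unique[OF trivial_limit_at_right_real] by fastforce
qed

lemma profile_near_0:
  assumes "0 < q" "\<And>s. 0 < s \<Longrightarrow> s < q \<Longrightarrow> 0 < g s"
  shows "\<And>s. 0 < s \<Longrightarrow> s < q \<Longrightarrow> g s = g 0 * B s" "\<And>s. 0 < s \<Longrightarrow> s < q \<Longrightarrow> g1 s = - (g 0 * K s)"
proof -
  obtain \<alpha> \<gamma> where "\<And>s. s \<in> {0<..<q} \<Longrightarrow> g s = \<alpha> * B s + \<gamma> * U s"
    "\<And>s. s \<in> {0<..<q} \<Longrightarrow> g1 s = \<gamma> * U1 s - \<alpha> * K s"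
    using profile_representation[of "{0<..<q}"] assms by (auto simp: subset_iff)
  moreover from this(1) have "\<gamma> = 0" "\<alpha> = g 0" using no_U_component[OF assms(1)] by auto
  ultimately show "g s = g 0 * B s" "g1 s = - (g 0 * K s)" if "0 < s" "s < q" for s
    using that by auto
qed

text \<open>Near 0 the profile is \<open>g 0 * B\<close>. This rules out the punctured ball and the
  punctured space.\<close>

lemma profile_not_positive_right_of_0:
  assumes "g 0 = 0" "0 < q" "\<And>s. 0 < s \<Longrightarrow> s < q \<Longrightarrow> 0 < g s" shows False
  using profile_near_0(1)[OF assms(2,3), of "q/2"] assms(1,2) assms(3)[of "q/2"] by simp

text \<open>A zero beyond \<open>p\<close> is incompatible with \<open>s_star <= p\<close>, and for
  \<open>p < s_star\<close> there is only one. The slopes give \<open>|flux p| = |flux q|\<close>;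
  the signs of \<open>B\<close> on the two sides of \<open>s0\<close> turn this into a vanishing
  sum.\<close>

lemma profile_annulus:
  assumes p: "0 < p" "p < q" "g p = 0" "g q = 0" and pos: "\<And>s. p < s \<Longrightarrow> s < q \<Longrightarrow> 0 < g s"
  shows "p < s_star" "s0 < q" "rho q = rho p" "flux p + flux q = 0"
    "\<And>s. p < s \<Longrightarrow> s < q \<Longrightarrow> g s = shot p s"
proof -
  have Z: "{p<..<q} \<subseteq> {t. 0 < t \<and> 0 < g t}" using p pos by auto
  have g: "\<And>t. t \<in> {p<..<q} \<Longrightarrow> g t = shot p t" "\<And>t. t \<in> {p<..<q} \<Longrightarrow> g1 t = shot1 p t"
    using profile_eq_shot[OF p(1,3) convex_real_interval(8) _ at_within_Ioo_nontrivial(1)[OF p(2)]] pos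
    by (simp_all add: subset_iff)
  then show "\<And>s. p < s \<Longrightarrow> s < q \<Longrightarrow> g s = shot p s" by simp
  have q: "0 < q" using p by simp
  have e: "shot p q = 0" "sqrt q * \<bar>shot1 p q\<bar> = 1"
    using slope_at_end[OF q p(4) Z at_within_Ioo_nontrivial(2)[OF p(2)] ksol_shot g] by auto
  then have Pq: "P p q = 0" using W_pos[OF p(1)] p by (simp add: shot_def)
  show ps: "p < s_star" using P_pos_right[of p q] p Pq by (cases "p < s_star") auto
  obtain e where e': "s0 < e" "rho e = rho p" using ex_second_zero[OF p(1) ps] .
  then have "q = e" using P_sign[OF p(1) ps e' p(2)] Pq by (cases q e rule: linorder_cases) auto
  with e' show q': "s0 < q" "rho q = rho p" by auto
  have "0 < flux p" "flux q < 0"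
    using p ps s_star_less_s0 B_pos_iff[of p] W_pos[of p] q' q B_neg_iff[of q] W_pos[of q]
    by (auto simp: flux_def divide_neg_pos mult_pos_neg)
  moreover have "\<bar>flux p / flux q\<bar> = 1"
    using e(2) q by (simp add: abs_mult flip: shot1_second_zero[OF p(1) ps q'])
  ultimately show "flux p + flux q = 0" by (simp add: abs_if divide_less_0_iff field_simps split: if_splits)
qed

text \<open>For \<open>p < s_star\<close> the second zero of \<open>shot p\<close> would fall into
  the region where \<open>g\<close> is positive.\<close>

lemma profile_exterior:
  assumes p: "0 < p" "g p = 0" and pos: "\<And>s. p < s \<Longrightarrow> 0 < g s"
  shows "s_star \<le> p" "\<And>s. p < s \<Longrightarrow> g s = shot p s"
proof -
  show g: "\<And>s. p < s \<Longrightarrow> g s = shot p s"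
    using profile_eq_shot(1)[OF p, of "{p<..}"] pos by auto
  show "s_star \<le> p"
  proof (rule ccontr)
    assume "\<not> s_star \<le> p"
    then have ps: "p < s_star" by simp
    obtain e where e: "s0 < e" "rho e = rho p" using ex_second_zero[OF p(1) ps] .
    then have "p < e" using ps s_star_less_s0 by simp
    then have "0 < P p e" using g[of e] pos[of e] shot_pos_iff[OF p(1), of e] by simp
    then show False using P_sign(1)[OF p(1) ps e \<open>p < e\<close>] by simp
  qed
qed

end

context kummer
begin

lemma U_exp_asymp: "((\<lambda>s. U s / (s powr (- b - 1/2) * exp s)) \<longlongrightarrow> 0) at_top"
proof -
  have "((\<lambda>s. (U s / sqrt s) * (sqrt s / (s powr (- b - 1/2) * exp s))) \<longlongrightarrow> 2 / l * 0) at_top"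
    by (intro tendsto_mult U_asymp) real_asymp
  then have "((\<lambda>s. (U s / sqrt s) * (sqrt s / (s powr (- b - 1/2) * exp s))) \<longlongrightarrow> 0) at_top"
    by (simp only: mult_zero_right)
  moreover have "\<forall>\<^sub>F s in at_top. (U s / sqrt s) * (sqrt s / (s powr (- b - 1/2) * exp s)) = U s / (s powr (- b - 1/2) * exp s)"
    using eventually_gt_at_top[of 0] by eventually_elim simp
  ultimately show ?thesis by (rule Lim_transform_eventually)
qed

text \<open>The exponential growth comes from the \<open>B\<close> part, whose coefficient is
  proportional to \<open>- U a\<close>. It disappears exactly when \<open>U a = 0\<close>, and then
  the growth drops to that of \<open>U\<close>.\<close>

lemma shot_exp_asymp:
  "((\<lambda>s. shot a s / (s powr (- b - 1/2) * exp s)) \<longlongrightarrow> W a / (2 * sqrt a) * (U a * l)) at_top"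
proof -
  have "((\<lambda>s. W a / (2 * sqrt a) * (B a * (U s / (s powr (- b - 1/2) * exp s)) - U a * (B s / (s powr (- b - 1/2) * exp s))))
      \<longlongrightarrow> W a / (2 * sqrt a) * (B a * 0 - U a * - l)) at_top"
    by (intro tendsto_intros U_exp_asymp B_asymp)
  moreover have "x * (p * (u / e) - r * (w / e)) = x * (p * u - r * w) / e" for x p u e r w :: real
    by (simp add: diff_divide_distrib right_diff_distrib)
  moreover have "B a * 0 - U a * - l = U a * l" by simp
  ultimately show ?thesis by (simp only: shot_def P_def)
qed

text \<open>Normalised to radial slope \<open>-1\<close> at \<open>s0\<close>.\<close>

definition ball_profile :: "real \<Rightarrow> real" where "ball_profile s = B s / (sqrt s0 * K s0)"

end

context kummer_profile
begin

text \<open>The absence of the second solution near 0 is a hypothesis because it has different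
  causes for n >= 2 and on the line.\<close>

lemma profile_ball:
  assumes q: "0 < q" "g q = 0" and pos: "0 < g 0" "\<And>s. 0 < s \<Longrightarrow> s < q \<Longrightarrow> 0 < g s"
    and g: "\<And>s. 0 < s \<Longrightarrow> s < q \<Longrightarrow> g s = g 0 * B s" "\<And>s. 0 < s \<Longrightarrow> s < q \<Longrightarrow> g1 s = - (g 0 * K s)"
  shows "q = s0" "\<And>s. 0 \<le> s \<Longrightarrow> s < s0 \<Longrightarrow> g s = ball_profile s"
proof -
  have sol: "ksol {0<..} (\<lambda>s. g 0 * B s) (\<lambda>s. - (g 0 * K s))"
    using ksol_lincomb[OF ksol_B ksol_B, of "g 0" 0] by simp
  have Z: "{0<..<q} \<subseteq> {t. 0 < t \<and> 0 < g t}" using pos by auto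
  have gh: "\<And>t. t \<in> {0<..<q} \<Longrightarrow> g t = g 0 * B t" "\<And>t. t \<in> {0<..<q} \<Longrightarrow> g1 t = - (g 0 * K t)"
    using g by auto
  have e: "g 0 * B q = 0" "sqrt q * \<bar>- (g 0 * K q)\<bar> = 1"
    using slope_at_end[OF q Z at_within_Ioo_nontrivial(2)[OF q(1)] sol gh] by auto
  then have "B q = 0" using pos(1) by simp
  then show qs: "q = s0" using B_pos_iff[of q] B_neg_iff[of q] q(1) by (cases q s0 rule: linorder_cases) auto
  have "g 0 * (sqrt s0 * K s0) = 1"
    using e(2) pos(1) K_pos[of q] q(1) qs by (simp add: abs_mult mult_ac)
  then have c: "g 0 = 1 / (sqrt s0 * K s0)" using K_pos[of s0] s0_pos by (simp add: field_simps)
  show "g s = ball_profile s" if "0 \<le> s" "s < s0" for s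
  proof (cases "s = 0")
    case True
    then show ?thesis using c by (simp add: ball_profile_def B_0)
  next
    case False
    then show ?thesis using g(1)[of s] that qs c by (simp add: ball_profile_def)
  qed
qed

end

section \<open>Profiles on the line\<close>

locale kummer1_profile = kummer_profile +
  assumes b_half: "b = 1/2"
begin

text \<open>\<open>sqrt s\<close> is \<open>|y| / 2\<close>: linear functions solve the equation,
  and in dimension one \<open>|y|\<close> is linear on each half-line.\<close>

lemma ksol_sqrt: "ksol {0<..} sqrt (\<lambda>s. 1 / (2 * sqrt s))"
  unfolding ksol_def
proof (intro ballI conjI)
  fix s :: real assume "s \<in> {0<..}"
  then have s: "0 < s" by simp
  have ss: "sqrt s * sqrt s = s" using s by simp
  show "(sqrt has_real_derivative 1 / (2 * sqrt s)) (at s)"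
    using DERIV_real_sqrt[OF s] by (simp add: field_simps)
  have "((\<lambda>s. 1 / (2 * sqrt s)) has_real_derivative - (2 * (inverse (sqrt s) / 2)) / (2 * sqrt s * (2 * sqrt s))) (at s)"
    using s by (auto intro!: derivative_eq_intros)
  moreover have "- (2 * (inverse q / 2)) / (2 * q * (2 * q)) = ((q * q - 1/2) * (1 / (2 * q)) - q / 2) / (q * q)" if "0 < q" for q :: real
    using that by (simp add: field_simps)
  from this[of "sqrt s"] have "- (2 * (inverse (sqrt s) / 2)) / (2 * sqrt s * (2 * sqrt s))
      = ((s - b) * (1 / (2 * sqrt s)) - sqrt s / 2) / s"
    using s unfolding b_half ss by simp
  ultimately show "((\<lambda>s. 1 / (2 * sqrt s)) has_real_derivative ((s - b) * (1 / (2 * sqrt s)) - sqrt s / 2) / s) (at s)"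
    by simp
qed

text \<open>The constant has to be read off at \<open>s = 0\<close>, where \<open>sqrt\<close> is
  not differentiable. After cancelling \<open>sqrt s\<close> what remains is
  \<open>exp (- s) * (B s / 2 + s * K s)\<close>, smooth and constant on the whole line.\<close>

lemma wronskian_sqrt_B:
  assumes "0 < s" shows "1 / (2 * sqrt s) * B s + sqrt s * K s = (1/2) / W s"
proof -
  let ?f = "\<lambda>s. exp (- s) * (B s / 2 + s * K s)"
  have "(?f has_real_derivative 0) (at x)" for x
  proof -
    have "(?f has_real_derivative - exp (- x) * (B x / 2 + x * K x) + exp (- x) * (- K x / 2 + (K x + x * K1 x))) (at x)"
      by (auto intro!: derivative_eq_intros B_deriv K_deriv)
    moreover have "- exp (- x) * (B x / 2 + x * K x) + exp (- x) * (- K x / 2 + (K x + x * K1 x)) = 0"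
    proof -
      have "x * K1 x = (x - 1/2) * K x + B x / 2" using B_ode[of x] by (metis b_half)
      then show ?thesis by (simp add: algebra_simps)
    qed
    ultimately show ?thesis by simp
  qed
  then have "?f s = ?f 0" using DERIV_isconst_all[of ?f s 0] by blast
  then have e: "exp (- s) * (B s / 2 + s * K s) = 1/2" by (simp add: B_0)
  have gen: "1 / (2 * q) * x + q * k = (1/2) / (q * e)"
    if "0 < q" "0 < e" "e * (x / 2 + (q * q) * k) = 1/2" for q e x k :: real
  proof -
    have "(1 / (2 * q) * x + q * k) * q = x / 2 + (q * q) * k"
      using that(1) by (simp add: field_simps)
    then have "(1 / (2 * q) * x + q * k) * (q * e) = 1/2"
      using that(3) by (metis mult.assoc mult.commute)
    then show ?thesis using that by (metis nonzero_eq_divide_eq mult_pos_pos less_irrefl)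
  qed
  have "W s = sqrt s * exp (- s)" by (metis W_def assms b_half less_imp_le powr_half_sqrt)
  moreover have "sqrt s * sqrt s = s" using assms by simp
  ultimately show ?thesis using gen[of "sqrt s" "exp (- s)" "B s" "K s"] e assms by (simp only: real_sqrt_gt_zero exp_gt_zero)
qed

lemma profile_representation_sqrt:
  assumes "p < q" "0 \<le> p" "\<And>s. p < s \<Longrightarrow> s < q \<Longrightarrow> 0 < g s"
  obtains \<alpha> \<gamma> where "\<And>s. s \<in> {p<..<q} \<Longrightarrow> g s = \<alpha> * B s + \<gamma> * sqrt s"
    "\<And>s. s \<in> {p<..<q} \<Longrightarrow> g1 s = \<gamma> * (1 / (2 * sqrt s)) - \<alpha> * K s"
    "ksol {0<..} (\<lambda>s. \<alpha> * B s + \<gamma> * sqrt s) (\<lambda>s. \<gamma> * (1 / (2 * sqrt s)) - \<alpha> * K s)"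
proof -
  have Z: "{p<..<q} \<subseteq> {t. 0 < t \<and> 0 < g t}" "{p<..<q} \<subseteq> {0<..}" using assms by auto
  have sol: "ksol {0<..} (\<lambda>s. \<alpha> * B s + \<gamma> * sqrt s) (\<lambda>s. \<gamma> * (1 / (2 * sqrt s)) - \<alpha> * K s)" for \<alpha> \<gamma>
    using ksol_lincomb[OF ksol_B ksol_sqrt, of \<alpha> \<gamma>] by (simp add: algebra_simps)
  obtain \<alpha> \<gamma> where "\<And>s. s \<in> {p<..<q} \<Longrightarrow> g s = \<alpha> * B s + \<gamma> * sqrt s"
    "\<And>s. s \<in> {p<..<q} \<Longrightarrow> g1 s = \<gamma> * (1 / (2 * sqrt s)) - \<alpha> * K s"
  proof (rule ksol_representation[OF _ Z(2) ksol_mono[OF sol_g Z(1)] ksol_mono[OF ksol_sqrt Z(2)]])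
    show "1 / (2 * sqrt s) * B s + sqrt s * K s = (1/2) / W s" if "s \<in> {p<..<q}" for s
      using Z(2) that by (intro wronskian_sqrt_B) auto
  qed auto
  with sol show ?thesis using that by blast
qed

text \<open>\<open>sqrt\<close> has no zero for \<open>s > 0\<close>, so the quotient of a solution
  by it is strictly monotone unless their Wronskian vanishes. Two zeros therefore force a vanishing
  Wronskian, and then the slope at \<open>p\<close> is 0 instead of 1.\<close>

lemma no_annulus:
  assumes p: "0 < p" "p < q" "g p = 0" "g q = 0" and pos: "\<And>s. p < s \<Longrightarrow> s < q \<Longrightarrow> 0 < g s"
  shows False
proof -
  obtain \<alpha> \<gamma> where rep: "\<And>s. s \<in> {p<..<q} \<Longrightarrow> g s = \<alpha> * B s + \<gamma> * sqrt s"
    "\<And>s. s \<in> {p<..<q} \<Longrightarrow> g1 s = \<gamma> * (1 / (2 * sqrt s)) - \<alpha> * K s"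
    "ksol {0<..} (\<lambda>s. \<alpha> * B s + \<gamma> * sqrt s) (\<lambda>s. \<gamma> * (1 / (2 * sqrt s)) - \<alpha> * K s)"
    using profile_representation_sqrt[OF p(2) less_imp_le[OF p(1)] pos] by blast
  define h where "h s = \<alpha> * B s + \<gamma> * sqrt s" for s
  define h1 where "h1 s = \<gamma> * (1 / (2 * sqrt s)) - \<alpha> * K s" for s
  have sol: "ksol {0<..} h h1" using rep(3) by (simp only: h_def[abs_def] h1_def[abs_def])
  have gh: "\<And>t. t \<in> {p<..<q} \<Longrightarrow> g t = h t" "\<And>t. t \<in> {p<..<q} \<Longrightarrow> g1 t = h1 t"
    using rep(1,2) by (simp_all add: h_def h1_def)
  have Z: "{p<..<q} \<subseteq> {t. 0 < t \<and> 0 < g t}" and q: "0 < q" using p pos by auto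
  have hp: "h p = 0" "sqrt p * \<bar>h1 p\<bar> = 1"
    by (rule slope_at_end[OF p(1,3) Z at_within_Ioo_nontrivial(1)[OF p(2)] sol gh]; assumption)+
  have hq: "h q = 0"
    by (rule slope_at_end(1)[OF q p(4) Z at_within_Ioo_nontrivial(2)[OF p(2)] sol gh])
  define D where "D s = h1 s * sqrt s - h s * (1 / (2 * sqrt s))" for s
  obtain c where c: "\<And>s. s \<in> {0<..} \<Longrightarrow> W s * D s = c"
    using wronskian_const[OF convex_real_interval(3) order_refl sol ksol_sqrt] unfolding D_def by blast
  have d: "((\<lambda>s. h s / sqrt s) has_real_derivative D s / (sqrt s * sqrt s)) (at s)"
    if "0 < s" for s
    unfolding D_def using ksolD(1)[OF sol, of s] ksolD(1)[OF ksol_sqrt, of s] that by (intro DERIV_divide) auto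
  have "\<exists>z. p < z \<and> z < q \<and> h q / sqrt q - h p / sqrt p = (q - p) * (D z / (sqrt z * sqrt z))"
    using p(1) by (intro MVT2[OF p(2)] d) auto
  then obtain z where z: "p < z" "z < q" "(q - p) * (D z / (sqrt z * sqrt z)) = 0"
    using hp(1) hq by auto
  then have "D z = 0" using p by simp
  then have "c = 0" using c[of z] z p by simp
  then have "D p = 0" using c[of p] p W_pos[of p] by simp
  then have "h1 p = 0" using hp(1) p by (simp add: D_def)
  then show False using hp(2) by simp
qed

text \<open>Since \<open>sqrt\<close> is continuous at 0, continuity of \<open>g\<close> determines
  \<open>\<alpha>\<close> alone. After division by \<open>sqrt s\<close> the \<open>B\<close> part
  tends to 0 and \<open>\<gamma>\<close> remains, so flatness at the origin removes it.\<close>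

lemma sqrt_component:
  assumes q: "0 < q" and g: "\<And>s. s \<in> {0<..<q} \<Longrightarrow> g s = \<alpha> * B s + \<gamma> * sqrt s"
  shows "\<alpha> = g 0"
    and "((\<lambda>s. (g s - g 0) / sqrt s) \<longlongrightarrow> 0) (at_right 0) \<Longrightarrow> \<gamma> = 0"
proof -
  have ev: "\<forall>\<^sub>F s in at_right 0. s \<in> {0<..<q}" using eventually_at_right_real[OF q] .
  have B0: "(B \<longlongrightarrow> 1) (at_right 0)"
    using isCont_B[of 0] by (auto simp: isCont_def B_0 intro: filterlim_mono at_le)
  have "(g \<longlongrightarrow> g 0) (at 0 within {0..})" using cont_g by (simp add: continuous_on_def)
  then have "(g \<longlongrightarrow> g 0) (at_right 0)" by (rule tendsto_within_subset) auto
  then have "((\<lambda>s. \<alpha> * B s + \<gamma> * sqrt s) \<longlongrightarrow> g 0) (at_right 0)"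
    by (rule Lim_transform_eventually) (rule eventually_mono[OF ev], rule g)
  moreover have "((\<lambda>s. \<alpha> * B s + \<gamma> * sqrt s) \<longlongrightarrow> \<alpha> * 1 + \<gamma> * sqrt 0) (at_right 0)"
    by (intro tendsto_intros B0)
  ultimately show \<alpha>: "\<alpha> = g 0" using tendsto_unique[OF trivial_limit_at_right_real] by fastforce
  assume flat: "((\<lambda>s. (g s - g 0) / sqrt s) \<longlongrightarrow> 0) (at_right 0)"
  have "((\<lambda>s. (B s - B 0) / (s - 0)) \<longlongrightarrow> - K 0) (at_right 0)"
    using B_deriv[of 0] has_field_derivative_at_within[of B "- K 0" 0 "{0<..}"]
    by (simp add: has_field_derivative_iff)
  moreover have "(sqrt \<longlongrightarrow> sqrt 0) (at_right 0)" by (intro tendsto_intros)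
  ultimately have "((\<lambda>s. \<alpha> * ((B s - B 0) / (s - 0) * sqrt s) + \<gamma>) \<longlongrightarrow> \<alpha> * (- K 0 * sqrt 0) + \<gamma>) (at_right 0)"
    by (intro tendsto_intros)
  moreover have "\<forall>\<^sub>F s in at_right 0. \<alpha> * ((B s - B 0) / (s - 0) * sqrt s) + \<gamma> = (g s - g 0) / sqrt s"
  proof (rule eventually_mono[OF ev])
    fix s assume s: "s \<in> {0<..<q}"
    have gen: "a * ((x - 1) / (r * r) * r) + c = (a * x + c * r - a) / r" if "0 < r" for a x r c :: real
      using that by (simp add: field_simps)
    have "sqrt s * sqrt s = s" using s by simp
    then show "\<alpha> * ((B s - B 0) / (s - 0) * sqrt s) + \<gamma> = (g s - g 0) / sqrt s"
      using gen[of "sqrt s" \<alpha> "B s" \<gamma>] s g[OF s] \<alpha> by (simp add: B_0)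
  qed
  ultimately have "((\<lambda>s. (g s - g 0) / sqrt s) \<longlongrightarrow> \<gamma>) (at_right 0)"
    by (simp add: tendsto_cong)
  then show "\<gamma> = 0" using flat tendsto_unique[OF trivial_limit_at_right_real] by blast
qed

text \<open>A zero at the centre removes the \<open>B\<close> part, and the zero at \<open>q\<close>
  then removes the \<open>sqrt\<close> part.\<close>

lemma no_punctured_interval:
  assumes q: "0 < q" "g q = 0" and pos: "g 0 = 0" "\<And>s. 0 < s \<Longrightarrow> s < q \<Longrightarrow> 0 < g s"
  shows False
proof -
  obtain \<alpha> \<gamma> where rep: "\<And>s. s \<in> {0<..<q} \<Longrightarrow> g s = \<alpha> * B s + \<gamma> * sqrt s"
    "\<And>s. s \<in> {0<..<q} \<Longrightarrow> g1 s = \<gamma> * (1 / (2 * sqrt s)) - \<alpha> * K s"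
    "ksol {0<..} (\<lambda>s. \<alpha> * B s + \<gamma> * sqrt s) (\<lambda>s. \<gamma> * (1 / (2 * sqrt s)) - \<alpha> * K s)"
    using profile_representation_sqrt[OF q(1) order_refl pos(2)] by blast
  have "{0<..<q} \<subseteq> {t. 0 < t \<and> 0 < g t}" using pos by auto
  from slope_at_end(1)[OF q this at_within_Ioo_nontrivial(2)[OF q(1)] rep(3,1,2)]
  have "\<alpha> * B q + \<gamma> * sqrt q = 0" .
  moreover have "\<alpha> = 0" using sqrt_component(1)[OF q(1) rep(1)] pos(1) by simp
  ultimately have "\<gamma> = 0" using q by simp
  with \<open>\<alpha> = 0\<close> have "g (q/2) = 0" using rep(1)[of "q/2"] q by simp
  then show False using pos(2)[of "q/2"] q by simp
qed

lemma profile_ball_1: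
  assumes "0 < q" "g q = 0" "0 < g 0" "\<And>s. 0 < s \<Longrightarrow> s < q \<Longrightarrow> 0 < g s"
    and flat: "((\<lambda>s. (g s - g 0) / sqrt s) \<longlongrightarrow> 0) (at_right 0)"
  shows "q = s0" "\<And>s. 0 \<le> s \<Longrightarrow> s < s0 \<Longrightarrow> g s = ball_profile s"
proof -
  obtain \<alpha> \<gamma> where rep: "\<And>s. s \<in> {0<..<q} \<Longrightarrow> g s = \<alpha> * B s + \<gamma> * sqrt s"
    "\<And>s. s \<in> {0<..<q} \<Longrightarrow> g1 s = \<gamma> * (1 / (2 * sqrt s)) - \<alpha> * K s"
    "ksol {0<..} (\<lambda>s. \<alpha> * B s + \<gamma> * sqrt s) (\<lambda>s. \<gamma> * (1 / (2 * sqrt s)) - \<alpha> * K s)"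
    using profile_representation_sqrt[OF assms(1) order_refl assms(4)] by blast
  have "\<alpha> = g 0"
    by (rule sqrt_component(1)[OF assms(1), of \<alpha> \<gamma>]) (rule rep(1))
  moreover have "\<gamma> = 0"
    by (rule sqrt_component(2)[OF assms(1), of \<alpha> \<gamma>, OF _ flat]) (rule rep(1))
  ultimately have g: "\<And>s. 0 < s \<Longrightarrow> s < q \<Longrightarrow> g s = g 0 * B s" "\<And>s. 0 < s \<Longrightarrow> s < q \<Longrightarrow> g1 s = - (g 0 * K s)"
    using rep by auto
  show "q = s0" "\<And>s. 0 \<le> s \<Longrightarrow> s < s0 \<Longrightarrow> g s = ball_profile s"
    using profile_ball[OF assms(1-4) g] by auto
qed

end

section \<open>From profiles to solutions\<close>

lemma radial_extension_eqI:
  fixes \<phi> :: "real^'n::finite \<Rightarrow> real"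
  assumes "radial_solution_P \<phi>"
    and "\<And>s. 0 \<le> s \<Longrightarrow> 0 < profile \<phi> s \<longleftrightarrow> s \<in> I"
    and "\<And>s. 0 \<le> s \<Longrightarrow> s \<in> I \<Longrightarrow> profile \<phi> s = F s"
  shows "\<phi> = radial_extension I F"
proof
  fix y :: "real^'n"
  let ?s = "(norm y)\<^sup>2 / 4"
  have s: "0 \<le> ?s" by simp
  show "\<phi> y = radial_extension I F y"
    using profile_eq[OF assms(1), of y] assms(2,3)[OF s] profile_nonneg[OF assms(1), of ?s]
    by (cases "?s \<in> I") (auto simp: radial_extension_def)
qed

lemma profile_pos_iff:
  fixes \<phi> :: "real^'n::finite \<Rightarrow> real"
  assumes "0 \<le> s"
  shows "0 < profile \<phi> s \<longleftrightarrow> (ray s :: real^'n) \<in> positivity_set \<phi>"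
  by (simp add: profile_def positivity_set_def)

lemma quarter_square_less_iff: "0 \<le> s \<Longrightarrow> 0 < R \<Longrightarrow> 2 * sqrt s < R \<longleftrightarrow> s < R\<^sup>2 / 4"
  and less_quarter_square_iff: "0 \<le> s \<Longrightarrow> 0 < R \<Longrightarrow> R < 2 * sqrt s \<longleftrightarrow> R\<^sup>2 / 4 < s"
proof -
  assume *: "0 \<le> s" "0 < R"
  have "2 * sqrt s < R \<longleftrightarrow> sqrt s < sqrt (R\<^sup>2 / 4)" "R < 2 * sqrt s \<longleftrightarrow> sqrt (R\<^sup>2 / 4) < sqrt s"
    using * by (auto simp: real_sqrt_divide)
  then show "2 * sqrt s < R \<longleftrightarrow> s < R\<^sup>2 / 4" "R < 2 * sqrt s \<longleftrightarrow> R\<^sup>2 / 4 < s" by simp_all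
qed

lemma norm_less_sqrt_iff: "0 < s \<Longrightarrow> norm y < 2 * sqrt s \<longleftrightarrow> (norm y)\<^sup>2 / 4 < s"
  and less_norm_sqrt_iff: "0 < s \<Longrightarrow> 2 * sqrt s < norm y \<longleftrightarrow> s < (norm y)\<^sup>2 / 4"
  for y :: "'a::real_normed_vector"
proof -
  assume s: "0 < s"
  have "norm y = 2 * sqrt ((norm y)\<^sup>2 / 4)" by (simp add: real_sqrt_divide)
  then have "norm y < 2 * sqrt s \<longleftrightarrow> sqrt ((norm y)\<^sup>2 / 4) < sqrt s"
    "2 * sqrt s < norm y \<longleftrightarrow> sqrt s < sqrt ((norm y)\<^sup>2 / 4)" by linarith+
  then show "norm y < 2 * sqrt s \<longleftrightarrow> (norm y)\<^sup>2 / 4 < s" "2 * sqrt s < norm y \<longleftrightarrow> s < (norm y)\<^sup>2 / 4"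
    by (simp_all only: real_sqrt_less_iff)
qed

lemma profile_ball_set:
  assumes "positivity_set \<phi> = ball 0 R" "0 < R" "0 \<le> s"
  shows "0 < profile \<phi> s \<longleftrightarrow> s < R\<^sup>2 / 4"
  using assms quarter_square_less_iff[of s R] by (simp add: profile_pos_iff norm_ray)

lemma profile_annulus_set:
  assumes "positivity_set \<phi> = annulus x y" "0 < x" "0 < y" "0 \<le> s"
  shows "0 < profile \<phi> s \<longleftrightarrow> x\<^sup>2 / 4 < s \<and> s < y\<^sup>2 / 4"
  using assms quarter_square_less_iff[of s y] less_quarter_square_iff[of s x]
  by (simp add: profile_pos_iff norm_ray annulus_def)

lemma profile_exterior_set:
  assumes "positivity_set \<phi> = - cball 0 R" "0 < R" "0 \<le> s"
  shows "0 < profile \<phi> s \<longleftrightarrow> R\<^sup>2 / 4 < s"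
  using assms less_quarter_square_iff[of s R] by (simp add: profile_pos_iff norm_ray not_le)

lemma connected_profile_positive:
  fixes \<phi> :: "real^'n::finite \<Rightarrow> real"
  assumes "radial_solution_P \<phi>" "connected (positivity_set \<phi>)"
  shows "connected {s. 0 \<le> s \<and> 0 < profile \<phi> s}"
proof -
  have "{s. 0 \<le> s \<and> 0 < profile \<phi> s} = (\<lambda>y. (norm y)\<^sup>2 / 4) ` positivity_set \<phi>" (is "?A = ?q ` ?\<Omega>")
  proof (intro equalityI subsetI)
    fix s assume s: "s \<in> ?A"
    then have "ray s \<in> ?\<Omega>" using profile_pos_iff[of s \<phi>] by simp
    moreover have "s = ?q (ray s :: real^'n)" using quarter_norm_ray[of s, where 'a='n] s by simp
    ultimately show "s \<in> ?q ` ?\<Omega>" by blast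
  next
    fix s assume "s \<in> ?q ` ?\<Omega>"
    then obtain y where y: "s = ?q y" "0 < \<phi> y" by (auto simp: positivity_set_def)
    then have "0 < profile \<phi> s" using profile_eq[OF assms(1), of y] by (simp only:)
    moreover have "0 \<le> s" unfolding y(1) by simp
    ultimately show "s \<in> ?A" by simp
  qed
  then show ?thesis
    using connected_continuous_image[OF continuous_on_quarter_norm assms(2)] by simp
qed

lemma profile_pos_exists:
  fixes \<phi> :: "real^'n::finite \<Rightarrow> real"
  assumes "radial_solution_P \<phi>" "\<phi> \<noteq> (\<lambda>_. 0)"
  shows "\<exists>s\<ge>0. 0 < profile \<phi> s"
proof -
  obtain y where "\<phi> y \<noteq> 0" using assms(2) by auto
  moreover have "0 \<le> \<phi> y" using assms(1) by (simp add: radial_solution_P_def solution_P_def)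
  ultimately have "0 < profile \<phi> ((norm y)\<^sup>2 / 4)" using profile_eq[OF assms(1), of y] by simp
  then show ?thesis by (intro exI[of _ "(norm y)\<^sup>2 / 4"]) simp
qed

lemma radial_extension_quotient_limit:
  fixes H :: "real^'n::finite \<Rightarrow> real"
  assumes "((\<lambda>s. F s / h s) \<longlongrightarrow> c) at_top" "\<And>y. y \<noteq> 0 \<Longrightarrow> H y = d * h ((norm y)\<^sup>2 / 4)"
  shows "((\<lambda>y. radial_extension {p<..} F y / H y) \<longlongrightarrow> c / d) at_infinity"
proof -
  have lim: "filterlim (\<lambda>y :: real^'n. (norm y)\<^sup>2 / 4) at_top at_infinity"
  proof -
    have "filterlim (\<lambda>r::real. r\<^sup>2 / 4) at_top at_top" by real_asymp
    then show ?thesis using filterlim_norm_at_top by (rule filterlim_compose)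
  qed
  have "((\<lambda>y :: real^'n. F ((norm y)\<^sup>2 / 4) / h ((norm y)\<^sup>2 / 4) / d) \<longlongrightarrow> c / d) at_infinity"
  \<comment> \<open>For \<open>d = 0\<close> both sides are 0 by the convention for
    division.\<close>
  proof (cases "d = 0")
    case False
    then show ?thesis
      by (intro tendsto_divide tendsto_const filterlim_compose[OF assms(1) lim])
  qed simp
  moreover have "\<forall>\<^sub>F y :: real^'n in at_infinity. max 0 p < (norm y)\<^sup>2 / 4"
    using lim unfolding filterlim_at_top_dense by blast
  then have "\<forall>\<^sub>F y :: real^'n in at_infinity. F ((norm y)\<^sup>2 / 4) / h ((norm y)\<^sup>2 / 4) / d = radial_extension {p<..} F y / H y"
  proof eventually_elim
    case (elim y)
    then have "y \<noteq> 0" by auto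
    with elim show ?case by (simp add: radial_extension_def assms(2) mult.commute)
  qed
  ultimately show ?thesis by (rule Lim_transform_eventually)
qed

lemma last_zero:
  fixes g :: "real \<Rightarrow> real"
  assumes "continuous_on {z..s} g" "g z = 0" "g s \<noteq> 0" "z \<le> s"
  obtains p where "z \<le> p" "p < s" "g p = 0" "\<And>t. p < t \<Longrightarrow> t \<le> s \<Longrightarrow> g t \<noteq> 0"
proof -
  let ?Z = "{t \<in> {z..s}. g t = 0}"
  have "closed ?Z"
    using assms(1) by (intro continuous_closed_preimage_constant closed_atLeastAtMost)
  moreover have "bounded ?Z"
    by (rule bounded_subset[OF bounded_closed_interval]) auto
  ultimately have "compact ?Z" by (simp add: compact_eq_bounded_closed)
  moreover have "?Z \<noteq> {}" using assms by auto
  ultimately obtain p where p: "p \<in> ?Z" "\<And>t. t \<in> ?Z \<Longrightarrow> t \<le> p"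
    using compact_attains_sup[of ?Z] by blast
  show ?thesis
  proof
    show "z \<le> p" "g p = 0" using p(1) by auto
    show "p < s" using p(1) assms(3) by (auto simp: less_le)
    show "g t \<noteq> 0" if "p < t" "t \<le> s" for t
      using p(2)[of t] p(1) that by auto
  qed
qed

lemma first_zero:
  fixes g :: "real \<Rightarrow> real"
  assumes "continuous_on {s..z} g" "g z = 0" "g s \<noteq> 0" "s \<le> z"
  obtains q where "q \<le> z" "s < q" "g q = 0" "\<And>t. s \<le> t \<Longrightarrow> t < q \<Longrightarrow> g t \<noteq> 0"
proof -
  have "continuous_on {- z..- s} (\<lambda>t. g (- t))"
    by (intro continuous_on_compose2[OF assms(1)] continuous_intros) auto
  then obtain p where "- z \<le> p" "p < - s" "g (- p) = 0" "\<And>t. p < t \<Longrightarrow> t \<le> - s \<Longrightarrow> g (- t) \<noteq> 0"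
    using last_zero[of "- z" "- s" "\<lambda>t. g (- t)"] assms by auto
  then show ?thesis using that[of "- p"] by (metis minus_le_iff minus_less_iff minus_minus neg_le_iff_le)
qed

context kummer
begin

lemma kummer_profileI:
  fixes \<phi> :: "real^'n::finite \<Rightarrow> real"
  assumes "b = real CARD('n) / 2" "radial_solution_P \<phi>"
  shows "kummer_profile b (profile \<phi>) (profile1 \<phi>)"
proof (unfold_locales)
  show "continuous_on {0..} (profile \<phi>)" using assms(2) by (rule continuous_on_profile)
  show "ksol {s. 0 < s \<and> 0 < profile \<phi> s} (profile \<phi>) (profile1 \<phi>)"
    unfolding ksol_def using profile_derivs(1)[OF assms(2)] profile_ode[OF assms(2)]
    by (simp add: assms(1))
  show "((\<lambda>t. sqrt t * \<bar>profile1 \<phi> t\<bar>) \<longlongrightarrow> 1) (at s within {t. 0 < t \<and> 0 < profile \<phi> t})"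
    if "0 < s" "profile \<phi> s = 0" "s \<in> closure {t. 0 < t \<and> 0 < profile \<phi> t}" for s
    using profile_slope[OF assms(2) that] .
qed

lemma ball_solution:
  assumes "b = real CARD('n::finite) / 2"
  shows "radial_solution_P (radial_extension {..<s0} ball_profile :: real^'n \<Rightarrow> real)"
    and "positivity_set (radial_extension {..<s0} ball_profile :: real^'n \<Rightarrow> real) = ball 0 (2 * sqrt s0)"
proof -
  let ?c = "sqrt s0 * K s0"
  have c: "0 < ?c" using s0_pos K_pos[of s0] by simp
  have dF: "(ball_profile has_real_derivative - K s / ?c) (at s)" for s
    unfolding ball_profile_def[abs_def] by (rule DERIV_cdivide[OF B_deriv])
  have dF1: "((\<lambda>s. - K s / ?c) has_real_derivative - K1 s / ?c) (at s)" for s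
    by (rule DERIV_cdivide[OF DERIV_minus[OF K_deriv]])
  have cF2: "isCont (\<lambda>s. - K1 s / ?c) s" for s
    using c continuous_on_BK(3)[of UNIV] by (intro continuous_intros) (auto simp: continuous_on_eq_continuous_at)
  have ode: "s * (- K1 s / ?c) = (s - real CARD('n) / 2) * (- K s / ?c) - ball_profile s / 2" for s
  proof -
    have "s * (- K1 s / ?c) = - (s * K1 s) / ?c" by simp
    also have "\<dots> = (s - b) * (- K s / ?c) - ball_profile s / 2"
      unfolding B_ode ball_profile_def by (simp add: add_divide_distrib diff_divide_distrib)
    finally show ?thesis by (simp add: assms)
  qed
  have pos: "0 < ball_profile s" if "s \<in> {..<s0}" "0 \<le> s" for s
    using that B_pos_iff[of s] c by (simp add: ball_profile_def)
  have bd: "ball_profile s = 0 \<and> isCont ball_profile s \<and> isCont (\<lambda>s. - K s / ?c) s \<and> sqrt s * \<bar>- K s / ?c\<bar> = 1"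
    if "s \<in> frontier {..<s0}" for s
  proof -
    have s: "s = s0" using that by (simp add: frontier_def interior_open)
    show ?thesis
      using DERIV_isCont[OF dF, of s] DERIV_isCont[OF dF1, of s] c K_pos[of s0] s0_pos
      unfolding s by (simp add: ball_profile_def B_s0)
  qed
  note E = radial_solution_P_extension[where 'n='n, OF open_lessThan pos dF dF1 cF2 ode bd]
  show "radial_solution_P (radial_extension {..<s0} ball_profile :: real^'n \<Rightarrow> real)"
    by (rule E(1)) auto
  have "positivity_set (radial_extension {..<s0} ball_profile :: real^'n \<Rightarrow> real) = {y. (norm y)\<^sup>2 / 4 \<in> {..<s0}}"
    by (rule E(2)) auto
  also have "\<dots> = ball 0 (2 * sqrt s0)"
    by (intro set_eqI) (simp only: mem_Collect_eq lessThan_iff mem_ball dist_0_norm norm_less_sqrt_iff[OF s0_pos])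
  finally show "positivity_set (radial_extension {..<s0} ball_profile :: real^'n \<Rightarrow> real) = ball 0 (2 * sqrt s0)" .
qed

lemma shot_solution:
  assumes b: "b = real CARD('n::finite) / 2" and p: "0 < p" and I: "open I" "I \<subseteq> {p<..}"
    and pos: "\<And>s. s \<in> I \<Longrightarrow> 0 < shot p s"
    and fr: "\<And>s. s \<in> frontier I \<Longrightarrow> 0 < s \<and> shot p s = 0 \<and> sqrt s * \<bar>shot1 p s\<bar> = 1"
  shows "radial_solution_P (radial_extension I (shot p) :: real^'n \<Rightarrow> real)"
    and "positivity_set (radial_extension I (shot p) :: real^'n \<Rightarrow> real) = {y. (norm y)\<^sup>2 / 4 \<in> I}"
proof -
  let ?F2 = "\<lambda>s. ((s - b) * shot1 p s - shot p s / 2) / s"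
  note d = ksolD[OF ksol_shot[of p]]
  have gt: "0 < s" if "s \<in> I" for s using that I(2) p by auto
  have c: "isCont (shot p) s" "isCont (shot1 p) s" if "0 < s" for s
    using d[of s] that DERIV_isCont by auto
  have dF: "(shot p has_real_derivative shot1 p s) (at s)" if "s \<in> I" for s
    using d(1)[of s] gt[OF that] by simp
  have dF1: "(shot1 p has_real_derivative ?F2 s) (at s)" if "s \<in> I" for s
    using d(2)[of s] gt[OF that] by simp
  have cF2: "isCont ?F2 s" if "s \<in> I" for s
    using c[OF gt[OF that]] gt[OF that] by (intro continuous_intros) auto
  have ode: "s * ?F2 s = (s - real CARD('n) / 2) * shot1 p s - shot p s / 2" if "s \<in> I" for s
    using gt[OF that] by (simp add: b)
  have bd: "shot p s = 0 \<and> isCont (shot p) s \<and> isCont (shot1 p) s \<and> sqrt s * \<bar>shot1 p s\<bar> = 1"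
    if "s \<in> frontier I" for s using fr[OF that] c[of s] by auto
  note E = radial_solution_P_extension[where 'n='n, OF I(1) pos dF dF1 cF2 ode bd]
  show "radial_solution_P (radial_extension I (shot p) :: real^'n \<Rightarrow> real)"
    by (rule E(1)) auto
  show "positivity_set (radial_extension I (shot p) :: real^'n \<Rightarrow> real) = {y. (norm y)\<^sup>2 / 4 \<in> I}"
    by (rule E(2)) auto
qed

end

context kummer2
begin

lemma exterior_solution:
  assumes "b = real CARD('n::finite) / 2" "s_star \<le> p"
  shows "radial_solution_P (radial_extension {p<..} (shot p) :: real^'n \<Rightarrow> real)"
    and "positivity_set (radial_extension {p<..} (shot p) :: real^'n \<Rightarrow> real) = - cball 0 (2 * sqrt p)"
proof -
  have p: "0 < p" using assms s_star_pos by simp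
  have pos: "0 < shot p s" if "s \<in> {p<..}" for s
    using that P_pos_right[OF assms(2)] shot_pos_iff[OF p] by simp
  have fr: "0 < s \<and> shot p s = 0 \<and> sqrt s * \<bar>shot1 p s\<bar> = 1" if "s \<in> frontier {p<..}" for s
  proof -
    have s: "s = p" using that by (simp add: frontier_def interior_open)
    have "0 < sqrt p * shot1 p p" using shot1_self[OF p] by simp
    then have "0 < shot1 p p" using p by (simp add: zero_less_mult_iff)
    then show ?thesis unfolding s using p shot_self[of p] shot1_self[OF p] by simp
  qed
  note E = shot_solution[OF assms(1) p open_greaterThan order_refl pos fr]
  show "radial_solution_P (radial_extension {p<..} (shot p) :: real^'n \<Rightarrow> real)"
    by (rule E(1)) auto
  have "positivity_set (radial_extension {p<..} (shot p) :: real^'n \<Rightarrow> real) = {y. (norm y)\<^sup>2 / 4 \<in> {p<..}}"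
    by (rule E(2)) auto
  also have "\<dots> = - cball 0 (2 * sqrt p)"
    by (intro set_eqI) (simp only: mem_Collect_eq greaterThan_iff Compl_iff mem_cball dist_0_norm not_le less_norm_sqrt_iff[OF p])
  finally show "positivity_set (radial_extension {p<..} (shot p) :: real^'n \<Rightarrow> real) = - cball 0 (2 * sqrt p)" .
qed

lemma annulus_solution:
  assumes b: "b = real CARD('n::finite) / 2" and p: "0 < p" "p < s_star"
    and q: "s0 < q" "rho q = rho p" "flux p + flux q = 0"
  shows "radial_solution_P (radial_extension {p<..<q} (shot p) :: real^'n \<Rightarrow> real)"
    and "positivity_set (radial_extension {p<..<q} (shot p) :: real^'n \<Rightarrow> real) = annulus (2 * sqrt p) (2 * sqrt q)"
proof -
  have pq: "p < q" and q0: "0 < q" using p q s_star_less_s0 by auto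
  have pos: "0 < shot p s" if "s \<in> {p<..<q}" for s
    using that P_sign(1)[OF p q(1,2)] shot_pos_iff[OF p(1)] by simp
  have fr: "0 < s \<and> shot p s = 0 \<and> sqrt s * \<bar>shot1 p s\<bar> = 1" if "s \<in> frontier {p<..<q}" for s
  proof -
    have "s = p \<or> s = q" using that pq by (auto simp: frontier_def interior_open)
    then show ?thesis
    proof
      assume s: "s = p"
      have "0 < sqrt p * shot1 p p" using shot1_self[OF p(1)] by simp
      then have "0 < shot1 p p" using p by (simp add: zero_less_mult_iff)
      then show ?thesis unfolding s using p shot_self[of p] shot1_self[OF p(1)] by simp
    next
      assume s: "s = q"
      have "\<not> 0 < P p q" "\<not> P p q < 0" using P_sign[OF p q(1,2) pq] by auto
      then have 0: "shot p q = 0" by (simp add: shot_def)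
      have "flux q \<noteq> 0" using q s0_pos B_neg_iff[of q] W_pos[of q] by (simp add: flux_def)
      moreover have "flux p = - flux q" using q(3) by simp
      ultimately have "sqrt q * shot1 p q = - 1" using shot1_second_zero[OF p q(1,2)] by simp
      then have "\<bar>sqrt q * shot1 p q\<bar> = 1" by simp
      then show ?thesis unfolding s using q0 0 by (simp add: abs_mult)
    qed
  qed
  have sub: "{p<..<q} \<subseteq> {p<..}" by auto
  note E = shot_solution[OF b p(1) open_greaterThanLessThan sub pos fr]
  show "radial_solution_P (radial_extension {p<..<q} (shot p) :: real^'n \<Rightarrow> real)"
    by (rule E(1)) auto
  have "positivity_set (radial_extension {p<..<q} (shot p) :: real^'n \<Rightarrow> real) = {y. (norm y)\<^sup>2 / 4 \<in> {p<..<q}}"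
    by (rule E(2)) auto
  also have "\<dots> = annulus (2 * sqrt p) (2 * sqrt q)"
    by (intro set_eqI) (simp only: mem_Collect_eq greaterThanLessThan_iff annulus_def less_norm_sqrt_iff[OF p(1)] norm_less_sqrt_iff[OF q0])
  finally show "positivity_set (radial_extension {p<..<q} (shot p) :: real^'n \<Rightarrow> real) = annulus (2 * sqrt p) (2 * sqrt q)" .
qed

section \<open>Classification in dimension at least two\<close>

context
  fixes \<phi> :: "real^'n::finite \<Rightarrow> real"
  assumes b: "b = real CARD('n) / 2" and sol: "radial_solution_P \<phi>"
begin

interpretation kummer2_profile b "profile \<phi>" "profile1 \<phi>"
proof -
  interpret kummer_profile b "profile \<phi>" "profile1 \<phi>" using kummer_profileI[OF b sol] .
  show "kummer2_profile b (profile \<phi>) (profile1 \<phi>)" by unfold_locales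
qed

lemma profile_zero: "0 \<le> s \<Longrightarrow> \<not> 0 < profile \<phi> s \<Longrightarrow> profile \<phi> s = 0"
  using profile_nonneg[OF sol, of s] by simp

lemma classify_ball:
  assumes q: "0 < q" and I: "\<And>s. 0 \<le> s \<Longrightarrow> 0 < profile \<phi> s \<longleftrightarrow> s < q"
  shows "q = s0" "\<phi> = radial_extension {..<s0} ball_profile"
proof -
  have z: "profile \<phi> q = 0" using I[of q] profile_zero[of q] q by simp
  have pos: "0 < profile \<phi> 0" "\<And>s. 0 < s \<Longrightarrow> s < q \<Longrightarrow> 0 < profile \<phi> s" using I q by auto
  note B = profile_ball[OF q z pos profile_near_0[OF q pos(2)]]
  show qs: "q = s0" by (rule B(1)) auto
  show "\<phi> = radial_extension {..<s0} ball_profile"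
  proof (rule radial_extension_eqI[OF sol])
    show "0 < profile \<phi> s \<longleftrightarrow> s \<in> {..<s0}" if "0 \<le> s" for s using I[OF that] qs by simp
    show "profile \<phi> s = ball_profile s" if "0 \<le> s" "s \<in> {..<s0}" for s
      using that by (intro B(2)) auto
  qed
qed

lemma classify_annulus:
  assumes p: "0 < p" "p < q" and I: "\<And>s. 0 \<le> s \<Longrightarrow> 0 < profile \<phi> s \<longleftrightarrow> p < s \<and> s < q"
  shows "p < s_star" "s0 < q" "rho q = rho p" "flux p + flux q = 0"
    "\<phi> = radial_extension {p<..<q} (shot p)"
proof -
  have z: "profile \<phi> p = 0" "profile \<phi> q = 0" using I[of p] I[of q] profile_zero p by auto
  have pos: "\<And>s. p < s \<Longrightarrow> s < q \<Longrightarrow> 0 < profile \<phi> s" using I p by auto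
  note A = profile_annulus[OF p z pos]
  show "p < s_star" "s0 < q" "rho q = rho p" "flux p + flux q = 0" using A(1-4) by auto
  show "\<phi> = radial_extension {p<..<q} (shot p)"
    using I A(5) by (intro radial_extension_eqI[OF sol]) auto
qed

lemma classify_exterior:
  assumes p: "0 < p" and I: "\<And>s. 0 \<le> s \<Longrightarrow> 0 < profile \<phi> s \<longleftrightarrow> p < s"
  shows "s_star \<le> p" "\<phi> = radial_extension {p<..} (shot p)"
proof -
  have z: "profile \<phi> p = 0" using I[of p] profile_zero p by auto
  have pos: "\<And>s. p < s \<Longrightarrow> 0 < profile \<phi> s" using I p by auto
  note A = profile_exterior[OF p z pos]
  show "s_star \<le> p" using A(1) by auto
  show "\<phi> = radial_extension {p<..} (shot p)"
    using I A(2) by (intro radial_extension_eqI[OF sol]) auto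
qed

text \<open>The profile would be a multiple of \<open>B\<close> past \<open>s0\<close>, where
  \<open>B\<close> vanishes.\<close>

lemma not_everywhere_positive:
  assumes "\<And>s. 0 \<le> s \<Longrightarrow> 0 < profile \<phi> s" shows False
proof -
  have "profile \<phi> s0 = profile \<phi> 0 * B s0"
    using assms s0_pos by (intro profile_near_0(1)[of "s0 + 1"]) auto
  then show False using assms[of s0] s0_pos by (simp add: B_s0)
qed

lemma classify_connected:
  assumes "\<phi> \<noteq> (\<lambda>_. 0)" "connected (positivity_set \<phi>)"
  obtains "\<phi> = radial_extension {..<s0} ball_profile"
  | p q where "0 < p" "p < s_star" "s0 < q" "rho q = rho p" "flux p + flux q = 0"
      "\<phi> = radial_extension {p<..<q} (shot p)"
  | p where "s_star \<le> p" "\<phi> = radial_extension {p<..} (shot p)"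
proof -
  have ne: "{s. 0 \<le> s \<and> 0 < profile \<phi> s} \<noteq> {}" using profile_pos_exists[OF sol assms(1)] by auto
  have iff: "0 < profile \<phi> s \<longleftrightarrow> s \<in> S" if "{s. 0 \<le> s \<and> 0 < profile \<phi> s} = S" "0 \<le> s" for s S
    using that by auto
  show ?thesis
  proof (rule positive_part_cases[OF cont_g connected_profile_positive[OF sol assms(2)] ne])
    fix q :: real assume q: "0 < q" "{s. 0 \<le> s \<and> 0 < profile \<phi> s} = {0..<q}"
    then show ?thesis using classify_ball(2)[OF q(1)] iff[OF q(2)] that(1) by auto
  next
    assume "{s. 0 \<le> s \<and> 0 < profile \<phi> s} = {0..}"
    from iff[OF this] show ?thesis using not_everywhere_positive by auto
  next
    fix p q :: real assume pq: "0 \<le> p" "p < q" "{s. 0 \<le> s \<and> 0 < profile \<phi> s} = {p<..<q}"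
    have I: "0 < profile \<phi> s \<longleftrightarrow> p < s \<and> s < q" if "0 \<le> s" for s using iff[OF pq(3) that] by simp
    show ?thesis
    proof (cases "p = 0")
      case True
      then have "profile \<phi> 0 = 0" using I[of 0] profile_zero[of 0] by simp
      then show ?thesis using profile_not_positive_right_of_0[of q] I pq True by auto
    next
      case False
      then have "0 < p" using pq by simp
      then show ?thesis using classify_annulus[OF _ pq(2) I] that(2) by blast
    qed
  next
    fix p :: real assume p: "0 \<le> p" "{s. 0 \<le> s \<and> 0 < profile \<phi> s} = {p<..}"
    have I: "0 < profile \<phi> s \<longleftrightarrow> p < s" if "0 \<le> s" for s using iff[OF p(2) that] by simp
    show ?thesis
    proof (cases "p = 0")
      case True
      then have "profile \<phi> 0 = 0" using I[of 0] profile_zero[of 0] by simp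
      then show ?thesis using profile_not_positive_right_of_0[of 1] I True by auto
    next
      case False
      then have "0 < p" using p by simp
      then show ?thesis using classify_exterior[OF _ I] that(3) by blast
    qed
  qed
qed

end

end

section \<open>Dimension one: no annulus, one bounded solution\<close>

context kummer
begin

context
  fixes \<phi> :: "real^'n::finite \<Rightarrow> real"
  assumes n: "CARD('n) = 1" and b: "b = 1/2" and sol: "radial_solution_P \<phi>"
begin

interpretation kummer1_profile b "profile \<phi>" "profile1 \<phi>"
proof -
  interpret kummer_profile b "profile \<phi>" "profile1 \<phi>"
    by (rule kummer_profileI) (use n b sol in simp_all)
  show "kummer1_profile b (profile \<phi>) (profile1 \<phi>)" by unfold_locales (rule b)
qed

lemma positivity_set_not_annulus:
  assumes "0 < x" "x < y" shows "positivity_set \<phi> \<noteq> annulus x y"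
proof
  assume A: "positivity_set \<phi> = annulus x y"
  have y: "0 < y" using assms by simp
  have I: "0 < profile \<phi> s \<longleftrightarrow> x\<^sup>2 / 4 < s \<and> s < y\<^sup>2 / 4" if "0 \<le> s" for s
    using profile_annulus_set[OF A assms(1) y that] .
  have le: "x\<^sup>2 / 4 < y\<^sup>2 / 4" using assms by (simp add: power_strict_mono)
  have "profile \<phi> (x\<^sup>2 / 4) = 0" "profile \<phi> (y\<^sup>2 / 4) = 0"
    using I[of "x\<^sup>2 / 4"] I[of "y\<^sup>2 / 4"] profile_nonneg[OF sol] by (simp_all add: order_antisym_conv not_less)
  moreover have "0 < x\<^sup>2 / 4" using assms by simp
  moreover have "0 < profile \<phi> s" if "x\<^sup>2 / 4 < s" "s < y\<^sup>2 / 4" for s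
    using I[of s] that by (smt (verit) zero_le_power2 divide_nonneg_nonneg)
  ultimately show False using no_annulus le by blast
qed

text \<open>The positivity set is not assumed connected. A positive point above a zero would lie in
  a component \<open>(p, q)\<close>, bounded because the set is; \<open>no_annulus\<close> excludes
  \<open>p > 0\<close> and \<open>no_punctured_interval\<close> excludes \<open>p = 0\<close>. So
  the profile is positive exactly on an initial interval.\<close>

lemma bounded_solution_unique:
  assumes nz: "\<phi> \<noteq> (\<lambda>_. 0)" and bd: "bounded (positivity_set \<phi>)"
  shows "\<phi> = radial_extension {..<s0} ball_profile"
proof -
  let ?g = "profile \<phi>"
  have cont: "continuous_on S ?g" for S using sol by (rule continuous_on_profile)
  have zero: "?g s = 0" if "\<not> 0 < ?g s" for s
    using profile_nonneg[OF sol, of s] that by simp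
  obtain M where M: "\<And>y. y \<in> positivity_set \<phi> \<Longrightarrow> norm y \<le> M"
    using bd unfolding bounded_iff by blast
  have large: "\<exists>z>s. ?g z = 0" if "0 \<le> s" for s
  proof -
    \<comment> \<open>Chosen to make \<open>2 * sqrt z = norm (ray z)\<close> larger than the bound
      \<open>M\<close>.\<close>
    define z where "z = s + 1 + M\<^sup>2"
    have z: "s < z" "0 \<le> z" "M\<^sup>2 < z" using that by (simp_all add: z_def add_strict_increasing)
    have "\<not> 0 < ?g z"
    proof
      assume "0 < ?g z"
      then have "ray z \<in> positivity_set \<phi>" using profile_pos_iff[OF z(2)] by blast
      then have "2 * sqrt z \<le> M" using M norm_ray[OF z(2), where 'a='n] by metis
      then have "(2 * sqrt z)\<^sup>2 \<le> M\<^sup>2" using z(2) by (intro power_mono) auto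
      then show False using z by (simp add: power_mult_distrib)
    qed
    then show ?thesis using zero z(1) by blast
  qed
  have below: "0 < ?g z" if "0 \<le> z" "z < s" "0 < ?g s" for z s
  proof (rule ccontr)
    assume "\<not> 0 < ?g z"
    then have gz: "?g z = 0" by (rule zero)
    have zs: "?g s \<noteq> 0" "z \<le> s" using that by auto
    obtain p where p: "z \<le> p" "p < s" "?g p = 0" "\<And>t. p < t \<Longrightarrow> t \<le> s \<Longrightarrow> ?g t \<noteq> 0"
      using last_zero[OF cont gz zs] by blast
    have "0 \<le> s" using that by simp
    then obtain m where m: "s < m" "?g m = 0" using large by blast
    obtain q where q: "s < q" "?g q = 0" "\<And>t. s \<le> t \<Longrightarrow> t < q \<Longrightarrow> ?g t \<noteq> 0"
      using first_zero[OF cont m(2) zs(1) less_imp_le[OF m(1)]] by blast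
    have pos: "0 < ?g t" if "p < t" "t < q" for t
      using p(4)[of t] q(3)[of t] zero[of t] that by (cases "t \<le> s") auto
    show False
    proof (cases "p = 0")
      case True
      then show ?thesis using no_punctured_interval[of q] pos p q by auto
    next
      case False
      then show ?thesis using no_annulus[of p q] pos p q that by auto
    qed
  qed
  obtain s where s: "0 \<le> s" "0 < ?g s" using profile_pos_exists[OF sol nz] by blast
  obtain m where m: "s < m" "?g m = 0" using large[OF s(1)] by blast
  obtain q where q: "s < q" "?g q = 0" "\<And>t. s \<le> t \<Longrightarrow> t < q \<Longrightarrow> ?g t \<noteq> 0"
    using first_zero[OF cont m(2), of s] s m by auto
  have I: "0 < ?g t \<longleftrightarrow> t < q" if t: "0 \<le> t" for t
  proof
    show "t < q" if "0 < ?g t"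
      using below[of q t] that q(1,2) s(1) by (cases t q rule: linorder_cases) auto
    show "0 < ?g t" if "t < q"
      using below[of t s] q(3)[of t] zero[of t] that s t by (cases "t < s") auto
  qed
  have q0: "0 < q" using q s by simp
  have pos: "0 < ?g 0" "\<And>t. 0 < t \<Longrightarrow> t < q \<Longrightarrow> 0 < ?g t" using I q0 by auto
  note B = profile_ball_1[OF q0 q(2) pos profile_flat_at_0[OF sol pos(1)]]
  have qs: "q = s0" by (rule B(1)) auto
  show ?thesis
  proof (rule radial_extension_eqI[OF sol])
    show "0 < ?g t \<longleftrightarrow> t \<in> {..<s0}" if "0 \<le> t" for t using I[OF that] qs by simp
    show "?g t = ball_profile t" if "0 \<le> t" "t \<in> {..<s0}" for t
      using that by (intro B(2)) auto
  qed
qed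

end

end

lemma radial_solutions_dim_1:
  assumes n: "CARD('n::finite) = 1"
  shows "(\<nexists>(\<phi> :: real^'n \<Rightarrow> real) a b.
        radial_solution_P \<phi> \<and> 0 < a \<and> a < b \<and> positivity_set \<phi> = annulus a b) \<and>
     (\<exists>!\<phi> :: real^'n \<Rightarrow> real.
        radial_solution_P \<phi> \<and> \<phi> \<noteq> (\<lambda>_. 0) \<and> bounded (positivity_set \<phi>))"
proof -
  interpret kummer "1/2" by unfold_locales simp
  have b: "(1/2 :: real) = real CARD('n) / 2" using n by simp
  let ?\<phi> = "radial_extension {..<s0} ball_profile :: real^'n \<Rightarrow> real"
  note B = ball_solution[where 'n='n, OF b]
  have "0 \<in> positivity_set ?\<phi>" unfolding B(2) using s0_pos by simp
  then have nz: "?\<phi> \<noteq> (\<lambda>_. 0)" by (auto simp: positivity_set_def)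
  show ?thesis
  proof (intro conjI notI ex1I[of _ ?\<phi>])
    assume "\<exists>(\<phi> :: real^'n \<Rightarrow> real) a b. radial_solution_P \<phi> \<and> 0 < a \<and> a < b \<and> positivity_set \<phi> = annulus a b"
    then show False using positivity_set_not_annulus[OF n refl] by blast
  next
    show "radial_solution_P ?\<phi>" by (rule B(1))
    show "bounded (positivity_set ?\<phi>)" unfolding B(2) by simp
    show "?\<phi> = (\<lambda>_. 0) \<Longrightarrow> False" using nz by blast
    show "\<phi> = ?\<phi>" if "radial_solution_P \<phi> \<and> \<phi> \<noteq> (\<lambda>_. 0) \<and> bounded (positivity_set \<phi>)" for \<phi>
      using bounded_solution_unique[OF n refl] that by blast
  qed
qed

section \<open>Growth of the exterior solutions and assembly of the result\<close>

context kummer2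
begin

lemma shot_star_asymp:
  "((\<lambda>s. shot s_star s / sqrt s) \<longlongrightarrow> W s_star / (2 * sqrt s_star) * (B s_star * (2 / l))) at_top"
proof -
  have "((\<lambda>s. W s_star / (2 * sqrt s_star) * (B s_star * (U s / sqrt s)))
      \<longlongrightarrow> W s_star / (2 * sqrt s_star) * (B s_star * (2 / l))) at_top"
    by (intro tendsto_mult tendsto_const U_asymp)
  then show ?thesis by (simp add: shot_def P_def U_s_star)
qed

lemma sim_at_infinity_star:
  "sim_at_infinity (radial_extension {s_star<..} (shot s_star) :: real^'n::finite \<Rightarrow> real) (\<lambda>x. norm x)"
  unfolding sim_at_infinity_def
proof (intro exI conjI)
  \<comment> \<open>The last division by 2 converts \<open>sqrt s\<close> into
    \<open>|y| = 2 * sqrt s\<close>; \<open>B s_star\<close> is positive because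
    \<open>s_star < s0\<close>.\<close>
  show "0 < W s_star / (2 * sqrt s_star) * (B s_star * (2 / l)) / 2"
    using W_pos[OF s_star_pos] s_star_pos B_pos_iff[of s_star] s_star_less_s0 l_pos by simp
  show "((\<lambda>x :: real^'n. radial_extension {s_star<..} (shot s_star) x / norm x) \<longlongrightarrow>
      W s_star / (2 * sqrt s_star) * (B s_star * (2 / l)) / 2) at_infinity"
    by (rule radial_extension_quotient_limit[OF shot_star_asymp]) (simp add: real_sqrt_divide)
qed

text \<open>\<open>|y| powr (- (n + 1))\<close> equals
  \<open>2 powr (- (n + 1)) * s powr (- b - 1/2)\<close>, so the comparison function is the
  exponential rate of \<open>shot p\<close>. Its coefficient is positive because
  \<open>U p > 0\<close> beyond \<open>s_star\<close>.\<close>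

lemma sim_at_infinity_exterior:
  assumes b: "b = real CARD('n::finite) / 2" and p: "s_star < p"
  shows "sim_at_infinity (radial_extension {p<..} (shot p) :: real^'n \<Rightarrow> real)
    (\<lambda>x. exp ((norm x)\<^sup>2 / 4) * norm x powr (- (real CARD('n) + 1)))"
  unfolding sim_at_infinity_def
proof (intro exI conjI)
  let ?d = "2 powr (- (real CARD('n) + 1)) :: real"
  have p0: "0 < p" using p s_star_pos by simp
  show "0 < W p / (2 * sqrt p) * (U p * l) / ?d"
    using W_pos[OF p0] p0 U_pos_iff[OF p0] p l_pos by simp
  show "((\<lambda>x :: real^'n. radial_extension {p<..} (shot p) x / (exp ((norm x)\<^sup>2 / 4) * norm x powr (- (real CARD('n) + 1))))
      \<longlongrightarrow> W p / (2 * sqrt p) * (U p * l) / ?d) at_infinity"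
  proof (rule radial_extension_quotient_limit[OF shot_exp_asymp])
    fix y :: "real^'n" assume "y \<noteq> 0"
    let ?s = "(norm y)\<^sup>2 / 4" and ?k = "- (real CARD('n) + 1)"
    have s: "0 < ?s" using \<open>y \<noteq> 0\<close> by simp
    have "norm y powr ?k = (2 * sqrt ?s) powr ?k" by (simp add: real_sqrt_divide)
    also have "\<dots> = ?d * sqrt ?s powr ?k" by (rule powr_mult)
    also have "sqrt ?s powr ?k = ?s powr (1/2 * ?k)"
      using s by (simp only: powr_half_sqrt[symmetric] less_imp_le powr_powr)
    also have "1/2 * ?k = - b - 1/2" by (simp add: b field_simps)
    finally show "exp ?s * norm y powr ?k = ?d * (?s powr (- b - 1/2) * exp ?s)" by simp
  qed
qed

end

lemma radial_solutions_dim_ge_2: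
  assumes n: "CARD('n::finite) \<ge> 2"
  shows "(\<exists>r_minus r_star r_zero r_plus :: real.
        0 < r_minus \<and> r_minus < r_star \<and> r_star < r_zero \<and> r_zero < r_plus \<and>
        (\<exists>(\<phi>B :: real^'n \<Rightarrow> real) (\<phi>A :: real^'n \<Rightarrow> real) (\<phi>E :: real \<Rightarrow> real^'n \<Rightarrow> real).
           (radial_solution_P \<phi>B \<and> positivity_set \<phi>B = ball 0 r_zero \<and>
            (\<forall>\<phi>. radial_solution_P \<phi> \<and> (\<exists>R>0. positivity_set \<phi> = ball 0 R) \<longrightarrow> \<phi> = \<phi>B)) \<and>
           (radial_solution_P \<phi>A \<and> positivity_set \<phi>A = annulus r_minus r_plus \<and>
            (\<forall>\<phi>. radial_solution_P \<phi> \<and> (\<exists>a b. 0 < a \<and> a < b \<and> positivity_set \<phi> = annulus a b)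
                  \<longrightarrow> \<phi> = \<phi>A)) \<and>
           (\<forall>r\<ge>r_star.
              radial_solution_P (\<phi>E r) \<and> positivity_set (\<phi>E r) = - cball 0 r \<and>
              (\<forall>\<phi>. radial_solution_P \<phi> \<and> positivity_set \<phi> = - cball 0 r \<longrightarrow> \<phi> = \<phi>E r)) \<and>
           sim_at_infinity (\<phi>E r_star) (\<lambda>x. norm x) \<and>
           (\<forall>r>r_star. sim_at_infinity (\<phi>E r)
              (\<lambda>x. exp ((norm x)\<^sup>2 / 4) * norm x powr (- (real CARD('n) + 1)))) \<and>
           (\<forall>\<phi> :: real^'n \<Rightarrow> real.
              radial_solution_P \<phi> \<and> \<phi> \<noteq> (\<lambda>_. 0) \<and> connected (positivity_set \<phi>) \<longrightarrow>
              \<phi> = \<phi>B \<or> \<phi> = \<phi>A \<or> (\<exists>r\<ge>r_star. \<phi> = \<phi>E r))))"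
proof -
  define b where "b = real CARD('n) / 2"
  interpret kummer2 b by unfold_locales (use n in \<open>auto simp: b_def\<close>)
  obtain p q where pq: "0 < p" "p < s_star" "s0 < q" "rho q = rho p" "flux p + flux q = 0"
    using ex_annulus by blast
  let ?B = "radial_extension {..<s0} ball_profile :: real^'n \<Rightarrow> real"
  let ?A = "radial_extension {p<..<q} (shot p) :: real^'n \<Rightarrow> real"
  let ?E = "\<lambda>r. radial_extension {r\<^sup>2 / 4<..} (shot (r\<^sup>2 / 4)) :: real^'n \<Rightarrow> real"
  have A_unique: "x = p \<and> y = q" if "0 < x" "x < s_star" "s0 < y" "rho y = rho x" "flux x + flux y = 0" for x y
    using annulus_unique[OF that(1,2) pq(1,2) that(3-5) pq(3-5)] .
  have sq: "(2 * sqrt s)\<^sup>2 / 4 = s" if "0 < s" for s :: real using that by (simp add: power_mult_distrib)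
  have E: "s_star \<le> r\<^sup>2 / 4" "2 * sqrt (r\<^sup>2 / 4) = r" "0 < r" if "2 * sqrt s_star \<le> r" for r
  proof -
    have "0 \<le> 2 * sqrt s_star" using s_star_pos by simp
    then have "(2 * sqrt s_star)\<^sup>2 \<le> r\<^sup>2" using that by (intro power_mono)
    then show "s_star \<le> r\<^sup>2 / 4" using s_star_pos by (simp add: power_mult_distrib)
    have "0 < 2 * sqrt s_star" using s_star_pos by simp
    then show "0 < r" using that by linarith
    then show "2 * sqrt (r\<^sup>2 / 4) = r" by (simp add: real_sqrt_divide)
  qed
  show ?thesis
  \<comment> \<open>The radii are the zeros carried back by \<open>r = 2 * sqrt s\<close>. They are
    built from \<open>b\<close> alone and so depend only on the dimension.\<close>
  proof (rule exI[of _ "2 * sqrt p"], rule exI[of _ "2 * sqrt s_star"], rule exI[of _ "2 * sqrt s0"],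
      rule exI[of _ "2 * sqrt q"], intro conjI, goal_cases)
    case 5
    show ?case
    proof (rule exI[of _ ?B], rule exI[of _ ?A], rule exI[of _ ?E], intro conjI allI impI, goal_cases)
      case 1 show ?case by (rule ball_solution(1)[OF b_def])
    next
      case 2 show ?case by (rule ball_solution(2)[OF b_def])
    next
      case (3 \<phi>)
      then obtain R where R: "0 < R" "positivity_set \<phi> = ball 0 R" by blast
      have "0 < R\<^sup>2 / 4" using R by simp
      then show ?case
        using classify_ball(2)[OF b_def, of \<phi>] profile_ball_set[OF R(2,1)] 3 by blast
    next
      case 4 show ?case by (rule annulus_solution(1)[OF b_def pq])
    next
      case 5 show ?case by (rule annulus_solution(2)[OF b_def pq])
    next
      case (6 \<phi>)
      then obtain x y where xy: "0 < x" "x < y" "positivity_set \<phi> = annulus x y" and sol: "radial_solution_P \<phi>" by blast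
      have pos: "0 < x\<^sup>2 / 4" "x\<^sup>2 / 4 < y\<^sup>2 / 4" "0 < y" using xy by (auto intro: power_strict_mono)
      note C = classify_annulus[OF b_def sol pos(1,2) profile_annulus_set[OF xy(3,1) pos(3)]]
      have "x\<^sup>2 / 4 = p \<and> y\<^sup>2 / 4 = q" using C(1-4) pos(1) by (intro A_unique) auto
      then show ?case using C(5) by auto
    next
      case (7 r)
      then show ?case using exterior_solution(1)[OF b_def E(1)] by blast
    next
      case (8 r)
      then show ?case using exterior_solution(2)[where 'n='n, OF b_def E(1)[OF 8]] E(2)[OF 8] by simp
    next
      case (9 r \<phi>)
      have "0 < r\<^sup>2 / 4" using E(3)[OF 9(1)] by simp
      then show ?case
        using classify_exterior(2)[OF b_def, of \<phi>] profile_exterior_set[of \<phi> r] E(3)[OF 9(1)] 9(2) by blast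
    next
      case 10
      show ?case unfolding sq[OF s_star_pos] by (rule sim_at_infinity_star)
    next
      case (11 r)
      then have "(2 * sqrt s_star)\<^sup>2 < r\<^sup>2" using s_star_pos by (intro power_strict_mono) auto
      then have "s_star < r\<^sup>2 / 4" using s_star_pos by (simp add: power_mult_distrib)
      then show ?case by (rule sim_at_infinity_exterior[OF b_def])
    next
      case (12 \<phi>)
      then have sol: "radial_solution_P \<phi>" and nz: "\<phi> \<noteq> (\<lambda>_. 0)" "connected (positivity_set \<phi>)" by auto
      show ?case
      proof (rule classify_connected[OF b_def sol nz])
        assume "\<phi> = ?B" then show ?thesis by blast
      next
        fix x y assume xy: "0 < x" "x < s_star" "s0 < y" "rho y = rho x" "flux x + flux y = 0"
          "\<phi> = radial_extension {x<..<y} (shot x)"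
        then show ?thesis using A_unique[OF xy(1-5)] by auto
      next
        fix x assume x: "s_star \<le> x" "\<phi> = radial_extension {x<..} (shot x)"
        then have "\<phi> = ?E (2 * sqrt x)" "2 * sqrt s_star \<le> 2 * sqrt x" using sq[of x] s_star_pos by auto
        then show ?thesis by blast
      qed
    qed
  qed (use pq s_star_less_s0 in auto)
qed

theorem theorem1p3:
  "(CARD('n::finite) \<ge> 2 \<longrightarrow>
     (\<exists>r_minus r_star r_zero r_plus :: real.
        0 < r_minus \<and> r_minus < r_star \<and> r_star < r_zero \<and> r_zero < r_plus \<and>
        (\<exists>(\<phi>B :: real^'n \<Rightarrow> real) (\<phi>A :: real^'n \<Rightarrow> real) (\<phi>E :: real \<Rightarrow> real^'n \<Rightarrow> real).
           (radial_solution_P \<phi>B \<and> positivity_set \<phi>B = ball 0 r_zero \<and>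
            (\<forall>\<phi>. radial_solution_P \<phi> \<and> (\<exists>R>0. positivity_set \<phi> = ball 0 R) \<longrightarrow> \<phi> = \<phi>B)) \<and>
           (radial_solution_P \<phi>A \<and> positivity_set \<phi>A = annulus r_minus r_plus \<and>
            (\<forall>\<phi>. radial_solution_P \<phi> \<and> (\<exists>a b. 0 < a \<and> a < b \<and> positivity_set \<phi> = annulus a b)
                  \<longrightarrow> \<phi> = \<phi>A)) \<and>
           (\<forall>r\<ge>r_star.
              radial_solution_P (\<phi>E r) \<and> positivity_set (\<phi>E r) = - cball 0 r \<and>
              (\<forall>\<phi>. radial_solution_P \<phi> \<and> positivity_set \<phi> = - cball 0 r \<longrightarrow> \<phi> = \<phi>E r)) \<and>
           sim_at_infinity (\<phi>E r_star) (\<lambda>x. norm x) \<and>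
           (\<forall>r>r_star. sim_at_infinity (\<phi>E r)
              (\<lambda>x. exp ((norm x)\<^sup>2 / 4) * norm x powr (- (real CARD('n) + 1)))) \<and>
           (\<forall>\<phi> :: real^'n \<Rightarrow> real.
              radial_solution_P \<phi> \<and> \<phi> \<noteq> (\<lambda>_. 0) \<and> connected (positivity_set \<phi>) \<longrightarrow>
              \<phi> = \<phi>B \<or> \<phi> = \<phi>A \<or> (\<exists>r\<ge>r_star. \<phi> = \<phi>E r))))) \<and>
   (CARD('n) = 1 \<longrightarrow>
     (\<nexists>(\<phi> :: real^'n \<Rightarrow> real) a b.
        radial_solution_P \<phi> \<and> 0 < a \<and> a < b \<and> positivity_set \<phi> = annulus a b) \<and>
     (\<exists>!\<phi> :: real^'n \<Rightarrow> real.
        radial_solution_P \<phi> \<and> \<phi> \<noteq> (\<lambda>_. 0) \<and> bounded (positivity_set \<phi>)))"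
  by (intro conjI[OF impI impI] radial_solutions_dim_ge_2 radial_solutions_dim_1)

end
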